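(* There exists a unique pair of families $\{P^{+}_{\Lambda}(x;\mathbf t)\}_{\Lambda\in Z_{n,D}}$, $\{P^{-}_{\Lambda}(x;\mathbf t)\}_{\Lambda\in Z_{n,D}}$ of elements of $\Xi^{n,D}_{\mathscr A}$ satisfying the following properties. (i) For each $\Lambda\in Z_{n,D}$ and each sign $\pm$, $P^{\pm}_{\Lambda}(x;\mathbf t)$ can be expressed as $$P^{\pm}_{\Lambda}(x;\mathbf t)=s_{\Lambda}(x)+\sum_{\Lambda'\prec\Lambda}u^{\pm}_{\Lambda,\Lambda'}(\mathbf t)\,s_{\Lambda'}(x),$$ where $u^{\pm}_{\Lambda,\Lambda'}(\mathbf t)\in\mathscr A$, and $u^{\pm}_{\Lambda,\Lambda'}(\mathbf t)=0$ if $\Lambda'\sim\Lambda$. (ii) $\langle P^{+}_{\Lambda},P^{-}_{\Lambda'}\rangle=0$ if $\Lambda\not\sim\Lambda'$. (iii) $P^{\pm}_{\Lambda}(x;\mathbf 0)=s_{\Lambda}(x)$.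
   Context: **Symbols.** Let $r\ge 1$, $n\ge 0$. $\mathcal P_{N,r}$ is the set of $r$-partitions $\boldsymbol\lambda=(\lambda^{(1)},\dots,\lambda^{(r)})$ with $\sum_k|\lambda^{(k)}|=N$. Fix non-negative integers $\mathbf s=(s_1,\dots,s_r)$ and $e$ with $s_k\le e$ for all $k$, and an integer $0\le\alpha<r$. For $\mathbf m=(m_1,\dots,m_r)\in\mathbb Z_{\ge0}^r$ let $\tilde Z(\mathbf m)$ be the set of $\Lambda=(A^{(1)},\dots,A^{(r)})$, where $A^{(k)}=(a^{(k)}_1,\dots,a^{(k)}_{m_k})$ is a sequence of non-negative integers with $a^{(k)}_i-a^{(k)}_{i+1}\ge e$ and $a^{(k)}_{m_k}\ge s_k$. The shift sends $\Lambda\in\tilde Z(\mathbf m)$ to the element of $\tilde Z(m_1+1,\dots,m_r+1)$ whose $k$-th row is $(a^{(k)}_1+e,\dots,a^{(k)}_{m_k}+e,s_k)$. Symbols are classes for the equivalence relation generated by the shift; the defect of the class of $\Lambda\in\tilde Z(\mathbf m)$ is $\mathbf d=(d_1,\dots,d_r)$, $d_k=m_k-\min_j m_j$. Only defects with $\sum_k d_k\equiv\alpha\pmod r$ are considered. Let $\Lambda^0(\mathbf m)\in\tilde Z(\mathbf m)$ be the element whose $k$-th row has $i$-th entry $s_k+(m_k-i)e$. For a defect $\mathbf d$ put $c_k=d_k-1$ for $k\le\alpha$, $c_k=d_k$ for $k>\alpha$, $d'_k=c_k-\min_jc_j$, $f(\mathbf d)=\sum_{k\le\alpha}d'_k(d'_k-1)/2+\sum_{k>\alpha}d'_k(d'_k+1)/2$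 and $n'=n'(\mathbf d)=n-f(\mathbf d)$. If $n'\ge0$, for $\boldsymbol\lambda\in\mathcal P_{n',r}$ let $\Lambda(\boldsymbol\lambda)$ be the class of $\Lambda^0(\mathbf m)+\boldsymbol\lambda$ (entrywise sum, $\lambda^{(k)}$ padded with zeros to length $m_k$), where $\mathbf m$ has defect $\mathbf d$ and all $m_k\ge n'$. $Z_{n,\mathbf d}$ (symbols of rank $n$ and defect $\mathbf d$) is the set of these $\Lambda(\boldsymbol\lambda)$; $\boldsymbol\lambda\mapsto\Lambda(\boldsymbol\lambda)$ is a bijection $\mathcal P_{n',r}\to Z_{n,\mathbf d}$. Fix a (finite) set $D$ of defects with $Z_{n,\mathbf d}\neq\emptyset$, and put $Z_{n,D}=\coprod_{\mathbf d\in D}Z_{n,\mathbf d}$. $\Lambda\sim\Lambda'$ (similar) means that $\Lambda,\Lambda'$ have representatives whose multisets of all entries coincide. For a representative $\Lambda\in\tilde Z(\mathbf m)$ with $\sum_km_k=\alpha+rM$, $a(\Lambda)=\sum\min(a,a')-\sum\min(b,b')$, the first sum over unordered pairs of entries of $\Lambda$ at distinct positions, the second over those of $\Lambda^0(\mathbf m^\bullet)$, $\mathbf m^\bullet=(M+1,\dots,M+1,M,\dots,M)$ ($M+1$ occurring $\alpha$ times); this is shift invariant. Fix a total order $\preceq$ on $Z_{n,D}$ such that $\Lambda\prec\Lambda'$ whenever $a(\Lambda)>a(\Lambda')$, and each similarity class is an interval. **Symmetric functions.** $\mathbf t=(t_1,\dots,t_r)$ are indeterminates; superscripts $(k)$ and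 indices of $t_k$ are read modulo $r$. Let $x^{(k)}=(x^{(k)}_1,x^{(k)}_2,\dots)$, $1\le k\le r$, and let $\Xi^N$ be the degree $N$ part of the tensor product over $\mathbb Z$ of the rings of symmetric functions in $x^{(1)},\dots,x^{(r)}$. For $\boldsymbol\lambda\in\mathcal P_{N,r}$ let $s_{\boldsymbol\lambda}=\prod_ks_{\lambda^{(k)}}(x^{(k)})$, $m_{\boldsymbol\lambda}=\prod_km_{\lambda^{(k)}}(x^{(k)})$ (Schur and monomial symmetric functions). Define $q^{(k)}_{s,\pm}(x;t)$ by $\sum_{s\ge0}q^{(k)}_{s,\pm}(x;t)u^s=\prod_i\frac{1-tu\,x_i^{(k\mp1)}}{1-u\,x_i^{(k)}}$ and $q^{\pm}_{\boldsymbol\lambda}(x;\mathbf t)=\prod_{k}\prod_iq^{(k)}_{\lambda^{(k)}_i,\pm}(x;t_{k-c})$ with $c=1$ for $+$, $c=0$ for $-$. The $q^\pm_{\boldsymbol\lambda}$ form a $\mathbb Q(\mathbf t)$-basis of $\Xi^N\otimes\mathbb Q(\mathbf t)$, and a bilinear form on this space is defined by $\langle q^+_{\boldsymbol\lambda},m_{\boldsymbol\mu}\rangle=\delta_{\boldsymbol\lambda,\boldsymbol\mu}$. For each $\mathbf d\in D$ let $\hat\Xi^{n,\mathbf d}$ be a copy of $\Xi^n$ indexed by $\mathbf d$, fix an injective map $\theta_{\mathbf d}:\mathcal P_{n',r}\to\mathcal P_{n,r}$ ($n'=n'(\mathbf d)$), and let $\Theta_{\mathbf d}:\Xi^{n'}\to\hat\Xi^{n,\mathbf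 d}$ be the linear embedding $s_{\boldsymbol\lambda}\mapsto s_{\theta_{\mathbf d}(\boldsymbol\lambda)}$ (extended to any coefficients), with image $\Xi^{n,\mathbf d}$. For $\Lambda=\Lambda(\boldsymbol\lambda)\in Z_{n,\mathbf d}$ put $s_\Lambda=\Theta_{\mathbf d}(s_{\boldsymbol\lambda})$. Put $\Xi^{n,D}_{\mathbb Q}(\mathbf t)=\bigoplus_{\mathbf d\in D}\Xi^{n,\mathbf d}\otimes\mathbb Q(\mathbf t)$, with the bilinear form $\langle\ ,\ \rangle$ transported from $\Xi^{n'}\otimes\mathbb Q(\mathbf t)$ by $\Theta_{\mathbf d}$ on each summand, different summands being orthogonal. $\mathscr A\subset\mathbb Q(\mathbf t)$ is the subalgebra of rational functions without pole at $\mathbf t=\mathbf 0$, and $\Xi^{n,D}_{\mathscr A}$ is the $\mathscr A$-span of $\{s_\Lambda\mid\Lambda\in Z_{n,D}\}$; $P(x;\mathbf 0)$ denotes the specialization at $\mathbf t=\mathbf 0$ of $P\in\Xi^{n,D}_{\mathscr A}$. *)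

theory Defs
  imports
    "HOL-Library.Poly_Mapping"
    "HOL-Library.FuncSet"
    "HOL-Library.Multiset"
    "HOL-Computational_Algebra.Fraction_Field"
    "HOL-Computational_Algebra.Formal_Power_Series"
begin

(* Throughout, the indices k = 1,...,r are shifted to k = 0,...,r-1; hence "k \<le> \<alpha>"
   becomes "k < \<alpha>", and indices modulo r are represented in {..<r}. *)

section \<open>Partitions and symbols\<close>

definition partitions :: "nat list set" where
  "partitions = {p. sorted_wrt (\<ge>) p \<and> 0 \<notin> set p}"

definition mparts :: "nat \<Rightarrow> nat \<Rightarrow> nat list list set" where
  "mparts r N = {l. length l = r \<and> set l \<subseteq> partitions \<and> sum_list (map sum_list l) = N}"

definition Ztilde :: "(nat \<Rightarrow> nat) \<Rightarrow> nat \<Rightarrow> nat list \<Rightarrow> nat list list set" where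
  "Ztilde s e m = {X. map length X = m \<and>
     (\<forall>k<length X. (\<forall>i. Suc i < length (X!k) \<longrightarrow> X!k!Suc i + e \<le> X!k!i) \<and>
                   (X!k \<noteq> [] \<longrightarrow> s k \<le> last (X!k)))}"

definition shift :: "(nat \<Rightarrow> nat) \<Rightarrow> nat \<Rightarrow> nat list list \<Rightarrow> nat list list" where
  "shift s e X = map (\<lambda>k. map (\<lambda>a. a + e) (X!k) @ [s k]) [0..<length X]"

type_synonym symbol = "nat list list set"

(* For fixed r, s and e: the class of X under the equivalence relation generated by the shift on
   the union of all Ztilde s e m with length m = r. *)
definition symbol_class :: "nat \<Rightarrow> (nat \<Rightarrow> nat) \<Rightarrow> nat \<Rightarrow> nat list list \<Rightarrow> symbol" where
  "symbol_class r s e X =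
     {Y. equivclp (\<lambda>U V. (\<exists>m. length m = r \<and> U \<in> Ztilde s e m) \<and> V = shift s e U) X Y}"

definition defect :: "nat list \<Rightarrow> nat list" where
  "defect m = map (\<lambda>x. x - Min (set m)) m"

definition defects :: "nat \<Rightarrow> nat \<Rightarrow> nat list set" where
  "defects r \<alpha> = {d. (\<exists>m. length m = r \<and> d = defect m) \<and> sum_list d mod r = \<alpha> mod r}"

(* The quantities below that are invariant under the shift are computed on this representative. *)
definition symbol_rep :: "symbol \<Rightarrow> nat list list" where
  "symbol_rep \<Lambda> = (SOME X. X \<in> \<Lambda>)"

definition symbol_defect :: "symbol \<Rightarrow> nat list" where
  "symbol_defect \<Lambda> = defect (map length (symbol_rep \<Lambda>))"

definition Lambda0 :: "(nat \<Rightarrow> nat) \<Rightarrow> nat \<Rightarrow> nat list \<Rightarrow> nat list list" where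
  "Lambda0 s e m =
     map (\<lambda>k. map (\<lambda>i. s k + (m!k - i) * e) [1..<Suc (m!k)]) [0..<length m]"

definition add_mpart :: "nat list list \<Rightarrow> nat list list \<Rightarrow> nat list list" where
  "add_mpart X l = map (\<lambda>k. map (\<lambda>i. X!k!i + (if i < length (l!k) then l!k!i else 0))
                                [0..<length (X!k)]) [0..<length X]"

definition defect_c :: "nat \<Rightarrow> nat list \<Rightarrow> nat \<Rightarrow> int" where
  "defect_c \<alpha> d k = (if k < \<alpha> then int (d!k) - 1 else int (d!k))"

definition defect' :: "nat \<Rightarrow> nat \<Rightarrow> nat list \<Rightarrow> nat \<Rightarrow> nat" where
  "defect' r \<alpha> d k = nat (defect_c \<alpha> d k - Min (defect_c \<alpha> d ` {..<r}))"

(* The number f(d); both quotients are exact. *)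
definition defect_rank :: "nat \<Rightarrow> nat \<Rightarrow> nat list \<Rightarrow> nat" where
  "defect_rank r \<alpha> d =
     (\<Sum>k<\<alpha>. defect' r \<alpha> d k * (defect' r \<alpha> d k - 1) div 2) +
     (\<Sum>k=\<alpha>..<r. defect' r \<alpha> d k * (defect' r \<alpha> d k + 1) div 2)"

(* n' = n - f(d), only meaningful when f(d) \<le> n. *)
definition red_rank :: "nat \<Rightarrow> nat \<Rightarrow> nat \<Rightarrow> nat list \<Rightarrow> nat" where
  "red_rank r \<alpha> n d = n - defect_rank r \<alpha> d"

(* \<Lambda>(l) for an r-partition l of N = n'.  Since Min d = 0, the tuple m = d + (N,...,N) has defect d
   and all its entries are at least N; any other such m gives the same class. *)
definition symbol_of :: "nat \<Rightarrow> (nat \<Rightarrow> nat) \<Rightarrow> nat \<Rightarrow> nat \<Rightarrow> nat list \<Rightarrow> nat list list \<Rightarrow> symbol" where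
  "symbol_of r s e N d l =
     symbol_class r s e (add_mpart (Lambda0 s e (map (\<lambda>x. x + N) d)) l)"

definition symbols ::
  "nat \<Rightarrow> (nat \<Rightarrow> nat) \<Rightarrow> nat \<Rightarrow> nat \<Rightarrow> nat \<Rightarrow> nat list \<Rightarrow> symbol set" where
  "symbols r s e \<alpha> n d =
     (if defect_rank r \<alpha> d \<le> n
      then symbol_of r s e (red_rank r \<alpha> n d) d ` mparts r (red_rank r \<alpha> n d) else {})"

(* Symbols of different defect are different classes, so the coproduct is a union. *)
definition symbolsD ::
  "nat \<Rightarrow> (nat \<Rightarrow> nat) \<Rightarrow> nat \<Rightarrow> nat \<Rightarrow> nat \<Rightarrow> nat list set \<Rightarrow> symbol set" where
  "symbolsD r s e \<alpha> n D = (\<Union>d\<in>D. symbols r s e \<alpha> n d)"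

(* The r-partition l with \<Lambda> = \<Lambda>(l). *)
definition symbol_mpart ::
  "nat \<Rightarrow> (nat \<Rightarrow> nat) \<Rightarrow> nat \<Rightarrow> nat \<Rightarrow> nat \<Rightarrow> symbol \<Rightarrow> nat list list" where
  "symbol_mpart r s e \<alpha> n \<Lambda> =
     (let d = symbol_defect \<Lambda>; N = red_rank r \<alpha> n d
      in the_inv_into (mparts r N) (symbol_of r s e N d) \<Lambda>)"

definition similar :: "symbol \<Rightarrow> symbol \<Rightarrow> bool" where
  "similar \<Lambda> \<Lambda>' \<longleftrightarrow> (\<exists>X\<in>\<Lambda>. \<exists>Y\<in>\<Lambda>'. mset (concat X) = mset (concat Y))"

definition sum_min :: "nat list \<Rightarrow> nat" where
  "sum_min xs = (\<Sum>j<length xs. \<Sum>i<j. min (xs!i) (xs!j))"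

definition a_fun :: "nat \<Rightarrow> (nat \<Rightarrow> nat) \<Rightarrow> nat \<Rightarrow> nat \<Rightarrow> symbol \<Rightarrow> int" where
  "a_fun r s e \<alpha> \<Lambda> =
     (let X = symbol_rep \<Lambda>;
          M = (sum_list (map length X) - \<alpha>) div r;
          m = replicate \<alpha> (M + 1) @ replicate (r - \<alpha>) M
      in int (sum_min (concat X)) - int (sum_min (concat (Lambda0 s e m))))"

definition symbol_order ::
  "nat \<Rightarrow> (nat \<Rightarrow> nat) \<Rightarrow> nat \<Rightarrow> nat \<Rightarrow> symbol set \<Rightarrow> symbol rel \<Rightarrow> bool" where
  "symbol_order r s e \<alpha> Z R \<longleftrightarrow>
     linear_order_on Z R \<and>
     (\<forall>\<Lambda>\<in>Z. \<forall>\<Lambda>'\<in>Z. a_fun r s e \<alpha> \<Lambda> > a_fun r s e \<alpha> \<Lambda>' \<longrightarrow> (\<Lambda>, \<Lambda>') \<in> R \<and> \<Lambda> \<noteq> \<Lambda>') \<and>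
     (\<forall>\<Lambda>\<^sub>1\<in>Z. \<forall>\<Lambda>\<^sub>2\<in>Z. \<forall>\<Lambda>\<^sub>3\<in>Z. (\<Lambda>\<^sub>1, \<Lambda>\<^sub>2) \<in> R \<and> (\<Lambda>\<^sub>2, \<Lambda>\<^sub>3) \<in> R \<and> similar \<Lambda>\<^sub>1 \<Lambda>\<^sub>3 \<longrightarrow> similar \<Lambda>\<^sub>1 \<Lambda>\<^sub>2)"


section \<open>Formal power series in an arbitrary set of variables\<close>

typedef ('v, 'a) mfps = "UNIV :: (('v \<Rightarrow>\<^sub>0 nat) \<Rightarrow> 'a) set"
  morphisms mcoeff Abs_mfps ..

lemma mcoeff_Abs [simp]: "mcoeff (Abs_mfps f) = f"
  by (rule Abs_mfps_inverse) simp

lemma mfps_eqI: "(\<And>M. mcoeff f M = mcoeff g M) \<Longrightarrow> f = g"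
  by (metis mcoeff_inject ext)

definition antidiag :: "('v \<Rightarrow>\<^sub>0 nat) \<Rightarrow> (('v \<Rightarrow>\<^sub>0 nat) \<times> ('v \<Rightarrow>\<^sub>0 nat)) set" where
  "antidiag M = {(A, B). A + B = M}"

lemma finite_antidiag [simp]: "finite (antidiag M)"
proof -
  define b where "b = (\<Sum>x\<in>Poly_Mapping.keys M. Poly_Mapping.lookup M x)"
  let ?F = "{f. \<forall>x. (x \<in> Poly_Mapping.keys M \<longrightarrow> f x \<in> {..b}) \<and>
                  (x \<notin> Poly_Mapping.keys M \<longrightarrow> f x = (0::nat))}"
  have fin: "finite ?F"
    by (rule finite_set_of_finite_funs) auto
  have bound: "Poly_Mapping.lookup A \<in> ?F" if "A + B = M" for A B
  proof -
    have le: "Poly_Mapping.lookup A x \<le> Poly_Mapping.lookup M x" for x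
      using that by (auto simp: lookup_add)
    have "Poly_Mapping.lookup M x \<le> b" if "x \<in> Poly_Mapping.keys M" for x
      unfolding b_def by (rule member_le_sum) (use that in auto)
    then have "Poly_Mapping.lookup A x \<le> b" if "x \<in> Poly_Mapping.keys M" for x
      using le[of x] that by (meson le_trans)
    moreover have "Poly_Mapping.lookup A x = 0" if "x \<notin> Poly_Mapping.keys M" for x
      using le[of x] that by (simp add: in_keys_iff)
    ultimately show ?thesis by auto
  qed
  let ?h = "\<lambda>(A, B). (Poly_Mapping.lookup A, Poly_Mapping.lookup B) :: ('a \<Rightarrow> nat) \<times> ('a \<Rightarrow> nat)"
  have "?h ` antidiag M \<subseteq> ?F \<times> ?F"
    using bound by (force simp: antidiag_def add.commute)
  moreover have "inj_on ?h (antidiag M)"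
    by (auto simp: inj_on_def intro: poly_mapping_eqI)
  ultimately show ?thesis
    by (rule finite_imageD [OF finite_subset [OF _ finite_cartesian_product [OF fin fin]]])
qed

instantiation mfps :: (type, comm_ring_1) comm_ring_1
begin

definition "0 = Abs_mfps (\<lambda>M. 0)"
definition "1 = Abs_mfps (\<lambda>M. if M = 0 then 1 else 0)"
definition "f + g = Abs_mfps (\<lambda>M. mcoeff f M + mcoeff g M)"
definition "- f = Abs_mfps (\<lambda>M. - mcoeff f M)"
definition "f - g = Abs_mfps (\<lambda>M. mcoeff f M - mcoeff g M)"
definition "f * g = Abs_mfps (\<lambda>M. \<Sum>(A, B)\<in>antidiag M. mcoeff f A * mcoeff g B)"

instance
proof
  fix f g h :: "('a, 'b) mfps"
  show "f * g * h = f * (g * h)"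
  proof (rule mfps_eqI)
    fix M
    let ?t = "\<lambda>A B C. mcoeff f A * mcoeff g B * mcoeff h C"
    have "mcoeff (f * g * h) M =
        (\<Sum>p\<in>antidiag M. \<Sum>q\<in>antidiag (fst p). ?t (fst q) (snd q) (snd p))"
      by (simp add: times_mfps_def case_prod_unfold sum_distrib_right)
    also have "\<dots> = (\<Sum>(p, q)\<in>Sigma (antidiag M) (\<lambda>p. antidiag (fst p)). ?t (fst q) (snd q) (snd p))"
      by (rule sum.Sigma) auto
    also have "\<dots> = (\<Sum>(p, q)\<in>Sigma (antidiag M) (\<lambda>p. antidiag (snd p)). ?t (fst p) (fst q) (snd q))"
      by (rule sum.reindex_bij_witness
            [of _ "\<lambda>(p, q). ((fst p + fst q, snd q), (fst p, fst q))"
                  "\<lambda>(p, q). ((fst q, snd q + snd p), (snd q, snd p))"])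
         (auto simp: antidiag_def add.assoc)
    also have "\<dots> = (\<Sum>p\<in>antidiag M. \<Sum>q\<in>antidiag (snd p). ?t (fst p) (fst q) (snd q))"
      by (rule sum.Sigma [symmetric]) auto
    also have "\<dots> = mcoeff (f * (g * h)) M"
      by (simp add: times_mfps_def case_prod_unfold sum_distrib_left mult.assoc)
    finally show "mcoeff (f * g * h) M = mcoeff (f * (g * h)) M" .
  qed
  show "f * g = g * f"
  proof (rule mfps_eqI)
    fix M
    show "mcoeff (f * g) M = mcoeff (g * f) M"
      unfolding times_mfps_def mcoeff_Abs
      by (rule sum.reindex_bij_witness[of _ prod.swap prod.swap])
         (auto simp: antidiag_def add.commute mult.commute)
  qed
  show "1 * f = f"
  proof (rule mfps_eqI)
    fix M
    have "mcoeff (1 * f) M =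
        (\<Sum>p\<in>antidiag M. if p = (0, M) then mcoeff f M else 0)"
      unfolding times_mfps_def one_mfps_def mcoeff_Abs
      by (rule sum.cong) (auto simp: antidiag_def split: if_splits)
    also have "\<dots> = mcoeff f M"
      by (simp add: sum.delta) (simp add: antidiag_def)
    finally show "mcoeff (1 * f) M = mcoeff f M" .
  qed
  show "(f + g) * h = f * h + g * h"
    by (rule mfps_eqI)
       (simp add: times_mfps_def plus_mfps_def case_prod_unfold distrib_right sum.distrib)
  have "mcoeff (0 :: ('a, 'b) mfps) 0 \<noteq> mcoeff 1 0"
    by (simp add: zero_mfps_def one_mfps_def)
  then show "(0 :: ('a, 'b) mfps) \<noteq> 1" by metis
qed (rule mfps_eqI; simp add: plus_mfps_def zero_mfps_def uminus_mfps_def minus_mfps_def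
       add.assoc add.commute)+

end

definition mconst :: "'a::zero \<Rightarrow> ('v, 'a) mfps" where
  "mconst c = Abs_mfps (\<lambda>M. if M = 0 then c else 0)"

definition mvar :: "'v \<Rightarrow> ('v, 'a::zero_neq_one) mfps" where
  "mvar v = Abs_mfps (\<lambda>M. if M = Poly_Mapping.single v 1 then 1 else 0)"

definition mscale :: "'a::times \<Rightarrow> ('v, 'a) mfps \<Rightarrow> ('v, 'a) mfps" where
  "mscale c f = Abs_mfps (\<lambda>M. c * mcoeff f M)"

definition mmap :: "('a \<Rightarrow> 'b) \<Rightarrow> ('v, 'a) mfps \<Rightarrow> ('v, 'b) mfps" where
  "mmap h f = Abs_mfps (\<lambda>M. h (mcoeff f M))"

global_interpretation mfps: vector_space "mscale :: 'a::field \<Rightarrow> ('v, 'a) mfps \<Rightarrow> ('v, 'a) mfps"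
  by unfold_locales
     (rule mfps_eqI; simp add: mscale_def plus_mfps_def distrib_left distrib_right mult.assoc)+


section \<open>Symmetric functions in r families of variables\<close>

(* The variable (k, i) is the i-th variable (i = 0, 1, ...) of the family x^(k). *)
type_synonym 'a series = "(nat \<times> nat, 'a) mfps"

(* The degree N part, with coefficients in 'a, of the tensor product of the r rings of symmetric
   functions: homogeneous series that are symmetric in each of the families separately. *)
definition Xi :: "nat \<Rightarrow> nat \<Rightarrow> 'a::zero series set" where
  "Xi r N = {f. (\<forall>M. mcoeff f M \<noteq> 0 \<longrightarrow>
                    fst ` Poly_Mapping.keys M \<subseteq> {..<r} \<and>
                    (\<Sum>v\<in>Poly_Mapping.keys M. Poly_Mapping.lookup M v) = N) \<and>
                (\<forall>\<pi> M. (\<forall>k. bij (\<pi> k)) \<longrightarrow>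
                    mcoeff f (Poly_Mapping.map_key (\<lambda>(k, i). (k, \<pi> k i)) M) = mcoeff f M)}"

(* Semistandard tableaux of shape p, given by their rows. *)
definition ssyt :: "nat list \<Rightarrow> nat list list set" where
  "ssyt p = {T. map length T = p \<and> (\<forall>row\<in>set T. sorted row) \<and>
     (\<forall>i j. Suc i < length p \<longrightarrow> j < p!Suc i \<longrightarrow> T!i!j < T!Suc i!j)}"

definition tab_monom :: "nat \<Rightarrow> nat list list \<Rightarrow> nat \<times> nat \<Rightarrow>\<^sub>0 nat" where
  "tab_monom k T = sum_list (map (\<lambda>a. Poly_Mapping.single (k, a) 1) (concat T))"

(* The Schur function of p in x^(k), as the sum of x^T over the semistandard tableaux T. *)
definition schur1 :: "nat \<Rightarrow> nat list \<Rightarrow> 'a::comm_ring_1 series" where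
  "schur1 k p = Abs_mfps (\<lambda>M. of_nat (card {T \<in> ssyt p. tab_monom k T = M}))"

(* The monomial symmetric function of p in x^(k). *)
definition monom1 :: "nat \<Rightarrow> nat list \<Rightarrow> 'a::comm_ring_1 series" where
  "monom1 k p = Abs_mfps (\<lambda>M.
     if fst ` Poly_Mapping.keys M \<subseteq> {k} \<and>
        image_mset (Poly_Mapping.lookup M) (mset_set (Poly_Mapping.keys M)) = mset p
     then 1 else 0)"

definition schur :: "nat \<Rightarrow> nat list list \<Rightarrow> 'a::comm_ring_1 series" where
  "schur r l = (\<Prod>k<r. schur1 k (l!k))"

definition msym :: "nat \<Rightarrow> nat list list \<Rightarrow> 'a::comm_ring_1 series" where
  "msym r l = (\<Prod>k<r. monom1 k (l!k))"

(* k - 1 modulo r *)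
definition cpred :: "nat \<Rightarrow> nat \<Rightarrow> nat" where
  "cpred r k = nat ((int k - 1) mod int r)"

(* The factors i < n of the product over i of (1 - t u x^(k-1)_i) / (1 - u x^(k)_i), as a power
   series in u; 1 / (1 - u x) is written as a geometric series. *)
definition qplus_fin :: "nat \<Rightarrow> nat \<Rightarrow> 'a::comm_ring_1 \<Rightarrow> nat \<Rightarrow> 'a series fps" where
  "qplus_fin r k t n =
     (\<Prod>i<n. (1 - fps_const (mconst t * mvar (cpred r k, i)) * fps_X) *
             Abs_fps (\<lambda>j. mvar (k, i) ^ j))"

(* The infinite product is the coefficientwise limit of the finite ones; each coefficient is
   eventually constant. *)
definition qplus1 :: "nat \<Rightarrow> nat \<Rightarrow> 'a::comm_ring_1 \<Rightarrow> nat \<Rightarrow> 'a series" where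
  "qplus1 r k t j = Abs_mfps (\<lambda>M.
     THE c. \<forall>\<^sub>F n in sequentially. mcoeff (fps_nth (qplus_fin r k t n) j) M = c)"


section \<open>Rational functions in the indeterminates t\<close>

(* Fraction field of the polynomial ring over the rationals in the indeterminates t_0, t_1, ...;
   only t_0, ..., t_(r-1) are used, and polysT and ratA are restricted to them. *)
type_synonym polyT = "(nat \<Rightarrow>\<^sub>0 nat) \<Rightarrow>\<^sub>0 rat"
type_synonym ratT = "polyT fract"

definition tvar :: "nat \<Rightarrow> ratT" where
  "tvar k = Fraction_Field.Fract (Poly_Mapping.single (Poly_Mapping.single k 1) 1) 1"

definition polysT :: "nat \<Rightarrow> polyT set" where
  "polysT r = {p. \<forall>M\<in>Poly_Mapping.keys p. Poly_Mapping.keys M \<subseteq> {..<r}}"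

(* Value at t = 0, i.e. the constant coefficient. *)
definition poly_at0 :: "polyT \<Rightarrow> rat" where
  "poly_at0 p = Poly_Mapping.lookup p 0"

definition ratA :: "nat \<Rightarrow> ratT set" where
  "ratA r = {Fraction_Field.Fract p q | p q. p \<in> polysT r \<and> q \<in> polysT r \<and> poly_at0 q \<noteq> 0}"

definition rat_at0 :: "ratT \<Rightarrow> rat" where
  "rat_at0 f = (THE c. \<exists>p q. f = Fraction_Field.Fract p q \<and> poly_at0 q \<noteq> 0 \<and>
                             c = poly_at0 p / poly_at0 q)"


section \<open>The bilinear form\<close>

definition qplus :: "nat \<Rightarrow> nat list list \<Rightarrow> ratT series" where
  "qplus r l = (\<Prod>k<r. prod_list (map (qplus1 r k (tvar (cpred r k))) (l!k)))"

(* The bilinear form on the degree N part for which the bases qplus and msym are dual. *)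
definition pairing :: "nat \<Rightarrow> nat \<Rightarrow> ratT series \<Rightarrow> ratT series \<Rightarrow> ratT" where
  "pairing r N f g =
     (\<Sum>l\<in>mparts r N. mfps.representation (qplus r ` mparts r N) f (qplus r l) *
                      mfps.representation (msym r ` mparts r N) g (msym r l))"

(* The linear map with schur r l \<mapsto> schur r (th l) for l in mparts r N. *)
definition Theta :: "nat \<Rightarrow> nat \<Rightarrow> (nat list list \<Rightarrow> nat list list) \<Rightarrow>
    'a::field series \<Rightarrow> 'a series" where
  "Theta r N th f =
     (\<Sum>l\<in>mparts r N. mscale (mfps.representation (schur r ` mparts r N) f (schur r l))
                              (schur r (th l)))"

(* Elements of the direct sum over the defects d in D are finitely supported functions of d. *)
type_synonym 'a Dseries = "nat list \<Rightarrow>\<^sub>0 'a series"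

definition Dscale :: "'a::comm_ring_1 \<Rightarrow> 'a Dseries \<Rightarrow> 'a Dseries" where
  "Dscale c F = Poly_Mapping.map (mscale c) F"

definition schurD :: "nat \<Rightarrow> (nat \<Rightarrow> nat) \<Rightarrow> nat \<Rightarrow> nat \<Rightarrow> nat \<Rightarrow>
    (nat list \<Rightarrow> nat list list \<Rightarrow> nat list list) \<Rightarrow> symbol \<Rightarrow> 'a::field Dseries" where
  "schurD r s e \<alpha> n \<theta> \<Lambda> =
     (let d = symbol_defect \<Lambda>
      in Poly_Mapping.single d
           (Theta r (red_rank r \<alpha> n d) (\<theta> d) (schur r (symbol_mpart r s e \<alpha> n \<Lambda>))))"

definition pairingD :: "nat \<Rightarrow> nat \<Rightarrow> nat \<Rightarrow> nat list set \<Rightarrow>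
    (nat list \<Rightarrow> nat list list \<Rightarrow> nat list list) \<Rightarrow> ratT Dseries \<Rightarrow> ratT Dseries \<Rightarrow> ratT" where
  "pairingD r \<alpha> n D \<theta> F G =
     (\<Sum>d\<in>D. let N = red_rank r \<alpha> n d; inv = inv_into (Xi r N) (Theta r N (\<theta> d))
              in pairing r N (inv (Poly_Mapping.lookup F d)) (inv (Poly_Mapping.lookup G d)))"

definition XiA :: "nat \<Rightarrow> (nat \<Rightarrow> nat) \<Rightarrow> nat \<Rightarrow> nat \<Rightarrow> nat \<Rightarrow> nat list set \<Rightarrow>
    (nat list \<Rightarrow> nat list list \<Rightarrow> nat list list) \<Rightarrow> ratT Dseries set" where
  "XiA r s e \<alpha> n D \<theta> =
     {\<Sum>\<Lambda>\<in>symbolsD r s e \<alpha> n D. Dscale (c \<Lambda>) (schurD r s e \<alpha> n \<theta> \<Lambda>) | c.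
        \<forall>\<Lambda>\<in>symbolsD r s e \<alpha> n D. c \<Lambda> \<in> ratA r}"

(* P(x;0), with coefficients in the rational numbers. *)
definition spec0 :: "ratT Dseries \<Rightarrow> rat Dseries" where
  "spec0 P = Poly_Mapping.map (mmap rat_at0) P"

datatype sign = Plus | Minus

end

theory Submission
  imports Defs "HOL-Combinatorics.Permutations"
begin

text \<open>Everything rests on the Gram matrix \<open>G\<close> of the Schur basis. Let \<open>A\<close> be the ring of rational
functions without pole at \<open>t = 0\<close>: it is local, with residue map \<open>f \<mapsto> f(0)\<close>. At \<open>t = 0\<close> the
functions \<open>q\<^sup>+\<close> become products of complete symmetric functions, so that the form specialises
to Hall's scalar product, for which the Schur functions are orthonormal. Hence \<open>G\<close> has entries in
\<open>A\<close> and reduces to the identity matrix at \<open>t = 0\<close> (\<open>gram_matrix\<close>, \<open>pairing_schur_comb\<close>).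

For a symbol \<open>L\<close> let \<open>J(L)\<close> be the set of the symbols that precede \<open>L\<close> and are not similar to it.
As similarity classes are intervals of the order, \<open>L' \<in> J(L)\<close> implies \<open>J(L') \<subseteq> J(L)\<close>, and of two
symbols that are not similar one belongs to the \<open>J\<close> of the other (\<open>below_facts\<close>). Therefore, given
the triangular shape (i), the orthogonality (ii) says exactly that \<open>P\<^sup>+\<close> at \<open>L\<close> is orthogonal to
the Schur functions \<open>s\<close> at all \<open>L' \<in> J(L)\<close>, and that the same holds for \<open>P\<^sup>-\<close> on the other side
(\<open>orthogonal_imp_equations\<close>, \<open>equations_imp_orthogonal\<close>). For fixed \<open>L\<close> this is a square linear
system for the coefficients \<open>u\<close>, whose matrix is the restriction of \<open>G\<close> to \<open>J(L)\<close>. That matrix is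
the identity at \<open>t = 0\<close>, so it is invertible over \<open>A\<close> and the system has exactly one solution; its
right-hand side consists of off-diagonal entries of \<open>G\<close>, which vanish at \<open>t = 0\<close>, and so the
solution vanishes there as well. This is (iii) (\<open>block_orthogonalisation\<close>).

What remains is the orthonormality of the Schur functions at \<open>t = 0\<close>. Let \<open>K\<close> be the matrix of
Kostka numbers, so that \<open>s = K m\<close> for the monomial functions \<open>m\<close>. The claim amounts to
\<open>h = K\<^sup>T s\<close> for the products \<open>h\<close> of complete functions. A semistandard tableau is a chain of
horizontal strips (\<open>card_tableaux_below\<close>), and \<open>h = K\<^sup>T s\<close> is Pieri's rule applied repeatedly
(\<open>pieri_schur1\<close>, \<open>hsym_expand\<close>). Pieri's rule is proved by induction on the number of variables,
from the commutation of adding a strip with removing a strip (\<open>strip_commutation\<close>), which is a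
reflection of each row length in an interval. The symmetry of the Schur functions follows as well:
\<open>K\<close> is unitriangular, so they are combinations of products of complete functions
(\<open>schur1_in_Xi\<close>).\<close>

section \<open>Local subrings of a field and triangular systems\<close>

text \<open>A local ring inside a field, presented by its residue map: an element of \<open>A\<close> is a unit of \<open>A\<close> as
soon as its residue is non-zero. There are two instances: the rational functions without pole at
the origin, with evaluation at the origin, and a field with the identity map.\<close>
locale local_subring =
  fixes A :: "'a::field set" and \<rho> :: "'a \<Rightarrow> 'b::field"
  assumes one_mem: "1 \<in> A"
    and add_mem: "x \<in> A \<Longrightarrow> y \<in> A \<Longrightarrow> x + y \<in> A"
    and mult_mem: "x \<in> A \<Longrightarrow> y \<in> A \<Longrightarrow> x * y \<in> A"
    and uminus_mem: "x \<in> A \<Longrightarrow> - x \<in> A"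
    and inverse_mem: "x \<in> A \<Longrightarrow> \<rho> x \<noteq> 0 \<Longrightarrow> inverse x \<in> A"
    and res_one: "\<rho> 1 = 1"
    and res_add: "x \<in> A \<Longrightarrow> y \<in> A \<Longrightarrow> \<rho> (x + y) = \<rho> x + \<rho> y"
    and res_mult: "x \<in> A \<Longrightarrow> y \<in> A \<Longrightarrow> \<rho> (x * y) = \<rho> x * \<rho> y"
begin

lemma zero_mem: "0 \<in> A"
  using add_mem[OF one_mem uminus_mem[OF one_mem]] by simp

lemma diff_mem: "x \<in> A \<Longrightarrow> y \<in> A \<Longrightarrow> x - y \<in> A"
  using add_mem[OF _ uminus_mem, of x y] by simp

lemma res_zero: "\<rho> 0 = 0"
  using res_add[OF zero_mem zero_mem] by (metis add.right_neutral add_left_cancel)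

lemma res_uminus: "x \<in> A \<Longrightarrow> \<rho> (- x) = - \<rho> x"
  using res_add[of x "- x"] uminus_mem res_zero by (simp add: eq_neg_iff_add_eq_0 add.commute)

lemma res_diff: "x \<in> A \<Longrightarrow> y \<in> A \<Longrightarrow> \<rho> (x - y) = \<rho> x - \<rho> y"
  using res_add[of x "- y"] uminus_mem res_uminus by simp

lemma sum_mem: "(\<And>i. i \<in> I \<Longrightarrow> f i \<in> A) \<Longrightarrow> sum f I \<in> A"
  by (induction I rule: infinite_finite_induct) (auto simp: zero_mem add_mem)

lemma res_sum: "(\<And>i. i \<in> I \<Longrightarrow> f i \<in> A) \<Longrightarrow> \<rho> (sum f I) = (\<Sum>i\<in>I. \<rho> (f i))"
  by (induction I rule: infinite_finite_induct) (auto simp: res_zero res_add sum_mem)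

lemma of_nat_mem: "of_nat n \<in> A"
  by (induction n) (auto simp: zero_mem one_mem add_mem)

lemma res_of_nat: "\<rho> (of_nat n) = of_nat n"
  by (induction n) (auto simp: res_zero res_one res_add one_mem of_nat_mem)

lemma divide_mem: "x \<in> A \<Longrightarrow> y \<in> A \<Longrightarrow> \<rho> y \<noteq> 0 \<Longrightarrow> x / y \<in> A"
  by (simp add: divide_inverse mult_mem inverse_mem)

text \<open>Gaussian elimination. The pivot \<open>p\<close> is an index of largest rank: outside the diagonal its row has
residue \<open>0\<close>, so eliminating the unknown \<open>x p\<close> leaves all other residues unchanged, and the smaller
system is again unitriangular modulo the maximal ideal.\<close>
lemma triangular_solve:
  fixes \<phi> :: "'i \<Rightarrow> nat"
  assumes "finite I" "\<And>i j. i \<in> I \<Longrightarrow> j \<in> I \<Longrightarrow> g i j \<in> A"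
    "\<And>i. i \<in> I \<Longrightarrow> \<rho> (g i i) = 1"
    "\<And>i j. i \<in> I \<Longrightarrow> j \<in> I \<Longrightarrow> i \<noteq> j \<Longrightarrow> \<rho> (g i j) \<noteq> 0 \<Longrightarrow> \<phi> i < \<phi> j"
    "\<And>j. j \<in> I \<Longrightarrow> y j \<in> A"
  shows "\<exists>x. (\<forall>i\<in>I. x i \<in> A) \<and> (\<forall>j\<in>I. (\<Sum>i\<in>I. x i * g i j) = y j)"
  using assms
proof (induction I arbitrary: g y rule: finite_ranking_induct[where f = \<phi>])
  case empty
  then show ?case by auto
next
  case (insert p J)
  show ?case
  proof (cases "p \<in> J")
    case True
    then have eq: "insert p J = J" by auto
    show ?thesis unfolding eq using insert.IH[of g y] insert.prems by (auto simp: eq)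
  next
    case False
    let ?q = "g p p"
    have q: "?q \<in> A" "\<rho> ?q = 1" "?q \<noteq> 0"
      using insert.prems(1,2)[of p] res_zero by auto
    define g' where "g' i j = g i j - g i p * g p j / ?q" for i j
    define y' where "y' j = y j - y p * g p j / ?q" for j
    have mem: "g i p * g p j / ?q \<in> A" "g i j \<in> A" "g p j \<in> A" "g i p \<in> A" if "i \<in> J" "j \<in> J" for i j
      using that insert.prems(1) q by (auto intro!: divide_mem mult_mem)
    \<comment> \<open>maximality of the rank of the pivot\<close>
    have pj: "\<rho> (g p j) = 0" if "j \<in> J" for j
      using insert.prems(3)[of p j] insert.hyps(2)[OF that] that False by fastforce
    have res: "\<rho> (g' i j) = \<rho> (g i j)" if "i \<in> J" "j \<in> J" for i j
    proof -
      have "\<rho> (g i p * (g p j / ?q)) = \<rho> (g i p) * (\<rho> (g p j) * \<rho> (inverse ?q))"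
        unfolding divide_inverse using mem[OF that] q
        by (subst res_mult) (auto simp: res_mult inverse_mem mult_mem)
      then show ?thesis
        unfolding g'_def using mem[OF that] pj[OF that(2)] by (simp add: res_diff)
    qed
    have "\<exists>x. (\<forall>i\<in>J. x i \<in> A) \<and> (\<forall>j\<in>J. (\<Sum>i\<in>J. x i * g' i j) = y' j)"
    proof (rule insert.IH)
      show "g' i j \<in> A" if "i \<in> J" "j \<in> J" for i j
        unfolding g'_def using mem[OF that] by (intro diff_mem)
      show "y' j \<in> A" if "j \<in> J" for j
        unfolding y'_def using mem[of j j] that insert.prems(4) q by (auto intro!: diff_mem divide_mem mult_mem)
      show "\<rho> (g' i i) = 1" if "i \<in> J" for i
        using res[OF that that] insert.prems(2) that by simp
      show "\<phi> i < \<phi> j" if "i \<in> J" "j \<in> J" "i \<noteq> j" "\<rho> (g' i j) \<noteq> 0" for i j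
        using res[OF that(1,2)] insert.prems(3)[of i j] that by simp
    qed
    then obtain x where x: "\<forall>i\<in>J. x i \<in> A" "\<forall>j\<in>J. (\<Sum>i\<in>J. x i * g' i j) = y' j" by blast
    define x' where "x' = x(p := (y p - (\<Sum>i\<in>J. x i * g i p)) / ?q)"
    have x'J: "x' i = x i" if "i \<in> J" for i
      using that False by (auto simp: x'_def)
    have x'p: "x' p = (y p - (\<Sum>i\<in>J. x i * g i p)) / ?q"
      by (simp add: x'_def)
    have sumeq: "(\<Sum>i\<in>insert p J. x' i * g i j) = x' p * g p j + (\<Sum>i\<in>J. x i * g i j)" for j
      using False insert.hyps(1) x'J by simp
    have "x' i \<in> A" if "i \<in> insert p J" for i
      unfolding x'_def using that x(1) q insert.prems(1,4)
      by (auto intro!: divide_mem diff_mem sum_mem mult_mem)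
    moreover have "(\<Sum>i\<in>insert p J. x' i * g i j) = y j" if "j \<in> insert p J" for j
    proof (cases "j = p")
      case True
      then show ?thesis using q unfolding sumeq by (simp add: x'_def)
    next
      case False
      then have j: "j \<in> J" using that by simp
      have "(\<Sum>i\<in>J. x i * g' i j) = (\<Sum>i\<in>J. x i * g i j) - (\<Sum>i\<in>J. x i * g i p) * (g p j / ?q)"
        unfolding g'_def by (simp add: sum_subtractf sum_distrib_left sum_divide_distrib algebra_simps)
      then show ?thesis
        using x(2) j q unfolding sumeq x'p y'_def by (simp add: field_simps)
    qed
    ultimately show ?thesis by blast
  qed
qed

text \<open>Solving for the unit vectors gives a left inverse, and doing so for the transposed system gives a
right inverse; the two agree.\<close>
lemma triangular_inverse:
  fixes \<phi> :: "'i \<Rightarrow> nat"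
  assumes fin: "finite I" and mem: "\<And>i j. i \<in> I \<Longrightarrow> j \<in> I \<Longrightarrow> g i j \<in> A"
    and diag: "\<And>i. i \<in> I \<Longrightarrow> \<rho> (g i i) = 1"
    and tri: "\<And>i j. i \<in> I \<Longrightarrow> j \<in> I \<Longrightarrow> i \<noteq> j \<Longrightarrow> \<rho> (g i j) \<noteq> 0 \<Longrightarrow> \<phi> i < \<phi> j"
  obtains b where "\<And>i j. i \<in> I \<Longrightarrow> j \<in> I \<Longrightarrow> b i j \<in> A"
    and "\<And>i j. i \<in> I \<Longrightarrow> j \<in> I \<Longrightarrow> (\<Sum>k\<in>I. b i k * g k j) = (if i = j then 1 else 0)"
    and "\<And>i j. i \<in> I \<Longrightarrow> j \<in> I \<Longrightarrow> (\<Sum>k\<in>I. g i k * b k j) = (if i = j then 1 else 0)"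
proof -
  have "\<exists>x. (\<forall>j\<in>I. x j \<in> A) \<and> (\<forall>j\<in>I. (\<Sum>k\<in>I. x k * g k j) = (if i = j then 1 else 0))" for i
    by (rule triangular_solve[where \<phi> = \<phi>]) (use assms zero_mem one_mem in auto)
  then obtain b where b: "\<And>i. (\<forall>j\<in>I. b i j \<in> A) \<and> (\<forall>j\<in>I. (\<Sum>k\<in>I. b i k * g k j) = (if i = j then 1 else 0))"
    by metis
  obtain B where B: "\<And>i. i \<in> I \<Longrightarrow> \<phi> i \<le> B"
    using finite_imageI[OF fin, of \<phi>] by (auto simp: finite_nat_set_iff_bounded_le)
  \<comment> \<open>the transposed system is triangular for the reversed ranking\<close>
  have "\<exists>x. (\<forall>j\<in>I. x j \<in> A) \<and> (\<forall>j\<in>I. (\<Sum>k\<in>I. x k * g j k) = (if i = j then 1 else 0))" for i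
  proof (rule triangular_solve[where \<phi> = "\<lambda>i. B - \<phi> i"])
    show "B - \<phi> j < B - \<phi> k" if "j \<in> I" "k \<in> I" "j \<noteq> k" "\<rho> (g k j) \<noteq> 0" for j k
      using tri[of k j] that B[of j] by auto
  qed (use assms zero_mem one_mem in auto)
  then obtain c where c: "\<And>i. (\<forall>j\<in>I. c i j \<in> A) \<and> (\<forall>j\<in>I. (\<Sum>k\<in>I. c i k * g j k) = (if i = j then 1 else 0))"
    by metis
  have bc: "b i j = c j i" if "i \<in> I" "j \<in> I" for i j
  proof -
    have "b i j = (\<Sum>k\<in>I. b i k * (\<Sum>l\<in>I. c j l * g k l))"
      using c that fin by (subst sum.cong[OF refl, of _ _ "\<lambda>k. if j = k then b i k else 0"]) auto
    also have "\<dots> = (\<Sum>l\<in>I. c j l * (\<Sum>k\<in>I. b i k * g k l))"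
      by (simp add: sum_distrib_left algebra_simps) (rule sum.swap)
    also have "\<dots> = c j i"
      using b that fin by (subst sum.cong[OF refl, of _ _ "\<lambda>l. if i = l then c j l else 0"]) auto
    finally show ?thesis .
  qed
  show thesis
  proof (rule that[of b])
    show "(\<Sum>k\<in>I. g i k * b k j) = (if i = j then 1 else 0)" if "i \<in> I" "j \<in> I" for i j
    proof -
      have "(\<Sum>k\<in>I. g i k * b k j) = (\<Sum>k\<in>I. c j k * g i k)"
        using bc that by (intro sum.cong) auto
      then show ?thesis using c that by auto
    qed
  qed (use b in auto)
qed

text \<open>In the application \<open>y\<close> lists the values of the form on a Schur function \<open>s\<close> and the lower Schur
functions, and the equations say that \<open>s + (\<Sum>i\<in>J. u i * s\<^sub>i)\<close> is orthogonal to the latter. The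
solution is \<open>u = - y G\<^sup>-\<^sup>1\<close>, whose residue vanishes because that of \<open>y\<close> does.\<close>
lemma block_orthogonalisation:
  fixes G :: "'i \<Rightarrow> 'i \<Rightarrow> 'a"
  assumes fin: "finite J" and mem: "\<And>i j. i \<in> J \<Longrightarrow> j \<in> J \<Longrightarrow> G i j \<in> A"
    and res: "\<And>i j. i \<in> J \<Longrightarrow> j \<in> J \<Longrightarrow> \<rho> (G i j) = (if i = j then 1 else 0)"
    and y: "\<And>j. j \<in> J \<Longrightarrow> y j \<in> A" "\<And>j. j \<in> J \<Longrightarrow> \<rho> (y j) = 0"
  obtains u where "\<And>i. i \<in> J \<Longrightarrow> u i \<in> A" "\<And>i. i \<in> J \<Longrightarrow> \<rho> (u i) = 0"
    "\<And>j. j \<in> J \<Longrightarrow> y j + (\<Sum>i\<in>J. u i * G i j) = 0"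
    "\<And>v i. (\<And>j. j \<in> J \<Longrightarrow> y j + (\<Sum>i\<in>J. v i * G i j) = 0) \<Longrightarrow> i \<in> J \<Longrightarrow> v i = u i"
proof -
  obtain b where b: "\<And>i j. i \<in> J \<Longrightarrow> j \<in> J \<Longrightarrow> b i j \<in> A"
    and bg: "\<And>i j. i \<in> J \<Longrightarrow> j \<in> J \<Longrightarrow> (\<Sum>k\<in>J. b i k * G k j) = (if i = j then 1 else 0)"
    and gb: "\<And>i j. i \<in> J \<Longrightarrow> j \<in> J \<Longrightarrow> (\<Sum>k\<in>J. G i k * b k j) = (if i = j then 1 else 0)"
    by (rule triangular_inverse[of J G "\<lambda>_. 0"]) (use assms in \<open>auto split: if_splits\<close>)
  define u where "u i = - (\<Sum>j\<in>J. y j * b j i)" for i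
  show thesis
  proof (rule that[of u])
    show "u i \<in> A" if "i \<in> J" for i
      unfolding u_def using that b y by (auto intro!: uminus_mem sum_mem mult_mem)
    show "\<rho> (u i) = 0" if "i \<in> J" for i
      unfolding u_def using that b y by (auto simp: res_uminus res_sum res_mult sum_mem mult_mem)
    show "y j + (\<Sum>i\<in>J. u i * G i j) = 0" if "j \<in> J" for j
    proof -
      have "(\<Sum>i\<in>J. u i * G i j) = - (\<Sum>k\<in>J. y k * (\<Sum>i\<in>J. b k i * G i j))"
        unfolding u_def
        by (simp add: sum_distrib_left sum_distrib_right sum_negf mult.assoc) (rule sum.swap)
      also have "\<dots> = - y j"
        using bg that fin by (subst sum.cong[OF refl, of _ _ "\<lambda>k. if k = j then y k else 0"]) auto
      finally show ?thesis by simp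
    qed
    show "v i = u i" if v: "\<And>j. j \<in> J \<Longrightarrow> y j + (\<Sum>i\<in>J. v i * G i j) = 0" and i: "i \<in> J" for v i
    proof -
      have "(\<Sum>j\<in>J. - y j * b j i) = (\<Sum>j\<in>J. (\<Sum>k\<in>J. v k * G k j) * b j i)"
        using v by (intro sum.cong refl) (metis add_eq_0_iff)
      also have "\<dots> = (\<Sum>k\<in>J. v k * (\<Sum>j\<in>J. G k j * b j i))"
        by (simp add: sum_distrib_left sum_distrib_right mult.assoc) (rule sum.swap)
      also have "\<dots> = v i"
        using gb i fin by (subst sum.cong[OF refl, of _ _ "\<lambda>k. if k = i then v k else 0"]) auto
      finally show ?thesis by (simp add: u_def sum_negf)
    qed
  qed
qed

end

lemma local_subring_UNIV: "local_subring UNIV (\<lambda>x::'a::field. x)"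
  by unfold_locales auto


section \<open>Rational functions without pole at the origin\<close>

lemma zero_eq_add: "0 = a + b \<longleftrightarrow> a = 0 \<and> b = 0" for a b :: "'v \<Rightarrow>\<^sub>0 nat"
  by (auto simp: poly_mapping_eq_iff fun_eq_iff lookup_add)

lemma poly_at0_mult: "poly_at0 (p * q) = poly_at0 p * poly_at0 q"
proof -
  have "(\<Sum>b. Poly_Mapping.lookup q b when 0 = a + b) = (Poly_Mapping.lookup q 0 when a = 0)" for a
    by (cases "a = 0") (auto simp: when_def zero_eq_add)
  then show ?thesis
    by (simp add: poly_at0_def lookup_mult mult_when)
qed

lemma poly_at0_simps [simp]:
  "poly_at0 0 = 0" "poly_at0 1 = 1" "poly_at0 (p + q) = poly_at0 p + poly_at0 q"
  "poly_at0 (- p) = - poly_at0 p"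
  by (simp_all add: poly_at0_def lookup_add)

lemma polysT_closed:
  "0 \<in> polysT r" "1 \<in> polysT r"
  "p \<in> polysT r \<Longrightarrow> q \<in> polysT r \<Longrightarrow> p + q \<in> polysT r"
  "p \<in> polysT r \<Longrightarrow> - p \<in> polysT r"
proof -
  show "p + q \<in> polysT r" if "p \<in> polysT r" "q \<in> polysT r"
    using that Poly_Mapping.keys_add[of p q] unfolding polysT_def by blast
qed (auto simp: polysT_def)

lemma polysT_mult:
  assumes "p \<in> polysT r" "q \<in> polysT r" shows "p * q \<in> polysT r"
  unfolding polysT_def
proof (intro CollectI ballI)
  fix M assume "M \<in> Poly_Mapping.keys (p * q)"
  then obtain a b where M: "M = a + b" "a \<in> Poly_Mapping.keys p" "b \<in> Poly_Mapping.keys q"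
    using keys_mult[of p q] by blast
  have "Poly_Mapping.keys M \<subseteq> Poly_Mapping.keys a \<union> Poly_Mapping.keys b"
    unfolding M(1) by (rule Poly_Mapping.keys_add)
  then show "Poly_Mapping.keys M \<subseteq> {..<r}"
    using assms M(2,3) unfolding polysT_def by blast
qed

lemma rat_at0_Fract:
  assumes "poly_at0 q \<noteq> 0" shows "rat_at0 (Fraction_Field.Fract p q) = poly_at0 p / poly_at0 q"
  unfolding rat_at0_def
proof (rule the_equality)
  fix c assume "\<exists>p' q'. Fraction_Field.Fract p q = Fraction_Field.Fract p' q' \<and> poly_at0 q' \<noteq> 0 \<and> c = poly_at0 p' / poly_at0 q'"
  then obtain p' q' where *: "Fraction_Field.Fract p q = Fraction_Field.Fract p' q'" "poly_at0 q' \<noteq> 0"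
      "c = poly_at0 p' / poly_at0 q'" by blast
  have "q \<noteq> 0" "q' \<noteq> 0" using assms * by auto
  then have "p * q' = p' * q" using * by (simp add: eq_fract)
  then have "poly_at0 p * poly_at0 q' = poly_at0 p' * poly_at0 q" by (metis poly_at0_mult)
  then show "c = poly_at0 p / poly_at0 q" using assms * by (simp add: frac_eq_eq)
qed (use assms in blast)

lemma ratA_cases:
  assumes "x \<in> ratA r"
  obtains p q where "x = Fraction_Field.Fract p q" "p \<in> polysT r" "q \<in> polysT r"
    "poly_at0 q \<noteq> 0" "q \<noteq> 0" "rat_at0 x = poly_at0 p / poly_at0 q"
proof -
  from assms obtain p q where *: "x = Fraction_Field.Fract p q" "p \<in> polysT r" "q \<in> polysT r"
    "poly_at0 q \<noteq> 0" unfolding ratA_def by blast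
  have "q \<noteq> 0" using *(4) by auto
  then show thesis using that[OF *] rat_at0_Fract[OF *(4)] *(1) by metis
qed

lemma ratA_I:
  "p \<in> polysT r \<Longrightarrow> q \<in> polysT r \<Longrightarrow> poly_at0 q \<noteq> 0 \<Longrightarrow> Fraction_Field.Fract p q \<in> ratA r"
  unfolding ratA_def by blast

interpretation ratA: local_subring "ratA r" rat_at0 for r
proof
  have one: "(1::ratT) = Fraction_Field.Fract 1 1" by (simp add: One_fract_def)
  show "(1::ratT) \<in> ratA r" unfolding one by (rule ratA_I) (auto simp: polysT_closed)
  show "rat_at0 1 = 1" unfolding one by (subst rat_at0_Fract) auto
next
  fix x y assume "x \<in> ratA r" "y \<in> ratA r"
  from \<open>x \<in> ratA r\<close> obtain p q where x: "x = Fraction_Field.Fract p q" "p \<in> polysT r" "q \<in> polysT r"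
    "poly_at0 q \<noteq> 0" "q \<noteq> 0" "rat_at0 x = poly_at0 p / poly_at0 q" by (rule ratA_cases)
  from \<open>y \<in> ratA r\<close> obtain p' q' where y: "y = Fraction_Field.Fract p' q'" "p' \<in> polysT r" "q' \<in> polysT r"
    "poly_at0 q' \<noteq> 0" "q' \<noteq> 0" "rat_at0 y = poly_at0 p' / poly_at0 q'" by (rule ratA_cases)
  have add: "x + y = Fraction_Field.Fract (p * q' + p' * q) (q * q')" using x y by simp
  have mult: "x * y = Fraction_Field.Fract (p * p') (q * q')" using x y by simp
  show "x + y \<in> ratA r" "x * y \<in> ratA r" unfolding add mult
    using x y by (auto intro!: ratA_I polysT_mult polysT_closed simp: poly_at0_mult)
  show "rat_at0 (x + y) = rat_at0 x + rat_at0 y" "rat_at0 (x * y) = rat_at0 x * rat_at0 y"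
    unfolding x(6) y(6) unfolding add mult using x(4) y(4) by (auto simp: rat_at0_Fract poly_at0_mult field_simps)
next
  fix x assume "x \<in> ratA r"
  then obtain p q where x: "x = Fraction_Field.Fract p q" "p \<in> polysT r" "q \<in> polysT r"
    "poly_at0 q \<noteq> 0" "q \<noteq> 0" "rat_at0 x = poly_at0 p / poly_at0 q" by (rule ratA_cases)
  have "- x = Fraction_Field.Fract (- p) q" using x by simp
  then show "- x \<in> ratA r" using x by (auto intro!: ratA_I polysT_closed)
  assume "rat_at0 x \<noteq> 0"
  then have "inverse x = Fraction_Field.Fract q p" "poly_at0 p \<noteq> 0" using x by auto
  then show "inverse x \<in> ratA r" using x by (auto intro!: ratA_I)
qed

lemma tvar_mem: "k < r \<Longrightarrow> tvar k \<in> ratA r"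
  unfolding tvar_def by (rule ratA_I) (auto simp: polysT_def)

lemma rat_at0_tvar: "rat_at0 (tvar k) = 0"
proof -
  have "Poly_Mapping.single k (1::nat) \<noteq> 0" using lookup_single_eq[of k "1::nat"] by (metis lookup_zero zero_neq_one)
  then have "poly_at0 (Poly_Mapping.single (Poly_Mapping.single k 1) 1) = 0"
    unfolding poly_at0_def by (simp add: lookup_single when_def)
  then show ?thesis
    unfolding tvar_def by (simp add: rat_at0_Fract)
qed

section \<open>Horizontal strips\<close>

text \<open>A partition is represented by the function that lists its parts and is zero beyond its length, so
that partitions of different lengths can be compared row by row.\<close>

definition vanishes :: "nat \<Rightarrow> (nat \<Rightarrow> nat) \<Rightarrow> bool" where
  "vanishes L l \<longleftrightarrow> (\<forall>i\<ge>L. l i = 0)"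

definition fin_supp :: "(nat \<Rightarrow> nat) \<Rightarrow> bool" where
  "fin_supp l \<longleftrightarrow> (\<exists>L. vanishes L l)"

definition fsize :: "(nat \<Rightarrow> nat) \<Rightarrow> nat" where
  "fsize l = sum l {i. l i \<noteq> 0}"

text \<open>The skew shape \<open>l / m\<close> is a horizontal strip: the rows of \<open>m\<close> and \<open>l\<close> interlace. The condition
forces both functions to be weakly decreasing.\<close>
definition hstrip :: "(nat \<Rightarrow> nat) \<Rightarrow> (nat \<Rightarrow> nat) \<Rightarrow> bool" where
  "hstrip m l \<longleftrightarrow> (\<forall>i. l (Suc i) \<le> m i \<and> m i \<le> l i)"

definition add_strip :: "(nat \<Rightarrow> nat) \<Rightarrow> nat \<Rightarrow> (nat \<Rightarrow> nat) set" where
  "add_strip l b = {v. hstrip l v \<and> fsize v = fsize l + b}"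

definition remove_strip :: "(nat \<Rightarrow> nat) \<Rightarrow> nat \<Rightarrow> (nat \<Rightarrow> nat) set" where
  "remove_strip l a = {m. hstrip m l \<and> fsize l = fsize m + a}"

text \<open>The number of chains of shapes from the empty one to \<open>l\<close> in which step \<open>i < n\<close> adds a horizontal
strip with \<open>f i\<close> boxes, in other words the number of semistandard tableaux of shape \<open>l\<close> in which
each \<open>i < n\<close> occurs \<open>f i\<close> times (and nothing else occurs).\<close>
fun strip_chains :: "(nat \<Rightarrow> nat) \<Rightarrow> (nat \<Rightarrow> nat) \<Rightarrow> nat \<Rightarrow> nat" where
  "strip_chains l f 0 = of_bool (l = (\<lambda>_. 0))"
| "strip_chains l f (Suc n) = (\<Sum>m\<in>remove_strip l (f n). strip_chains m f n)"

lemma vanishes_mono: "vanishes L l \<Longrightarrow> L \<le> L' \<Longrightarrow> vanishes L' l"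
  by (auto simp: vanishes_def)

lemma fsize_eq: "vanishes L l \<Longrightarrow> fsize l = (\<Sum>i<L. l i)"
  unfolding fsize_def by (rule sum.mono_neutral_left) (auto simp: vanishes_def not_less[symmetric])

lemma hstrip_vanishes_lower: "hstrip m l \<Longrightarrow> vanishes L l \<Longrightarrow> vanishes L m"
  unfolding hstrip_def vanishes_def by (metis le_zero_eq)

lemma hstrip_vanishes_upper: "hstrip m l \<Longrightarrow> vanishes L m \<Longrightarrow> vanishes (Suc L) l"
  unfolding hstrip_def vanishes_def by (metis Suc_le_D Suc_le_mono le_zero_eq)

lemma hstrip_antimono_upper: "hstrip m l \<Longrightarrow> antimono l"
  unfolding hstrip_def antimono_iff_le_Suc by (meson le_trans)

lemma hstrip_antimono_lower: "hstrip m l \<Longrightarrow> antimono m"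
  unfolding hstrip_def antimono_iff_le_Suc by (meson le_trans)

lemma hstrip_fsize: "hstrip m l \<Longrightarrow> vanishes L l \<Longrightarrow> fsize m \<le> fsize l"
  using hstrip_vanishes_lower[of m l L] by (auto simp: fsize_eq hstrip_def intro!: sum_mono)

lemma finite_bounded_functions: "finite {l. vanishes L l \<and> (\<forall>i. l i \<le> B)}"
proof (rule finite_subset)
  show "{l. vanishes L l \<and> (\<forall>i. l i \<le> B)} \<subseteq> {f. \<forall>x. (x \<in> {..<L} \<longrightarrow> f x \<in> {..B}) \<and> (x \<notin> {..<L} \<longrightarrow> f x = 0)}"
    by (auto simp: vanishes_def)
  show "finite \<dots>" by (rule finite_set_of_finite_funs) auto
qed

lemma le_fsize: "vanishes L l \<Longrightarrow> l i \<le> fsize l"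
  by (cases "i < L") (auto simp: fsize_eq vanishes_def intro: member_le_sum)

lemma finite_fsize: "finite {l. vanishes L l \<and> fsize l = b}"
  by (rule finite_subset[OF _ finite_bounded_functions[of L b]]) (use le_fsize in auto)

lemma finite_add_strip: "fin_supp l \<Longrightarrow> finite (add_strip l b)"
proof -
  assume "fin_supp l"
  then obtain L where "vanishes L l" by (auto simp: fin_supp_def)
  then have "add_strip l b \<subseteq> {v. vanishes (Suc L) v \<and> fsize v = fsize l + b}"
    using hstrip_vanishes_upper by (auto simp: add_strip_def)
  then show ?thesis using finite_fsize finite_subset by blast
qed

lemma finite_remove_strip: "fin_supp l \<Longrightarrow> finite (remove_strip l b)"
proof -
  assume "fin_supp l"
  then obtain L where "vanishes L l" by (auto simp: fin_supp_def)
  then have "remove_strip l b \<subseteq> {m. vanishes L m \<and> (\<forall>i. m i \<le> fsize l)}"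
    using hstrip_vanishes_lower[of _ l L] le_fsize[of L l] by (auto simp: remove_strip_def hstrip_def intro: le_trans)
  then show ?thesis using finite_bounded_functions finite_subset by blast
qed

lemma add_strip_fin_supp: "fin_supp l \<Longrightarrow> v \<in> add_strip l b \<Longrightarrow> fin_supp v"
  using hstrip_vanishes_upper by (auto simp: fin_supp_def add_strip_def)

lemma remove_strip_fin_supp: "fin_supp l \<Longrightarrow> m \<in> remove_strip l b \<Longrightarrow> fin_supp m"
  using hstrip_vanishes_lower by (auto simp: fin_supp_def remove_strip_def)

lemma strip_chains_cong: "(\<And>i. i < n \<Longrightarrow> f i = g i) \<Longrightarrow> strip_chains l f n = strip_chains l g n"
  by (induction n arbitrary: l) auto

text \<open>Each \<open>v (Suc i)\<close> is the mirror image of \<open>k i\<close> in the interval from \<open>max (l (Suc i)) (m (Suc i))\<close> to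
\<open>min (l i) (m i)\<close>. The end points of all these intervals, together with \<open>max (l 0) (m 0)\<close>, add up to
the sum of the sizes of \<open>l\<close> and \<open>m\<close>, because \<open>max a b + min a b = a + b\<close>.\<close>
lemma growth_size:
  assumes "fin_supp l" "fin_supp m"
    and k: "\<And>i. max (l (Suc i)) (m (Suc i)) \<le> k i" "\<And>i. k i \<le> min (l i) (m i)"
    and v: "\<And>i. v (Suc i) + k i = max (l (Suc i)) (m (Suc i)) + min (l i) (m i)"
    and v0: "v 0 = j + max (l 0) (m 0)"
  shows "fsize v + fsize k = j + fsize l + fsize m"
proof -
  obtain L1 L2 where "vanishes L1 l" "vanishes L2 m" using assms(1,2) by (auto simp: fin_supp_def)
  then obtain L where L: "vanishes L l" "vanishes L m"
    using vanishes_mono[of L1 l "max L1 L2"] vanishes_mono[of L2 m "max L1 L2"] by auto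
  have Lk: "vanishes L k"
    unfolding vanishes_def
  proof (intro allI impI)
    fix i assume "L \<le> i" then show "k i = 0" using k(2)[of i] L by (auto simp: vanishes_def)
  qed
  have Lv: "vanishes (Suc L) v"
    unfolding vanishes_def
  proof (intro allI impI)
    fix i assume "Suc L \<le> i"
    then obtain i' where "i = Suc i'" "L \<le> i'" by (cases i) auto
    then show "v i = 0" using v[of i'] k[of i'] L by (auto simp: vanishes_def)
  qed
  have max_min: "max (l i) (m i) + min (l i) (m i) = l i + m i" for i
    by (simp add: max_def min_def)
  have "fsize v + fsize k = v 0 + (\<Sum>i<L. v (Suc i) + k i)"
    unfolding fsize_eq[OF Lv] fsize_eq[OF Lk] by (simp add: sum.lessThan_Suc_shift sum.distrib del: sum.lessThan_Suc)
  also have "\<dots> = j + (\<Sum>i<Suc L. max (l i) (m i)) + (\<Sum>i<L. min (l i) (m i))"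
    by (simp add: v v0 sum.lessThan_Suc_shift sum.distrib del: sum.lessThan_Suc)
  also have "\<dots> = j + (\<Sum>i<L. max (l i) (m i) + min (l i) (m i))"
    using L by (simp add: vanishes_def sum.distrib)
  also have "\<dots> = j + (\<Sum>i<L. l i + m i)"
    using max_min by simp
  also have "\<dots> = j + fsize l + fsize m"
    by (simp add: fsize_eq[OF L(1)] fsize_eq[OF L(2)] sum.distrib)
  finally show ?thesis .
qed

text \<open>Adding a strip to \<open>l\<close> and then removing one, with result \<open>m\<close>, amounts to removing one and then adding
one, up to \<open>j\<close> boxes by which both strips are shortened. For given \<open>l\<close> and \<open>m\<close>, the row
\<open>v (Suc i)\<close> of a shape \<open>v\<close> above both and the row \<open>k i\<close> of a shape \<open>k\<close> below both range over the same
interval, independently for each \<open>i\<close>; only the first row of \<open>v\<close> is unbounded, and its excess is \<open>j\<close>.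
The sizes match after reflecting every interval (\<open>growth_size\<close>). In terms of generating functions
this is the relation \<open>D(y) U(x) = U(x) D(y) / (1 - x y)\<close> for the operators \<open>U\<close> and \<open>D\<close> that add
and remove strips.\<close>
lemma strip_commutation:
  fixes w :: "(nat \<Rightarrow> nat) \<Rightarrow> 'a::comm_monoid_add"
  assumes l: "fin_supp l"
  shows "(\<Sum>v\<in>add_strip l b. \<Sum>m\<in>remove_strip v c. w m) =
    (\<Sum>j\<le>min b c. \<Sum>k\<in>remove_strip l (c - j). \<Sum>m\<in>add_strip k (b - j). w m)"
proof -
  \<comment> \<open>a row length and its mirror image add up to \<open>refl m i\<close>; \<open>dn\<close> and \<open>up\<close> reflect in the two directions\<close>
  define refl :: "(nat \<Rightarrow> nat) \<Rightarrow> nat \<Rightarrow> nat"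
    where "refl m i = max (l (Suc i)) (m (Suc i)) + min (l i) (m i)" for m i
  define dn where "dn v m = (\<lambda>i. refl m i - v (Suc i))" for v m
  define up where "up j k m = case_nat (j + max (l 0) (m 0)) (\<lambda>i. refl m i - k i)" for j k m
  let ?L = "SIGMA v:add_strip l b. remove_strip v c"
  let ?R = "SIGMA j:{..min b c}. SIGMA k:remove_strip l (c - j). add_strip k (b - j)"
  have "(\<Sum>v\<in>add_strip l b. \<Sum>m\<in>remove_strip v c. w m) = (\<Sum>(v, m)\<in>?L. w m)"
    using finite_add_strip[OF l] finite_remove_strip[OF add_strip_fin_supp[OF l]] by (intro sum.Sigma) auto
  also have "\<dots> = (\<Sum>(j, k, m)\<in>?R. w m)"
  proof (rule sum.reindex_bij_witness[of _ "\<lambda>(j, k, m). (up j k m, m)" "\<lambda>(v, m). (v 0 - max (l 0) (m 0), dn v m, m)"])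
    fix p assume "p \<in> ?L"
    then obtain v m where p: "p = (v, m)" and v: "v \<in> add_strip l b" and m: "m \<in> remove_strip v c" by auto
    have hs: "l i \<le> v i" "v (Suc i) \<le> l i" "m i \<le> v i" "v (Suc i) \<le> m i" for i
      using v m by (auto simp: add_strip_def remove_strip_def hstrip_def)
    have fm: "fin_supp m" using remove_strip_fin_supp[OF add_strip_fin_supp[OF l v] m] .
    define k where "k = dn v m"
    have k: "max (l (Suc i)) (m (Suc i)) \<le> k i" "k i \<le> min (l i) (m i)"
        "v (Suc i) + k i = max (l (Suc i)) (m (Suc i)) + min (l i) (m i)" for i
      using hs(1,3)[of "Suc i"] hs(2,4)[of i] by (auto simp: k_def dn_def refl_def)
    define j where "j = v 0 - max (l 0) (m 0)"
    have j: "v 0 = j + max (l 0) (m 0)" using hs(1,3)[of 0] by (auto simp: j_def)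
    have size: "fsize v + fsize k = j + fsize l + fsize m"
      by (rule growth_size[OF l fm k(1,2,3) j])
    have hk: "hstrip k l" "hstrip k m" using k by (auto simp: hstrip_def)
    then have "fsize k \<le> fsize l" "fsize k \<le> fsize m"
      using l fm hstrip_fsize by (auto simp: fin_supp_def)
    then have in_R: "j \<le> min b c" "k \<in> remove_strip l (c - j)" "m \<in> add_strip k (b - j)"
      using size v m hk by (auto simp: add_strip_def remove_strip_def)
    have "refl m i - k i = v (Suc i)" for i
      using k(3)[of i] by (simp add: refl_def)
    then have "up j k m i = v i" for i
      unfolding up_def using j by (cases i) simp_all
    then show "(\<lambda>(j, k, m). (up j k m, m)) ((\<lambda>(v, m). (v 0 - max (l 0) (m 0), dn v m, m)) p) = p"
      unfolding p j_def k_def by auto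
    show "(\<lambda>(v, m). (v 0 - max (l 0) (m 0), dn v m, m)) p \<in> ?R"
      using in_R unfolding p j_def k_def by auto
    show "(case (\<lambda>(v, m). (v 0 - max (l 0) (m 0), dn v m, m)) p of (j, k, m) \<Rightarrow> w m) = (case p of (v, m) \<Rightarrow> w m)"
      unfolding p by simp
  next
    fix p assume "p \<in> ?R"
    then obtain j k m where p: "p = (j, k, m)" and j: "j \<le> b" "j \<le> c"
      and k: "k \<in> remove_strip l (c - j)" and m: "m \<in> add_strip k (b - j)" by auto
    have hs: "k i \<le> l i" "l (Suc i) \<le> k i" "k i \<le> m i" "m (Suc i) \<le> k i" for i
      using k m by (auto simp: add_strip_def remove_strip_def hstrip_def)
    have fm: "fin_supp m" using add_strip_fin_supp[OF remove_strip_fin_supp[OF l k] m] .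
    define v where "v = up j k m"
    have v: "v 0 = j + max (l 0) (m 0)" "v (Suc i) = refl m i - k i" for i
      by (auto simp: v_def up_def)
    have k': "max (l (Suc i)) (m (Suc i)) \<le> k i" "k i \<le> min (l i) (m i)"
        "v (Suc i) + k i = max (l (Suc i)) (m (Suc i)) + min (l i) (m i)" for i
      using hs[of i] by (auto simp: v refl_def)
    have size: "fsize v + fsize k = j + fsize l + fsize m"
      by (rule growth_size[OF l fm k' v(1)])
    have "l i \<le> v i \<and> m i \<le> v i" for i
      using v(1) k'(2,3)[of "i - 1"] by (cases i) auto
    moreover have "v (Suc i) \<le> l i \<and> v (Suc i) \<le> m i" for i
      using k'(1,3)[of i] by auto
    ultimately have hv: "hstrip l v" "hstrip m v" by (auto simp: hstrip_def)
    have in_L: "v \<in> add_strip l b" "m \<in> remove_strip v c"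
      using hv size k m j by (auto simp: add_strip_def remove_strip_def)
    show "(\<lambda>(j, k, m). (up j k m, m)) p \<in> ?L"
      using in_L unfolding p v_def by auto
    have "refl m i - v (Suc i) = k i" for i using k'(3)[of i] by (simp add: refl_def)
    then have "dn v m = k" unfolding dn_def by auto
    then show "(\<lambda>(v, m). (v 0 - max (l 0) (m 0), dn v m, m)) ((\<lambda>(j, k, m). (up j k m, m)) p) = p"
      using v(1) unfolding p by (simp add: v_def[symmetric])
  qed
  also have "\<dots> = (\<Sum>j\<le>min b c. \<Sum>(k, m)\<in>(SIGMA k:remove_strip l (c - j). add_strip k (b - j)). w m)"
    using finite_remove_strip[OF l] finite_add_strip[OF remove_strip_fin_supp[OF l]]
    by (intro sum.Sigma[symmetric]) auto
  also have "\<dots> = (\<Sum>j\<le>min b c. \<Sum>k\<in>remove_strip l (c - j). \<Sum>m\<in>add_strip k (b - j). w m)"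
    using finite_remove_strip[OF l] finite_add_strip[OF remove_strip_fin_supp[OF l]]
    by (intro sum.cong HOL.refl sum.Sigma[symmetric]) auto
  finally show ?thesis .
qed

text \<open>The exponents of those monomials of degree \<open>b\<close> in \<open>n\<close> variables that divide the monomial with
exponents \<open>f\<close>.\<close>
definition exps_below :: "(nat \<Rightarrow> nat) \<Rightarrow> nat \<Rightarrow> nat \<Rightarrow> (nat \<Rightarrow> nat) set" where
  "exps_below f n b = {g. (\<forall>i<n. g i \<le> f i) \<and> vanishes n g \<and> (\<Sum>i<n. g i) = b}"

lemma finite_exps_below: "finite (exps_below f n b)"
  by (rule finite_subset[OF _ finite_fsize[of n b]]) (auto simp: exps_below_def fsize_eq)

lemma sum_exps_below_Suc:
  fixes w :: "(nat \<Rightarrow> nat) \<Rightarrow> 'a::comm_monoid_add"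
  shows "(\<Sum>g\<in>exps_below f (Suc n) b. w g) = (\<Sum>j\<le>min b (f n). \<Sum>g\<in>exps_below f n (b - j). w (g(n := j)))"
proof -
  have "(\<Sum>j\<le>min b (f n). \<Sum>g\<in>exps_below f n (b - j). w (g(n := j))) =
      (\<Sum>(j, g)\<in>(SIGMA j:{..min b (f n)}. exps_below f n (b - j)). w (g(n := j)))"
    by (intro sum.Sigma) (auto simp: finite_exps_below)
  also have "\<dots> = (\<Sum>g\<in>exps_below f (Suc n) b. w g)"
  proof (rule sum.reindex_bij_witness[of _ "\<lambda>g. (g n, g(n := 0))" "\<lambda>(j, g). g(n := j)"])
    fix p assume "p \<in> (SIGMA j:{..min b (f n)}. exps_below f n (b - j))"
    then obtain j g where p: "p = (j, g)" "j \<le> b" "j \<le> f n" "g \<in> exps_below f n (b - j)" by auto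
    have "(\<Sum>i<n. (g(n := j)) i) = (\<Sum>i<n. g i)" by (intro sum.cong) auto
    then show "(\<lambda>(j, g). g(n := j)) p \<in> exps_below f (Suc n) b"
      using p by (auto simp: exps_below_def vanishes_def less_Suc_eq)
    show "(\<lambda>g. (g n, g(n := 0))) ((\<lambda>(j, g). g(n := j)) p) = p"
      using p by (auto simp: exps_below_def vanishes_def fun_eq_iff)
  next
    fix g assume g: "g \<in> exps_below f (Suc n) b"
    have "(\<Sum>i<n. (g(n := 0)) i) = (\<Sum>i<n. g i)" by (intro sum.cong) auto
    then show "(g n, g(n := 0)) \<in> (SIGMA j:{..min b (f n)}. exps_below f n (b - j))"
      using g by (auto simp: exps_below_def vanishes_def)
  qed auto
  finally show ?thesis by simp
qed

text \<open>Pieri's rule for the product of a complete function of degree \<open>b\<close> with the Schur function of \<open>l\<close>,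
read off at the monomial with exponents \<open>f\<close>: on the right, \<open>g\<close> is the part of that monomial that
comes from the complete function. By induction on the number \<open>n\<close> of variables: the strip added by
the product is commuted past the strip that carries the last variable.\<close>
lemma pieri_strip_chains:
  assumes "fin_supp l"
  shows "(\<Sum>v\<in>add_strip l b. strip_chains v f n) = (\<Sum>g\<in>exps_below f n b. strip_chains l (\<lambda>i. f i - g i) n)"
  using assms
proof (induction n arbitrary: l b)
  case 0
  have z: "fsize (\<lambda>_. 0) = 0" by (simp add: fsize_def)
  have "exps_below f 0 b = (if b = 0 then {\<lambda>_. 0} else {})"
    by (auto simp: exps_below_def vanishes_def)
  moreover have "(\<Sum>v\<in>add_strip l b. strip_chains v f 0) = of_bool (l = (\<lambda>_. 0) \<and> b = 0)"
  proof -
    have "(\<lambda>_. 0) \<in> add_strip l b \<longleftrightarrow> l = (\<lambda>_. 0) \<and> b = 0"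
      by (auto simp: add_strip_def hstrip_def z)
    moreover have "(\<Sum>v\<in>add_strip l b. strip_chains v f 0) = (\<Sum>v\<in>add_strip l b. if v = (\<lambda>_. 0) then 1 else 0)"
      by (intro sum.cong) auto
    ultimately show ?thesis using finite_add_strip[OF 0, of b] by (simp add: sum.delta)
  qed
  ultimately show ?case by auto
next
  case (Suc n)
  have "(\<Sum>v\<in>add_strip l b. strip_chains v f (Suc n)) =
      (\<Sum>j\<le>min b (f n). \<Sum>k\<in>remove_strip l (f n - j). \<Sum>m\<in>add_strip k (b - j). strip_chains m f n)"
    using strip_commutation[OF Suc.prems] by simp
  also have "\<dots> = (\<Sum>j\<le>min b (f n). \<Sum>k\<in>remove_strip l (f n - j).
      \<Sum>g\<in>exps_below f n (b - j). strip_chains k (\<lambda>i. f i - g i) n)"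
    by (intro sum.cong refl Suc.IH remove_strip_fin_supp[OF Suc.prems])
  also have "\<dots> = (\<Sum>j\<le>min b (f n). \<Sum>g\<in>exps_below f n (b - j). \<Sum>k\<in>remove_strip l (f n - j).
      strip_chains k (\<lambda>i. f i - g i) n)"
    by (intro sum.cong refl sum.swap)
  also have "\<dots> = (\<Sum>j\<le>min b (f n). \<Sum>g\<in>exps_below f n (b - j). strip_chains l (\<lambda>i. f i - (g(n := j)) i) (Suc n))"
    by (auto intro!: sum.cong strip_chains_cong)
  also have "\<dots> = (\<Sum>g\<in>exps_below f (Suc n) b. strip_chains l (\<lambda>i. f i - g i) (Suc n))"
    by (rule sum_exps_below_Suc[symmetric])
  finally show ?case .
qed

text \<open>Triangularity of the Kostka numbers with respect to the statistic \<open>\<Sum>i. i * l i\<close>. The strip of step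
\<open>n\<close> only reaches the rows \<open>0, \<dots>, n\<close>, so it raises the statistic by at most \<open>n\<close> times its size, with
equality only if it lies in row \<open>n\<close>. A numerical statistic is a ranking that elimination can
follow directly.\<close>
lemma strip_chains_nonzero:
  assumes "strip_chains l f n \<noteq> 0" "fin_supp l"
  shows "vanishes n l \<and> fsize l = (\<Sum>i<n. f i) \<and> (\<Sum>i<n. i * l i) \<le> (\<Sum>i<n. i * f i) \<and>
    ((\<Sum>i<n. i * l i) = (\<Sum>i<n. i * f i) \<longrightarrow> (\<forall>i<n. l i = f i))"
  using assms
proof (induction n arbitrary: l)
  case 0
  then show ?case by (auto simp: vanishes_def fsize_def)
next
  case (Suc n)
  from Suc.prems(1) obtain m where m: "m \<in> remove_strip l (f n)" "strip_chains m f n \<noteq> 0"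
    by (metis strip_chains.simps(2) sum.neutral)
  have fm: "fin_supp m" using m Suc.prems remove_strip_fin_supp by blast
  note IH = Suc.IH[OF m(2) fm]
  have hs: "hstrip m l" "fsize l = fsize m + f n" using m by (auto simp: remove_strip_def)
  have vl: "vanishes (Suc n) l" using hstrip_vanishes_upper hs IH by blast
  have vm: "vanishes (Suc n) m" using hstrip_vanishes_lower hs vl by blast
  have le: "m i \<le> l i" for i using hs by (auto simp: hstrip_def)
  have fn: "f n = (\<Sum>i<Suc n. l i - m i)"
    using hs(2) le unfolding fsize_eq[OF vl] fsize_eq[OF vm] by (simp add: sum_subtractf_nat del: sum.lessThan_Suc)
  have mn: "m n = 0" using IH by (auto simp: vanishes_def)
  have eq1: "(\<Sum>i<Suc n. i * l i) = (\<Sum>i<n. i * m i) + (\<Sum>i<Suc n. i * (l i - m i))"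
  proof -
    have "(\<Sum>i<Suc n. i * l i) = (\<Sum>i<Suc n. i * m i + i * (l i - m i))"
      using le by (intro sum.cong refl) (metis add_mult_distrib2 le_add_diff_inverse)
    then show ?thesis using mn by (simp add: sum.distrib)
  qed
  have eq2: "(\<Sum>i<Suc n. i * f i) = (\<Sum>i<n. i * f i) + (\<Sum>i<Suc n. n * (l i - m i))"
    using fn by (simp add: sum_distrib_left[symmetric] del: sum.lessThan_Suc) simp
  have le2: "(\<Sum>i<Suc n. i * (l i - m i)) \<le> (\<Sum>i<Suc n. n * (l i - m i))"
    by (intro sum_mono mult_right_mono) auto
  have "(\<Sum>i<Suc n. i * l i) \<le> (\<Sum>i<Suc n. i * f i)"
    unfolding eq1 eq2 using le2 IH by linarith
  moreover have "\<forall>i<Suc n. l i = f i" if eq: "(\<Sum>i<Suc n. i * l i) = (\<Sum>i<Suc n. i * f i)"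
  proof -
    have e1: "(\<Sum>i<n. i * m i) = (\<Sum>i<n. i * f i)" and e2: "(\<Sum>i<Suc n. i * (l i - m i)) = (\<Sum>i<Suc n. n * (l i - m i))"
      using eq le2 IH unfolding eq1 eq2 by linarith+
    have mf: "\<forall>i<n. m i = f i" using e1 IH by blast
    have "i * (l i - m i) = n * (l i - m i)" if "i < Suc n" for i
    proof (rule ccontr)
      assume "i * (l i - m i) \<noteq> n * (l i - m i)"
      then have "i * (l i - m i) < n * (l i - m i)"
        using that by (intro le_neq_implies_less mult_right_mono) auto
      then have "(\<Sum>i<Suc n. i * (l i - m i)) < (\<Sum>i<Suc n. n * (l i - m i))"
        using that by (intro sum_strict_mono_ex1) (auto intro!: mult_right_mono)
      then show False using e2 by simp
    qed
    then have lm: "l i = m i" if "i < n" for i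
      using that le[of i] by (metis diff_is_0_eq less_SucI less_irrefl mult_right_cancel nat_le_linear le_antisym)
    then have "f n = l n" using fn mn by simp
    then show ?thesis using mf lm by (auto simp: less_Suc_eq)
  qed
  moreover have "fsize l = (\<Sum>i<Suc n. f i)" using hs IH by simp
  ultimately show ?case using vl by blast
qed

lemma strip_chains_self:
  assumes "vanishes n l" "antimono l" shows "strip_chains l l n = 1"
  using assms
proof (induction n arbitrary: l)
  case 0
  then show ?case by (auto simp: vanishes_def)
next
  case (Suc n)
  let ?m = "l(n := 0)"
  have fl: "fin_supp l" using Suc.prems by (auto simp: fin_supp_def)
  have vm: "vanishes n ?m" using Suc.prems(1) by (auto simp: vanishes_def)
  have am: "antimono ?m" 
    unfolding antimono_iff_le_Suc
  proof
    fix i show "?m (Suc i) \<le> ?m i"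
      using Suc.prems by (auto simp: vanishes_def antimono_iff_le_Suc)
  qed
  have "(\<Sum>i<n. ?m i) = (\<Sum>i<n. l i)" by (intro sum.cong) auto
  then have sz: "fsize l = fsize ?m + l n"
    unfolding fsize_eq[OF vm] fsize_eq[OF Suc.prems(1)] by simp
  have hs: "hstrip ?m l" unfolding hstrip_def
    using Suc.prems by (auto simp: vanishes_def antimono_iff_le_Suc)
  have "strip_chains k l n = (if k = ?m then 1 else 0)" if k: "k \<in> remove_strip l (l n)" for k
  proof (cases "k = ?m")
    case True
    have "strip_chains ?m l n = strip_chains ?m ?m n" by (rule strip_chains_cong) auto
    then show ?thesis using Suc.IH[OF vm am] True by simp
  next
    case False
    have "strip_chains k l n = 0"
    proof (rule ccontr)
      assume "strip_chains k l n \<noteq> 0"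
      then have vk: "vanishes n k" using strip_chains_nonzero remove_strip_fin_supp[OF fl k] by blast
      have kl: "k i \<le> l i" for i using k by (auto simp: remove_strip_def hstrip_def)
      have "fsize k = fsize ?m" using sz k by (auto simp: remove_strip_def)
      then have "(\<Sum>i<n. k i) = (\<Sum>i<n. l i)"
        using \<open>(\<Sum>i<n. ?m i) = (\<Sum>i<n. l i)\<close> by (simp add: fsize_eq[OF vk] fsize_eq[OF vm])
      have "k i = l i" if "i < n" for i
      proof (rule ccontr)
        assume "k i \<noteq> l i"
        then have "k i < l i" using kl[of i] by simp
        then have "(\<Sum>i<n. k i) < (\<Sum>i<n. l i)"
          using kl that by (intro sum_strict_mono_ex1) auto
        then show False using \<open>(\<Sum>i<n. k i) = (\<Sum>i<n. l i)\<close> by simp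
      qed
      then have "k i = ?m i" for i
        using vk vm by (cases "i < n") (auto simp: vanishes_def)
      then have "k = ?m" by blast
      with False show False by simp
    qed
    then show ?thesis using False by simp
  qed
  then have "strip_chains l l (Suc n) = (\<Sum>k\<in>remove_strip l (l n). if k = ?m then 1 else 0)" by simp
  also have "\<dots> = 1"
  proof -
    have "?m \<in> remove_strip l (l n)" using hs sz by (simp add: remove_strip_def)
    then show ?thesis using finite_remove_strip[OF fl] by (simp add: sum.delta)
  qed
  finally show ?case .
qed

section \<open>Semistandard tableaux as chains of horizontal strips\<close>

text \<open>The shape is cut off after \<open>L\<close> rows, some of which may be empty. So \<open>L\<close> can stay fixed while entries
are removed and the shape shrinks.\<close>
definition tableaux_below :: "(nat \<Rightarrow> nat) \<Rightarrow> nat \<Rightarrow> (nat \<Rightarrow> nat) \<Rightarrow> nat \<Rightarrow> nat list list set" where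
  "tableaux_below l L f n = {T \<in> ssyt (map l [0..<L]). set (concat T) \<subseteq> {..<n} \<and>
     (\<forall>i<n. count (mset (concat T)) i = f i)}"

lemma count_concat: "count (mset (concat T)) x = (\<Sum>i<length T. count (mset (T ! i)) x)"
  by (simp add: mset_concat sum_list_sum_nth count_sum atLeast0LessThan)

lemma ssyt_iff:
  "T \<in> ssyt (map l [0..<L]) \<longleftrightarrow> length T = L \<and> (\<forall>i<L. length (T ! i) = l i \<and> sorted (T ! i)) \<and>
     (\<forall>i j. Suc i < L \<longrightarrow> j < l (Suc i) \<longrightarrow> T ! i ! j < T ! Suc i ! j)"
proof -
  have shape: "map length T = map l [0..<L] \<longleftrightarrow> length T = L \<and> (\<forall>i<L. length (T ! i) = l i)"
    by (simp add: list_eq_iff_nth_eq cong: conj_cong)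
  have sorted: "(\<forall>row\<in>set T. sorted row) \<longleftrightarrow> (\<forall>i<L. sorted (T ! i))" if "length T = L"
    using that by (simp add: all_set_conv_all_nth)
  have len: "length (map l [0..<L]) = L" by simp
  have col: "(\<forall>i j. Suc i < L \<longrightarrow> j < map l [0..<L] ! Suc i \<longrightarrow> T ! i ! j < T ! Suc i ! j) \<longleftrightarrow>
      (\<forall>i j. Suc i < L \<longrightarrow> j < l (Suc i) \<longrightarrow> T ! i ! j < T ! Suc i ! j)"
    by (intro all_cong1 imp_cong HOL.refl) simp_all
  show ?thesis
    unfolding ssyt_def mem_Collect_eq shape len col using sorted by blast
qed

lemma sorted_split_max:
  assumes "sorted xs" "set xs \<subseteq> {..<Suc n}"
  shows "xs = filter (\<lambda>x. x < n) xs @ replicate (count (mset xs) n) n"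
  using assms
proof (induction xs)
  case (Cons a xs)
  show ?case
  proof (cases "a < n")
    case False
    then have "a = n" using Cons.prems by auto
    then have "\<forall>x\<in>set xs. x = n" using Cons.prems by fastforce
    then have "filter (\<lambda>x. x < n) xs = []" by (auto simp: filter_empty_conv)
    then show ?thesis using Cons \<open>a = n\<close> by simp
  qed (use Cons in auto)
qed simp

lemma filter_max_length:
  assumes "sorted xs" "set xs \<subseteq> {..<Suc n}"
  shows "length xs = length (filter (\<lambda>x. x < n) xs) + count (mset xs) n"
  by (subst sorted_split_max[OF assms]) simp

text \<open>The entries equal to \<open>n\<close> stand at the ends of the rows and occur at most once in each column, so the
boxes they occupy form a horizontal strip; conversely a strip can be filled with \<open>n\<close>. This
branching rule is what links tableaux with \<open>strip_chains\<close>.\<close>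
lemma tableaux_below_Suc:
  assumes l: "antimono l" "vanishes L l"
  shows "bij_betw (\<lambda>T. (\<lambda>i. if i < L then length (filter (\<lambda>x. x < n) (T ! i)) else 0, map (filter (\<lambda>x. x < n)) T))
    (tableaux_below l L f (Suc n)) (SIGMA m:remove_strip l (f n). tableaux_below m L f n)"
    (is "bij_betw ?F ?A ?B")
proof (rule bij_betw_byWitness[where f' = "\<lambda>(m, T). map (\<lambda>i. T ! i @ replicate (l i - m i) n) [0..<L]"])
  let ?c = "filter (\<lambda>x. x < n)"
  let ?G = "\<lambda>(m, T). map (\<lambda>i. T ! i @ replicate (l i - m i) n) [0..<L]"
  have A: "length T = L" "\<And>i. i < L \<Longrightarrow> length (T ! i) = l i" "\<And>i. i < L \<Longrightarrow> sorted (T ! i)"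
    "\<And>i j. Suc i < L \<Longrightarrow> j < l (Suc i) \<Longrightarrow> T ! i ! j < T ! Suc i ! j"
    "\<And>i. i < L \<Longrightarrow> set (T ! i) \<subseteq> {..<Suc n}"
    "\<And>i. i < Suc n \<Longrightarrow> (\<Sum>k<L. count (mset (T ! k)) i) = f i"
    if "T \<in> ?A" for T
  proof -
    have T: "T \<in> ssyt (map l [0..<L])" "set (concat T) \<subseteq> {..<Suc n}" "\<forall>i<Suc n. count (mset (concat T)) i = f i"
      using that by (auto simp: tableaux_below_def)
    show "length T = L" using T(1) unfolding ssyt_iff by blast
    then show "\<And>i. i < Suc n \<Longrightarrow> (\<Sum>k<L. count (mset (T ! k)) i) = f i"
      using T(3) unfolding count_concat by blast
    show "\<And>i. i < L \<Longrightarrow> set (T ! i) \<subseteq> {..<Suc n}"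
      using T(2) \<open>length T = L\<close> by (auto simp: subset_iff dest: nth_mem)
  qed (use that[unfolded tableaux_below_def] in \<open>auto simp: ssyt_iff\<close>)
  have B: "length T = L" "\<And>i. i < L \<Longrightarrow> length (T ! i) = m i" "\<And>i. i < L \<Longrightarrow> sorted (T ! i)"
    "\<And>i j. Suc i < L \<Longrightarrow> j < m (Suc i) \<Longrightarrow> T ! i ! j < T ! Suc i ! j"
    "\<And>i. i < L \<Longrightarrow> set (T ! i) \<subseteq> {..<n}"
    "\<And>i. i < n \<Longrightarrow> (\<Sum>k<L. count (mset (T ! k)) i) = f i"
    "\<And>i. l (Suc i) \<le> m i" "\<And>i. m i \<le> l i" "vanishes L m" "fsize l = fsize m + f n"
    if "(m, T) \<in> ?B" for m T
  proof -
    have T: "T \<in> ssyt (map m [0..<L])" "set (concat T) \<subseteq> {..<n}" "\<forall>i<n. count (mset (concat T)) i = f i"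
      and m: "m \<in> remove_strip l (f n)"
      using that by (auto simp: tableaux_below_def)
    show "length T = L" using T(1) unfolding ssyt_iff by blast
    then show "\<And>i. i < n \<Longrightarrow> (\<Sum>k<L. count (mset (T ! k)) i) = f i"
      using T(3) unfolding count_concat by blast
    show "\<And>i. i < L \<Longrightarrow> set (T ! i) \<subseteq> {..<n}"
      using T(2) \<open>length T = L\<close> by (auto simp: subset_iff dest: nth_mem)
    show "vanishes L m" "fsize l = fsize m + f n" "\<And>i. l (Suc i) \<le> m i" "\<And>i. m i \<le> l i"
      using m l hstrip_vanishes_lower[of m l L] by (auto simp: remove_strip_def hstrip_def)
  qed (use that[unfolded tableaux_below_def] in \<open>auto simp: ssyt_iff\<close>)
  show "\<forall>T\<in>?A. ?G (?F T) = T"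
  proof
    fix T assume T: "T \<in> ?A"
    note A = A[OF T]
    show "?G (?F T) = T"
    proof (rule nth_equalityI)
      fix i assume "i < length (?G (?F T))"
      then have i: "i < L" by simp
      have "l i - length (?c (T ! i)) = count (mset (T ! i)) n"
        using filter_max_length[OF A(3,5)[OF i]] A(2)[OF i] by simp
      then show "?G (?F T) ! i = T ! i"
        using i A(1) sorted_split_max[OF A(3,5)[OF i]] by simp
    qed (use A(1) in simp)
  qed
  show "\<forall>p\<in>?B. ?F (?G p) = p"
  proof
    fix p assume p: "p \<in> ?B"
    obtain m T where mT: "p = (m, T)" by (cases p)
    note B = B[OF p[unfolded mT]]
    have fil: "?c (T ! i @ replicate (l i - m i) n) = T ! i" if "i < L" for i
      using B(5)[OF that] by (auto simp: filter_id_conv)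
    have "map ?c (?G p) = T"
      using fil B(1) unfolding mT by (intro nth_equalityI) auto
    moreover have "(if i < L then length (?c (?G p ! i)) else 0) = m i" for i
      using fil[of i] B(2)[of i] B(9) unfolding mT by (auto simp: vanishes_def)
    ultimately show "?F (?G p) = p" unfolding mT by auto
  qed
  show "?F ` ?A \<subseteq> ?B"
  proof
    fix p assume "p \<in> ?F ` ?A"
    then obtain T where T: "T \<in> ?A" and p: "p = ?F T" by blast
    note A = A[OF T]
    define m where "m = (\<lambda>i. if i < L then length (?c (T ! i)) else 0)"
    have lm: "l i = m i + count (mset (T ! i)) n" if "i < L" for i
      using filter_max_length[OF A(3,5)[OF that]] A(2)[OF that] that by (simp add: m_def)
    have split: "T ! i = ?c (T ! i) @ replicate (count (mset (T ! i)) n) n" if "i < L" for i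
      by (rule sorted_split_max[OF A(3,5)[OF that]])
    have vm: "vanishes L m" by (simp add: vanishes_def m_def)
    have "fsize l = (\<Sum>i<L. m i + count (mset (T ! i)) n)"
      unfolding fsize_eq[OF l(2)] by (intro sum.cong) (auto simp: lm)
    then have size: "fsize l = fsize m + f n"
      using A(6)[of n] by (simp add: fsize_eq[OF vm] sum.distrib)
    have up: "m i \<le> l i" for i using lm[of i] by (cases "i < L") (auto simp: m_def)
    have low: "l (Suc i) \<le> m i" for i
    proof (rule ccontr)
      assume "\<not> l (Suc i) \<le> m i"
      then have lt: "m i < l (Suc i)" by simp
      then have i: "Suc i < L" using l(2) by (auto simp: vanishes_def not_less[symmetric])
      have "l (Suc i) \<le> l i" using l(1) by (simp add: antimono_iff_le_Suc)
      then have c: "0 < count (mset (T ! i)) n" using lm[OF Suc_lessD[OF i]] lt by linarith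
      \<comment> \<open>the box of row \<open>i\<close> above the offending one already contains \<open>n\<close>, against strictness in columns\<close>
      have "T ! i ! m i = n"
      proof -
        have "T ! i ! m i = (?c (T ! i) @ replicate (count (mset (T ! i)) n) n) ! m i"
          using split[of i] i by simp
        then show ?thesis using c i by (simp add: nth_append m_def)
      qed
      moreover have "T ! Suc i ! m i \<in> set (T ! Suc i)"
        using lt A(2)[OF i] by simp
      ultimately show False using A(4)[OF i lt] A(5)[OF i] by auto
    qed
    have m: "m \<in> remove_strip l (f n)" using up low size by (auto simp: remove_strip_def hstrip_def)
    let ?T = "map ?c T"
    have pre: "?c (T ! i) ! j = T ! i ! j" if "i < L" "j < m i" for i j
    proof -
      have "T ! i ! j = (?c (T ! i) @ replicate (count (mset (T ! i)) n) n) ! j"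
        using split[of i] that by simp
      then show ?thesis using that by (simp add: nth_append m_def)
    qed
    have "?T \<in> ssyt (map m [0..<L])"
      unfolding ssyt_iff
    proof (intro conjI allI impI)
      show "length ?T = L" using A(1) by simp
      fix i assume "i < L"
      then show "length (?T ! i) = m i" "sorted (?T ! i)" using A(1,3) by (auto simp: m_def sorted_wrt_filter)
    next
      fix i j assume i: "Suc i < L" and j: "j < m (Suc i)"
      have "j < l (Suc i)" using j up[of "Suc i"] by simp
      moreover from this have "j < m i" using low[of i] by simp
      ultimately show "?T ! i ! j < ?T ! Suc i ! j"
        using A(1) A(4)[OF i] pre[of i j] pre[of "Suc i" j] i j by simp
    qed
    moreover have "count (mset (concat ?T)) x = f x" if "x < n" for x
    proof -
      have "count (mset (concat ?T)) x = (\<Sum>k<L. count (mset (T ! k)) x)"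
        unfolding count_concat using A(1) that by (auto intro!: sum.cong)
      then show ?thesis using A(6)[of x] that by simp
    qed
    moreover have "set (concat ?T) \<subseteq> {..<n}" by auto
    ultimately have "?T \<in> tableaux_below m L f n" by (simp add: tableaux_below_def)
    then show "p \<in> ?B" unfolding p using m by (simp add: m_def)
  qed
  show "?G ` ?B \<subseteq> ?A"
  proof
    fix T' assume "T' \<in> ?G ` ?B"
    then obtain m T where mT: "(m, T) \<in> ?B" and T': "T' = map (\<lambda>i. T ! i @ replicate (l i - m i) n) [0..<L]" by auto
    note B = B[OF mT]
    have nth: "T' ! i = T ! i @ replicate (l i - m i) n" if "i < L" for i using that by (simp add: T')
    have "T' \<in> ssyt (map l [0..<L])"
      unfolding ssyt_iff
    proof (intro conjI allI impI)
      show "length T' = L" by (simp add: T')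
      fix i assume i: "i < L"
      show "length (T' ! i) = l i" using B(2,8) i by (simp add: nth)
      show "sorted (T' ! i)" using B(3,5)[OF i] by (auto simp: nth i sorted_append)
    next
      fix i j assume i: "Suc i < L" and j: "j < l (Suc i)"
      have jm: "j < m i" using j B(7)[of i] by simp
      then have e1: "T' ! i ! j = T ! i ! j" using i B(2)[of i] by (simp add: nth nth_append)
      show "T' ! i ! j < T' ! Suc i ! j"
      proof (cases "j < m (Suc i)")
        case True
        then show ?thesis using e1 B(4)[OF i] i B(2)[of "Suc i"] by (simp add: nth nth_append)
      next
        case False
        then have "T' ! Suc i ! j = n" using i j B(2)[of "Suc i"] by (simp add: nth nth_append)
        moreover have "T ! i ! j \<in> set (T ! i)" using jm i B(2)[of i] by simp
        ultimately show ?thesis using e1 B(5)[of i] i by auto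
      qed
    qed
    moreover have "count (mset (concat T')) x = f x" if "x < Suc n" for x
    proof -
      have "count (mset (concat T')) x = (\<Sum>k<L. count (mset (T ! k)) x + (if x = n then l k - m k else 0))"
        unfolding count_concat by (auto simp: T' intro!: sum.cong)
      also have "\<dots> = f x"
      proof (cases "x = n")
        case True
        have "(\<Sum>k<L. count (mset (T ! k)) n) = 0" using B(5) by (auto simp: count_eq_zero_iff)
        moreover have "(\<Sum>k<L. l k - m k) = f n"
          using B(8,10) unfolding fsize_eq[OF l(2)] fsize_eq[OF B(9)] by (simp add: sum_subtractf_nat)
        ultimately show ?thesis using True by (simp add: sum.distrib)
      next
        case False
        then show ?thesis using B(6)[of x] that by simp
      qed
      finally show ?thesis .
    qed
    moreover have "set (concat T') \<subseteq> {..<Suc n}"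
    proof
      fix x assume "x \<in> set (concat T')"
      then obtain i where "i < L" "x \<in> set (T ! i @ replicate (l i - m i) n)" by (auto simp: T')
      then show "x \<in> {..<Suc n}" using B(5)[of i] by auto
    qed
    ultimately show "T' \<in> ?A" by (simp add: tableaux_below_def)
  qed
qed

lemma card_tableaux_below:
  assumes "antimono l" "vanishes L l"
  shows "finite (tableaux_below l L f n) \<and> card (tableaux_below l L f n) = strip_chains l f n"
  using assms
proof (induction n arbitrary: l)
  case 0
  have "tableaux_below l L f 0 = (if l = (\<lambda>_. 0) then {replicate L []} else {})"
  proof -
    have "T = replicate L [] \<and> l = (\<lambda>_. 0)" if "T \<in> tableaux_below l L f 0" for T
    proof
      have T: "length T = L" "\<forall>i<L. length (T ! i) = l i" "concat T = []"
        using that by (auto simp: tableaux_below_def ssyt_iff)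
      have nil: "T ! i = []" if "i < L" for i using T(1,3) that by (auto simp: concat_eq_Nil_conv)
      then show "T = replicate L []" using T(1) by (auto intro: nth_equalityI)
      have "l i = 0" for i using nil[of i] T(2) 0(2) by (cases "i < L") (auto simp: vanishes_def)
      then show "l = (\<lambda>_. 0)" by blast
    qed
    then have sub: "tableaux_below l L f 0 \<subseteq> (if l = (\<lambda>_. 0) then {replicate L []} else {})" by auto
    have "replicate L [] \<in> tableaux_below (\<lambda>_. 0) L f 0"
      by (auto simp: tableaux_below_def ssyt_iff)
    then have "(if l = (\<lambda>_. 0) then {replicate L []} else {}) \<subseteq> tableaux_below l L f 0" by simp
    then show ?thesis using sub by (rule equalityI[rotated])
  qed
  then show ?case by auto
next
  case (Suc n)
  let ?B = "SIGMA m:remove_strip l (f n). tableaux_below m L f n"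
  have IH: "finite (tableaux_below m L f n) \<and> card (tableaux_below m L f n) = strip_chains m f n"
    if "m \<in> remove_strip l (f n)" for m
    using that Suc.prems hstrip_vanishes_lower hstrip_antimono_lower
    by (intro Suc.IH) (auto simp: remove_strip_def)
  have fin: "finite (remove_strip l (f n))"
    using Suc.prems by (intro finite_remove_strip) (auto simp: fin_supp_def)
  have "finite ?B" using fin IH by blast
  moreover have "card ?B = strip_chains l f (Suc n)"
    using fin IH by simp
  moreover note bij = tableaux_below_Suc[OF Suc.prems, of n f]
  ultimately show ?case
    using bij_betw_finite[OF bij] bij_betw_same_card[OF bij] by (simp del: strip_chains.simps)
qed

section \<open>Monomials and series in several families of variables\<close>

text \<open>A monomial is a finitely supported exponent function on the variables \<open>(k, i)\<close>. Its part in family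
\<open>k\<close> is described by \<open>fam k M\<close>, and \<open>act \<pi> M\<close> permutes the variables of each family separately.\<close>

definition in_fams :: "nat set \<Rightarrow> (nat \<times> nat \<Rightarrow>\<^sub>0 nat) \<Rightarrow> bool" where
  "in_fams K M \<longleftrightarrow> fst ` Poly_Mapping.keys M \<subseteq> K"

definition mdeg :: "('v \<Rightarrow>\<^sub>0 nat) \<Rightarrow> nat" where
  "mdeg M = (\<Sum>v\<in>Poly_Mapping.keys M. Poly_Mapping.lookup M v)"

definition fam :: "nat \<Rightarrow> (nat \<times> nat \<Rightarrow>\<^sub>0 nat) \<Rightarrow> nat \<Rightarrow> nat" where
  "fam k M i = Poly_Mapping.lookup M (k, i)"

definition restr :: "nat set \<Rightarrow> (nat \<times> nat \<Rightarrow>\<^sub>0 nat) \<Rightarrow> (nat \<times> nat \<Rightarrow>\<^sub>0 nat)" where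
  "restr K M = Abs_poly_mapping (\<lambda>v. if fst v \<in> K then Poly_Mapping.lookup M v else 0)"

definition act :: "(nat \<Rightarrow> nat \<Rightarrow> nat) \<Rightarrow> (nat \<times> nat \<Rightarrow>\<^sub>0 nat) \<Rightarrow> (nat \<times> nat \<Rightarrow>\<^sub>0 nat)" where
  "act \<pi> M = Poly_Mapping.map_key (\<lambda>(k, i). (k, \<pi> k i)) M"

lemma in_fams_iff: "in_fams K M \<longleftrightarrow> (\<forall>k i. Poly_Mapping.lookup M (k, i) \<noteq> 0 \<longrightarrow> k \<in> K)"
proof -
  have "in_fams K M \<longleftrightarrow> (\<forall>v\<in>Poly_Mapping.keys M. fst v \<in> K)"
    unfolding in_fams_def by blast
  then show ?thesis unfolding in_keys_iff Ball_def by (simp add: split_paired_all)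
qed

lemma in_famsD: "in_fams K M \<Longrightarrow> fst v \<notin> K \<Longrightarrow> Poly_Mapping.lookup M v = 0"
  unfolding in_fams_def by (meson image_subset_iff in_keys_iff)

lemma in_fams_add: "in_fams K (A + B) \<longleftrightarrow> in_fams K A \<and> in_fams K B"
  unfolding in_fams_iff lookup_add by (metis add_is_0)

lemma mdeg_superset: "finite S \<Longrightarrow> Poly_Mapping.keys M \<subseteq> S \<Longrightarrow> mdeg M = (\<Sum>v\<in>S. Poly_Mapping.lookup M v)"
  unfolding mdeg_def by (rule sum.mono_neutral_left) (auto simp: in_keys_iff)

lemma mdeg_add: "mdeg (A + B) = mdeg A + mdeg B"
proof -
  let ?S = "Poly_Mapping.keys A \<union> Poly_Mapping.keys B"
  have "Poly_Mapping.keys (A + B) \<subseteq> ?S" by (rule Poly_Mapping.keys_add)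
  then show ?thesis
    using mdeg_superset[of ?S A] mdeg_superset[of ?S B] mdeg_superset[of ?S "A + B"]
    by (simp add: lookup_add sum.distrib)
qed

lemma mdeg_zero [simp]: "mdeg 0 = 0"
  by (simp add: mdeg_def)

lemma lookup_restr: "Poly_Mapping.lookup (restr K M) v = (if fst v \<in> K then Poly_Mapping.lookup M v else 0)"
proof -
  have "finite {v. (if fst v \<in> K then Poly_Mapping.lookup M v else 0) \<noteq> 0}"
    by (rule finite_subset[OF _ finite_keys[of M]]) (auto simp: in_keys_iff)
  then show ?thesis unfolding restr_def by (subst lookup_Abs_poly_mapping) auto
qed

lemma in_fams_restr: "in_fams K (restr K M)"
  by (simp add: in_fams_iff lookup_restr)

lemma restr_in_fams: "in_fams K M \<Longrightarrow> restr K M = M"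
  by (rule poly_mapping_eqI) (auto simp: lookup_restr in_famsD)

lemma restr_outside: "in_fams K M \<Longrightarrow> K \<inter> K' = {} \<Longrightarrow> restr K' M = 0"
  by (rule poly_mapping_eqI) (auto simp: lookup_restr disjoint_iff intro: in_famsD[of K])

lemma restr_add: "restr K (A + B) = restr K A + restr K B"
  by (rule poly_mapping_eqI) (auto simp: lookup_restr lookup_add)

lemma restr_Un: "K \<inter> K' = {} \<Longrightarrow> in_fams (K \<union> K') M \<Longrightarrow> restr K M + restr K' M = M"
  by (rule poly_mapping_eqI) (auto simp: lookup_restr lookup_add disjoint_iff in_famsD)

lemma restr_restr: "restr K (restr K' M) = restr (K \<inter> K') M"
  by (rule poly_mapping_eqI) (auto simp: lookup_restr)

lemma fam_restr: "k \<in> K \<Longrightarrow> fam k (restr K M) = fam k M"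
  by (simp add: fam_def lookup_restr fun_eq_iff)

lemma fam_fin_supp: "fin_supp (fam k M)"
proof -
  have "finite (snd ` Poly_Mapping.keys M)" by simp
  then obtain L where L: "\<forall>i\<in>snd ` Poly_Mapping.keys M. i < L"
    using finite_nat_set_iff_bounded by blast
  have "vanishes L (fam k M)"
    unfolding vanishes_def fam_def
  proof (intro allI impI)
    fix i assume "L \<le> i"
    then have "(k, i) \<notin> Poly_Mapping.keys M" using L by fastforce
    then show "Poly_Mapping.lookup M (k, i) = 0" by (simp add: in_keys_iff)
  qed
  then show ?thesis by (auto simp: fin_supp_def)
qed

lemma in_fams_eqI:
  "in_fams K A \<Longrightarrow> in_fams K B \<Longrightarrow> (\<And>k. k \<in> K \<Longrightarrow> fam k A = fam k B) \<Longrightarrow> A = B"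
proof (rule poly_mapping_eqI)
  fix v assume *: "in_fams K A" "in_fams K B" "\<And>k. k \<in> K \<Longrightarrow> fam k A = fam k B"
  show "Poly_Mapping.lookup A v = Poly_Mapping.lookup B v"
  proof (cases "fst v \<in> K")
    case True
    then show ?thesis using fun_cong[OF *(3), of "fst v" "snd v"] by (cases v) (simp add: fam_def)
  qed (use *(1,2) in \<open>simp add: in_famsD\<close>)
qed

lemma in_fam_eqI: "in_fams {k} A \<Longrightarrow> in_fams {k} B \<Longrightarrow> fam k A = fam k B \<Longrightarrow> A = B"
  by (rule in_fams_eqI[of "{k}"]) auto

lemma mdeg_fam:
  assumes "in_fams {..<r} M" "\<And>k. k < r \<Longrightarrow> vanishes n (fam k M)"
  shows "mdeg M = (\<Sum>k<r. \<Sum>i<n. fam k M i)"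
proof -
  have "mdeg M = (\<Sum>v\<in>{..<r} \<times> {..<n}. Poly_Mapping.lookup M v)"
  proof (rule mdeg_superset)
    show "Poly_Mapping.keys M \<subseteq> {..<r} \<times> {..<n}"
    proof
      fix v assume v: "v \<in> Poly_Mapping.keys M"
      obtain k i where ki: "v = (k, i)" by (cases v)
      have k: "k < r" using assms(1) v ki by (auto simp: in_fams_def)
      have "fam k M i \<noteq> 0" using v ki by (simp add: fam_def in_keys_iff)
      then have "i < n" using assms(2)[OF k] by (auto simp: vanishes_def not_less[symmetric])
      then show "v \<in> {..<r} \<times> {..<n}" using ki k by simp
    qed
  qed simp
  then show ?thesis by (simp add: sum.cartesian_product fam_def case_prod_unfold)
qed

lemma inj_act: "(\<And>k. bij (\<pi> k)) \<Longrightarrow> inj (\<lambda>(k, i). (k, \<pi> k i))"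
  by (auto simp: inj_on_def bij_def)

lemma lookup_act: "(\<And>k. bij (\<pi> k)) \<Longrightarrow> Poly_Mapping.lookup (act \<pi> M) (k, i) = Poly_Mapping.lookup M (k, \<pi> k i)"
  unfolding act_def by (subst map_key.rep_eq) (auto simp: inj_act)

lemma act_add: "(\<And>k. bij (\<pi> k)) \<Longrightarrow> act \<pi> (A + B) = act \<pi> A + act \<pi> B"
  unfolding act_def by (rule map_key_plus) (rule inj_act)

lemma fam_act: "(\<And>k. bij (\<pi> k)) \<Longrightarrow> fam k (act \<pi> M) i = fam k M (\<pi> k i)"
  by (simp add: fam_def lookup_act)

lemma act_inverse:
  assumes "\<And>k. bij (\<pi> k)"
  shows "act (\<lambda>k. inv (\<pi> k)) (act \<pi> M) = M" "act \<pi> (act (\<lambda>k. inv (\<pi> k)) M) = M"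
proof -
  have b: "\<And>k. bij (inv (\<pi> k))" using assms bij_imp_bij_inv by blast
  have "\<And>k i. \<pi> k (inv (\<pi> k) i) = i" "\<And>k i. inv (\<pi> k) (\<pi> k i) = i"
    using assms by (simp_all add: bij_is_surj surj_f_inv_f bij_is_inj)
  then show "act (\<lambda>k. inv (\<pi> k)) (act \<pi> M) = M" "act \<pi> (act (\<lambda>k. inv (\<pi> k)) M) = M"
    by (auto intro!: poly_mapping_eqI simp: lookup_act assms b)
qed

lemma in_fams_act:
  assumes "\<And>k. bij (\<pi> k)" shows "in_fams K (act \<pi> M) \<longleftrightarrow> in_fams K M"
proof -
  have imp: "in_fams K (act \<pi> M)" if "in_fams K M" "\<And>k. bij (\<pi> k)" for \<pi> M
    using that(1) unfolding in_fams_iff lookup_act[OF that(2)] by blast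
  show ?thesis
    using imp[of "act \<pi> M" "\<lambda>k. inv (\<pi> k)"] imp[of M \<pi>] assms bij_imp_bij_inv
    by (auto simp: act_inverse(1)[OF assms])
qed

lemma mdeg_act:
  assumes "\<And>k. bij (\<pi> k)" shows "mdeg (act \<pi> M) = mdeg M"
  unfolding mdeg_def
proof (rule sum.reindex_bij_witness[of _ "\<lambda>(k, i). (k, inv (\<pi> k) i)" "\<lambda>(k, i). (k, \<pi> k i)"])
  have *: "\<And>k i. \<pi> k (inv (\<pi> k) i) = i" "\<And>k i. inv (\<pi> k) (\<pi> k i) = i"
    using assms by (simp_all add: bij_is_surj surj_f_inv_f bij_is_inj)
  fix v show "v \<in> Poly_Mapping.keys (act \<pi> M) \<Longrightarrow> (\<lambda>(k, i). (k, \<pi> k i)) v \<in> Poly_Mapping.keys M"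
    "v \<in> Poly_Mapping.keys M \<Longrightarrow> (\<lambda>(k, i). (k, inv (\<pi> k) i)) v \<in> Poly_Mapping.keys (act \<pi> M)"
    by (cases v; simp add: in_keys_iff lookup_act assms *)+
  show "(\<lambda>(k, i). (k, inv (\<pi> k) i)) ((\<lambda>(k, i). (k, \<pi> k i)) v) = v"
    "(\<lambda>(k, i). (k, \<pi> k i)) ((\<lambda>(k, i). (k, inv (\<pi> k) i)) v) = v"
    by (cases v; simp add: *)+
  show "Poly_Mapping.lookup M ((\<lambda>(k, i). (k, \<pi> k i)) v) = Poly_Mapping.lookup (act \<pi> M) v"
    by (cases v; simp add: lookup_act assms)
qed

lemma mcoeff_simps [simp]:
  "mcoeff 0 M = 0" "mcoeff (f + g) M = mcoeff f M + mcoeff g M" "mcoeff (- f) M = - mcoeff f M"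
  "mcoeff (f - g) M = mcoeff f M - mcoeff g M" "mcoeff (mscale c f) M = c * mcoeff f M"
  "mcoeff 1 M = (if M = 0 then 1 else 0)"
  by (simp_all add: zero_mfps_def plus_mfps_def uminus_mfps_def minus_mfps_def mscale_def one_mfps_def)

lemma mcoeff_mult: "mcoeff (f * g) M = (\<Sum>(A, B)\<in>antidiag M. mcoeff f A * mcoeff g B)"
  by (simp add: times_mfps_def)

lemma mcoeff_sum [simp]: "mcoeff (sum f I) M = (\<Sum>i\<in>I. mcoeff (f i) M)"
  by (induction I rule: infinite_finite_induct) auto

lemma mcoeff_mult_nonzero:
  assumes "mcoeff (f * g) M \<noteq> 0"
  obtains A B where "M = A + B" "mcoeff f A \<noteq> 0" "mcoeff g B \<noteq> 0"
proof -
  have "\<exists>p\<in>antidiag M. (case p of (A, B) \<Rightarrow> mcoeff f A * mcoeff g B) \<noteq> 0"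
    using assms unfolding mcoeff_mult by (metis (no_types, lifting) sum.neutral)
  then show thesis using that by (auto simp: antidiag_def dest!: mult_not_zero)
qed

lemma mcoeff_mconst: "mcoeff (mconst c) M = (if M = 0 then c else 0)"
  by (simp add: mconst_def)

lemma antidiag_zero_left: "(0, B) \<in> antidiag M \<longleftrightarrow> B = M"
  by (auto simp: antidiag_def)

lemma mconst_mult: "mconst c * f = mscale c f"
proof (rule mfps_eqI)
  fix M
  have "mcoeff (mconst c * f) M = (\<Sum>p\<in>antidiag M. if p = (0, M) then c * mcoeff f M else 0)"
    unfolding mcoeff_mult by (rule sum.cong) (auto simp: mcoeff_mconst antidiag_def split: if_splits)
  then show "mcoeff (mconst c * f) M = mcoeff (mscale c f) M"
    by (simp add: sum.delta antidiag_zero_left)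
qed

definition supported :: "nat set \<Rightarrow> 'a::zero series \<Rightarrow> bool" where
  "supported K f \<longleftrightarrow> (\<forall>M. mcoeff f M \<noteq> 0 \<longrightarrow> in_fams K M)"

text \<open>A monomial splits in only one way into factors that belong to disjoint sets of families.\<close>
lemma mcoeff_mult_disjoint:
  assumes "supported K f" "supported K' g" "K \<inter> K' = {}"
  shows "mcoeff (f * g) M = (if in_fams (K \<union> K') M then mcoeff f (restr K M) * mcoeff g (restr K' M) else 0)"
proof -
  have AB: "A = restr K M \<and> B = restr K' M \<and> in_fams (K \<union> K') M"
    if "A + B = M" "mcoeff f A \<noteq> 0" "mcoeff g B \<noteq> 0" for A B
  proof -
    have i: "in_fams K A" "in_fams K' B" using that assms(1,2) by (auto simp: supported_def)
    have "K' \<inter> K = {}" using assms(3) by auto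
    then have "restr K M = A" "restr K' M = B"
      using i assms(3) that(1)[symmetric] by (auto simp: restr_add restr_in_fams restr_outside)
    moreover have "in_fams (K \<union> K') M"
      using i unfolding that(1)[symmetric] in_fams_add by (auto simp: in_fams_def)
    ultimately show ?thesis by blast
  qed
  show ?thesis
  proof (cases "in_fams (K \<union> K') M")
    case True
    have "mcoeff (f * g) M = (\<Sum>p\<in>antidiag M. if p = (restr K M, restr K' M)
        then mcoeff f (restr K M) * mcoeff g (restr K' M) else 0)"
      unfolding mcoeff_mult
    proof (rule sum.cong[OF refl])
      fix p assume "p \<in> antidiag M"
      then show "(case p of (A, B) \<Rightarrow> mcoeff f A * mcoeff g B) = (if p = (restr K M, restr K' M)
        then mcoeff f (restr K M) * mcoeff g (restr K' M) else 0)"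
        using AB[of "fst p" "snd p"]
        by (cases p; cases "mcoeff f (fst p) = 0"; cases "mcoeff g (snd p) = 0") (auto simp: antidiag_def)
    qed
    moreover have "(restr K M, restr K' M) \<in> antidiag M"
      using restr_Un[OF assms(3) True] by (simp add: antidiag_def)
    ultimately show ?thesis using True by (simp add: sum.delta)
  next
    case False
    then show ?thesis using AB mcoeff_mult_nonzero[of f g M] by metis
  qed
qed

lemma supported_mult_mono: "supported K f \<Longrightarrow> supported K g \<Longrightarrow> supported K (f * g)"
  unfolding supported_def by (metis mcoeff_mult_nonzero in_fams_add)

lemma supported_mono: "supported K f \<Longrightarrow> K \<subseteq> K' \<Longrightarrow> supported K' f"
  unfolding supported_def in_fams_def by blast

lemma supported_one: "supported K 1"
  by (auto simp: supported_def in_fams_def)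

lemma mcoeff_prod_families:
  assumes "\<And>k. k < r \<Longrightarrow> supported {k} (f k)"
  shows "supported {..<r} (\<Prod>k<r. f k) \<and> mcoeff (\<Prod>k<r. f k) M =
    (if in_fams {..<r} M then \<Prod>k<r. mcoeff (f k) (restr {k} M) else 0)"
  using assms
proof (induction r arbitrary: M)
  case 0
  have "in_fams {} M \<longleftrightarrow> M = 0" by (auto simp: in_fams_def)
  then show ?case using supported_one by simp
next
  case (Suc r)
  have IH: "supported {..<r} (\<Prod>k<r. f k)" "mcoeff (\<Prod>k<r. f k) M =
    (if in_fams {..<r} M then \<Prod>k<r. mcoeff (f k) (restr {k} M) else 0)" for M
    using Suc by auto
  have un: "{..<r} \<union> {r} = {..<Suc r}" by auto
  have "mcoeff (\<Prod>k<Suc r. f k) M = (if in_fams {..<Suc r} M then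
      mcoeff (\<Prod>k<r. f k) (restr {..<r} M) * mcoeff (f r) (restr {r} M) else 0)"
    using mcoeff_mult_disjoint[OF IH(1) Suc.prems[of r], of M] un by simp
  also have "\<dots> = (if in_fams {..<Suc r} M then \<Prod>k<Suc r. mcoeff (f k) (restr {k} M) else 0)"
    unfolding IH(2) by (auto simp: in_fams_restr restr_restr intro!: prod.cong)
  finally have 1: "mcoeff (\<Prod>k<Suc r. f k) M = (if in_fams {..<Suc r} M then \<Prod>k<Suc r. mcoeff (f k) (restr {k} M) else 0)" .
  have "supported {..<Suc r} (\<Prod>k<Suc r. f k)"
    using supported_mult_mono[of "{..<Suc r}" "\<Prod>k<r. f k" "f r"] supported_mono[OF IH(1), of "{..<Suc r}"]
      supported_mono[OF Suc.prems[of r], of "{..<Suc r}"] by auto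
  with 1 show ?case by blast
qed

section \<open>Homogeneous symmetric series\<close>

lemma Xi_iff: "f \<in> Xi r N \<longleftrightarrow> (\<forall>M. mcoeff f M \<noteq> 0 \<longrightarrow> in_fams {..<r} M \<and> mdeg M = N) \<and>
   (\<forall>\<pi> M. (\<forall>k. bij (\<pi> k)) \<longrightarrow> mcoeff f (act \<pi> M) = mcoeff f M)"
  unfolding Xi_def in_fams_def mdeg_def act_def by simp

lemma Xi_act: "f \<in> Xi r N \<Longrightarrow> (\<And>k. bij (\<pi> k)) \<Longrightarrow> mcoeff f (act \<pi> M) = mcoeff f M"
  unfolding Xi_iff by blast

lemma Xi_zero: "0 \<in> Xi r N"
  by (simp add: Xi_iff)

lemma Xi_coeffwise:
  assumes f: "f \<in> Xi r N" and g: "g \<in> Xi r N"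
    and h: "\<And>M. mcoeff h M = F (mcoeff f M) (mcoeff g M)" and F: "F 0 0 = 0"
  shows "h \<in> Xi r N"
  unfolding Xi_iff
proof (intro conjI allI impI)
  fix M assume "mcoeff h M \<noteq> 0"
  then have "mcoeff f M \<noteq> 0 \<or> mcoeff g M \<noteq> 0" using h[of M] F by auto
  then show "in_fams {..<r} M" "mdeg M = N" using f g unfolding Xi_iff by blast+
next
  fix \<pi> :: "nat \<Rightarrow> nat \<Rightarrow> nat" and M assume "\<forall>k. bij (\<pi> k)"
  then show "mcoeff h (act \<pi> M) = mcoeff h M" unfolding h using f g unfolding Xi_iff by simp
qed

lemma Xi_add: "f \<in> Xi r N \<Longrightarrow> g \<in> Xi r N \<Longrightarrow> f + g \<in> Xi r N" for f g :: "'a::comm_ring_1 series"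
  by (rule Xi_coeffwise[where F = "(+)"]) auto

lemma Xi_diff: "f \<in> Xi r N \<Longrightarrow> g \<in> Xi r N \<Longrightarrow> f - g \<in> Xi r N" for f g :: "'a::comm_ring_1 series"
  by (rule Xi_coeffwise[where F = "(-)"]) auto

lemma Xi_scale: "f \<in> Xi r N \<Longrightarrow> mscale c f \<in> Xi r N" for f :: "'a::comm_ring_1 series"
  by (rule Xi_coeffwise[where F = "\<lambda>x _. c * x" and g = f]) auto

lemma Xi_sum: "(\<And>i. i \<in> I \<Longrightarrow> f i \<in> Xi r N) \<Longrightarrow> sum f I \<in> Xi r N" for f :: "_ \<Rightarrow> 'a::comm_ring_1 series"
  by (induction I rule: infinite_finite_induct) (auto simp: Xi_zero Xi_add)

lemma Xi_one: "(1 :: 'a::comm_ring_1 series) \<in> Xi r 0"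
proof -
  have zero: "act \<pi> 0 = 0" if "\<And>k. bij (\<pi> k)" for \<pi>
    by (rule poly_mapping_eqI) (auto simp: lookup_act that)
  have "act \<pi> M = 0 \<longleftrightarrow> M = 0" if \<pi>: "\<And>k. bij (\<pi> k)" for \<pi> M
    using act_inverse(1)[where \<pi> = \<pi> and M = M, OF \<pi>] zero[of \<pi>, OF \<pi>]
      zero[of "\<lambda>k. inv (\<pi> k)", OF bij_imp_bij_inv[OF \<pi>]] by auto
  then show ?thesis by (auto simp: Xi_iff in_fams_def)
qed

lemma Xi_mult:
  fixes f g :: "'a::comm_ring_1 series"
  assumes "f \<in> Xi r N" "g \<in> Xi r N'"
  shows "f * g \<in> Xi r (N + N')"
  unfolding Xi_iff
proof (intro conjI allI impI)
  fix M assume "mcoeff (f * g) M \<noteq> 0"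
  then obtain A B where AB: "M = A + B" "mcoeff f A \<noteq> 0" "mcoeff g B \<noteq> 0" by (rule mcoeff_mult_nonzero)
  then show "in_fams {..<r} M" "mdeg M = N + N'"
    using assms unfolding Xi_iff by (auto simp: in_fams_add mdeg_add)
next
  fix \<pi> :: "nat \<Rightarrow> nat \<Rightarrow> nat" and M
  assume \<pi>: "\<forall>k. bij (\<pi> k)"
  then have \<pi>': "\<And>k. bij (\<pi> k)" "\<And>k. bij (inv (\<pi> k))" using bij_imp_bij_inv by blast+
  let ?i = "act (\<lambda>k. inv (\<pi> k))"
  show "mcoeff (f * g) (act \<pi> M) = mcoeff (f * g) M"
    unfolding mcoeff_mult
  proof (rule sum.reindex_bij_witness[of _ "\<lambda>(A, B). (act \<pi> A, act \<pi> B)" "\<lambda>(A, B). (?i A, ?i B)"])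
    fix p
    show "p \<in> antidiag (act \<pi> M) \<Longrightarrow> (\<lambda>(A, B). (?i A, ?i B)) p \<in> antidiag M"
      by (auto simp: antidiag_def act_add[OF \<pi>'(2), symmetric] act_inverse[OF \<pi>'(1)])
    show "p \<in> antidiag M \<Longrightarrow> (\<lambda>(A, B). (act \<pi> A, act \<pi> B)) p \<in> antidiag (act \<pi> M)"
      by (auto simp: antidiag_def act_add[OF \<pi>'(1), symmetric])
    show "(case (\<lambda>(A, B). (?i A, ?i B)) p of (A, B) \<Rightarrow> mcoeff f A * mcoeff g B) = (case p of (A, B) \<Rightarrow> mcoeff f A * mcoeff g B)"
    proof -
      have "mcoeff f (?i A) = mcoeff f A" "mcoeff g (?i A) = mcoeff g A" for A
        by (rule Xi_act[OF assms(1) \<pi>'(2)], rule Xi_act[OF assms(2) \<pi>'(2)])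
      then show ?thesis by (cases p) simp
    qed
  qed (auto simp: act_inverse[OF \<pi>'(1)])
qed

lemma Xi_prod: "finite I \<Longrightarrow> (\<And>i. i \<in> I \<Longrightarrow> f i \<in> Xi r (N i)) \<Longrightarrow> prod f I \<in> Xi r (sum N I)"
  for f :: "_ \<Rightarrow> 'a::comm_ring_1 series"
  by (induction I rule: finite_induct) (auto simp: Xi_one Xi_mult)

lemma Xi_prod_list: "(\<And>i. i \<in> set xs \<Longrightarrow> f i \<in> Xi r i) \<Longrightarrow> prod_list (map f xs) \<in> Xi r (sum_list xs)"
  for f :: "_ \<Rightarrow> 'a::comm_ring_1 series"
  by (induction xs) (auto simp: Xi_one Xi_mult)

section \<open>Schur functions in one family\<close>

definition pfun :: "nat list \<Rightarrow> nat \<Rightarrow> nat" where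
  "pfun p i = (if i < length p then p ! i else 0)"

definition parts :: "nat \<Rightarrow> nat list set" where
  "parts b = {p \<in> partitions. sum_list p = b}"

lemma vanishes_pfun: "vanishes (length p) (pfun p)"
  by (simp add: vanishes_def pfun_def)

lemma fin_supp_pfun: "fin_supp (pfun p)"
  using vanishes_pfun by (auto simp: fin_supp_def)

lemma fsize_pfun: "fsize (pfun p) = sum_list p"
  unfolding fsize_eq[OF vanishes_pfun] by (simp add: sum_list_sum_nth pfun_def atLeast0LessThan)

lemma antimono_pfun: "p \<in> partitions \<Longrightarrow> antimono (pfun p)"
  unfolding antimono_iff_le_Suc pfun_def partitions_def by (auto simp: sorted_wrt_iff_nth_less)

lemma pfun_pos: "p \<in> partitions \<Longrightarrow> i < length p \<Longrightarrow> 0 < pfun p i"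
  unfolding partitions_def pfun_def by (auto intro: Suc_leI) (metis gr0I nth_mem)

lemma pfun_inj:
  assumes "p \<in> partitions" "q \<in> partitions" "pfun p = pfun q" shows "p = q"
proof -
  have le: "length p \<le> length q" if "p \<in> partitions" "pfun p = pfun q" for p q
    using pfun_pos[OF that(1), of "length q"] that(2) by (force simp: pfun_def)
  have "length p = length q"
    using le[of p q] le[of q p] assms by simp
  moreover have "p ! i = q ! i" if "i < length p" for i
    using fun_cong[OF assms(3), of i] that calculation by (simp add: pfun_def)
  ultimately show ?thesis by (rule nth_equalityI)
qed

lemma pfun_surj:
  assumes "antimono l" "fin_supp l"
  obtains p where "p \<in> partitions" "pfun p = l"
proof -
  define m where "m = (LEAST i. l i = 0)"
  obtain L where "l L = 0" using assms(2) by (auto simp: fin_supp_def vanishes_def)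
  then have m0: "l m = 0" unfolding m_def by (rule LeastI)
  have pos: "l i \<noteq> 0" if "i < m" for i using not_less_Least that unfolding m_def by blast
  have zero: "l i = 0" if "m \<le> i" for i using antimonoD[OF assms(1) that] m0 by simp
  let ?p = "map l [0..<m]"
  have "?p \<in> partitions"
    using pos by (auto simp: partitions_def sorted_wrt_iff_nth_less intro: antimonoD[OF assms(1) less_imp_le])
      (metis less_irrefl)
  moreover have "pfun ?p = l" using zero by (auto simp: pfun_def fun_eq_iff)
  ultimately show thesis by (rule that)
qed

text \<open>Every orbit of exponents under permutations of the variables contains a partition.\<close>
lemma sort_to_partition:
  assumes "vanishes n f"
  obtains p \<pi> where "p \<in> partitions" "bij \<pi>" "\<And>i. pfun p i = f (\<pi> i)"
proof -
  let ?xs = "map f [0..<n]"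
  let ?q = "rev (sort ?xs)"
  have "mset ?q = mset ?xs" by simp
  then obtain \<pi> where \<pi>: "\<pi> permutes {..<length ?xs}" "permute_list \<pi> ?xs = ?q"
    by (rule mset_eq_permutation)
  have q: "pfun ?q i = f (\<pi> i)" for i
  proof (cases "i < n")
    case True
    have "\<pi> i < n" using \<pi>(1) True permutes_in_image[of \<pi> "{..<n}" i] by simp
    moreover have "?q ! i = ?xs ! \<pi> i"
      using permute_list_nth[OF \<pi>(1), of i] \<pi>(2) True by simp
    ultimately show ?thesis using True by (simp add: pfun_def)
  next
    case False
    then have "\<pi> i = i" using \<pi>(1) by (auto simp: permutes_def)
    then show ?thesis using False assms by (simp add: pfun_def vanishes_def)
  qed
  have "sorted_wrt (\<ge>) ?q" by (simp add: sorted_wrt_rev)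
  then have "antimono (pfun ?q)"
    unfolding antimono_iff_le_Suc pfun_def by (auto simp: sorted_wrt_iff_nth_less)
  then obtain p where "p \<in> partitions" "pfun p = pfun ?q"
    using pfun_surj fin_supp_pfun by metis
  then show thesis using that[of p \<pi>] q permutes_bij[OF \<pi>(1)] by metis
qed

lemma length_le_sum_list: "p \<in> partitions \<Longrightarrow> length p \<le> sum_list p"
  unfolding partitions_def by (induction p) auto

lemma finite_parts: "finite (parts b)"
proof (rule finite_subset)
  show "parts b \<subseteq> {xs. set xs \<subseteq> {..b} \<and> length xs \<le> b}"
    using length_le_sum_list member_le_sum_list by (fastforce simp: parts_def)
qed (rule finite_lists_length_le, simp)

lemma bij_betw_pfun:
  assumes "\<And>v. v \<in> S \<Longrightarrow> antimono v \<and> fin_supp v"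
  shows "bij_betw pfun {p \<in> partitions. pfun p \<in> S} S"
proof (rule bij_betw_imageI)
  show "inj_on pfun {p \<in> partitions. pfun p \<in> S}"
    using pfun_inj by (auto simp: inj_on_def)
  show "pfun ` {p \<in> partitions. pfun p \<in> S} = S"
  proof (intro equalityI subsetI)
    fix v assume "v \<in> S"
    then obtain p where "p \<in> partitions" "pfun p = v" using assms pfun_surj by metis
    then show "v \<in> pfun ` {p \<in> partitions. pfun p \<in> S}" using \<open>v \<in> S\<close> by blast
  qed auto
qed

text \<open>Meaningful only if \<open>K\<close> and the supports of all \<open>e k\<close> for \<open>k \<in> K\<close> are finite.\<close>
definition monom_of :: "nat set \<Rightarrow> (nat \<Rightarrow> nat \<Rightarrow> nat) \<Rightarrow> (nat \<times> nat \<Rightarrow>\<^sub>0 nat)" where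
  "monom_of K e = Abs_poly_mapping (\<lambda>(k, i). if k \<in> K then e k i else 0)"

lemma lookup_monom_of:
  assumes "finite K" "\<And>k. k \<in> K \<Longrightarrow> fin_supp (e k)"
  shows "Poly_Mapping.lookup (monom_of K e) (k, i) = (if k \<in> K then e k i else 0)"
proof -
  have "finite {v. (case v of (k, i) \<Rightarrow> if k \<in> K then e k i else 0) \<noteq> 0}"
  proof (rule finite_subset)
    show "{v. (case v of (k, i) \<Rightarrow> if k \<in> K then e k i else 0) \<noteq> 0} \<subseteq> (SIGMA k:K. {i. e k i \<noteq> 0})"
      by (auto split: if_splits)
    have "finite {i. e k i \<noteq> 0}" if "k \<in> K" for k
    proof -
      obtain L where "vanishes L (e k)" using assms(2)[OF \<open>k \<in> K\<close>] by (auto simp: fin_supp_def)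
      then have "{i. e k i \<noteq> 0} \<subseteq> {..<L}" by (auto simp: vanishes_def not_less[symmetric])
      then show ?thesis using finite_subset by blast
    qed
    then show "finite (SIGMA k:K. {i. e k i \<noteq> 0})" using assms(1) by blast
  qed
  then show ?thesis unfolding monom_of_def by (subst lookup_Abs_poly_mapping) auto
qed

lemma fam_monom_of:
  "finite K \<Longrightarrow> (\<And>k. k \<in> K \<Longrightarrow> fin_supp (e k)) \<Longrightarrow> k \<in> K \<Longrightarrow> fam k (monom_of K e) = e k"
  by (simp add: fam_def lookup_monom_of fun_eq_iff)

lemma in_fams_monom_of:
  "finite K \<Longrightarrow> (\<And>k. k \<in> K \<Longrightarrow> fin_supp (e k)) \<Longrightarrow> in_fams K (monom_of K e)"
  by (simp add: in_fams_iff lookup_monom_of)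

lemma mdeg_one_family: "in_fams {k} M \<Longrightarrow> mdeg M = fsize (fam k M)"
proof -
  assume M: "in_fams {k} M"
  have keys: "Poly_Mapping.keys M = Pair k ` {i. fam k M i \<noteq> 0}"
    using M by (force simp: in_fams_def fam_def in_keys_iff)
  have "mdeg M = (\<Sum>i\<in>{i. fam k M i \<noteq> 0}. Poly_Mapping.lookup M (k, i))"
    unfolding mdeg_def keys by (subst sum.reindex) (auto simp: inj_on_def)
  then show ?thesis by (simp add: fsize_def fam_def)
qed

text \<open>The complete symmetric function of degree \<open>b\<close> in the family \<open>k\<close>.\<close>
definition hsym :: "nat \<Rightarrow> nat \<Rightarrow> 'a::comm_ring_1 series" where
  "hsym k b = Abs_mfps (\<lambda>M. if in_fams {k} M \<and> mdeg M = b then 1 else 0)"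

lemma tab_monom_eq_iff:
  "tab_monom k T = M \<longleftrightarrow> in_fams {k} M \<and> (\<forall>i. count (mset (concat T)) i = fam k M i)"
proof -
  have l: "Poly_Mapping.lookup (tab_monom k T) (k', i) = (if k' = k then count (mset (concat T)) i else 0)" for k' i
  proof -
    have "Poly_Mapping.lookup (sum_list (map (\<lambda>a. Poly_Mapping.single (k, a) 1) xs)) (k', i) =
        (if k' = k then count (mset xs) i else 0)" for xs
      by (induction xs) (auto simp: lookup_add lookup_single when_def)
    then show ?thesis unfolding tab_monom_def .
  qed
  show ?thesis
  proof
    assume "tab_monom k T = M"
    then show "in_fams {k} M \<and> (\<forall>i. count (mset (concat T)) i = fam k M i)"
      using l by (auto simp: in_fams_iff fam_def split: if_splits)
  next
    assume R: "in_fams {k} M \<and> (\<forall>i. count (mset (concat T)) i = fam k M i)"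
    show "tab_monom k T = M"
    proof (rule poly_mapping_eqI)
      fix v :: "nat \<times> nat" obtain k' i where v: "v = (k', i)" by (cases v)
      show "Poly_Mapping.lookup (tab_monom k T) v = Poly_Mapping.lookup M v"
        using R in_famsD[of "{k}" M v] unfolding v l by (auto simp: fam_def)
    qed
  qed
qed

lemma mcoeff_schur1:
  assumes p: "p \<in> partitions" and n: "vanishes n (fam k M)"
  shows "mcoeff (schur1 k p :: 'a::comm_ring_1 series) M =
    (if in_fams {k} M then of_nat (strip_chains (pfun p) (fam k M) n) else 0)"
proof -
  have "{T \<in> ssyt p. tab_monom k T = M} =
      (if in_fams {k} M then tableaux_below (pfun p) (length p) (fam k M) n else {})"
  proof (cases "in_fams {k} M")
    case True
    have p': "map (pfun p) [0..<length p] = p" by (rule nth_equalityI) (auto simp: pfun_def)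
    have "(\<forall>i. count (mset (concat T)) i = fam k M i) \<longleftrightarrow>
        set (concat T) \<subseteq> {..<n} \<and> (\<forall>i<n. count (mset (concat T)) i = fam k M i)" for T
    proof -
      have "set (concat T) \<subseteq> {..<n} \<longleftrightarrow> (\<forall>i\<ge>n. count (mset (concat T)) i = 0)"
        by (simp add: count_eq_zero_iff subset_iff del: set_concat) (meson not_less)
      then show ?thesis using n unfolding vanishes_def by (metis not_less)
    qed
    then show ?thesis using True by (simp only: tab_monom_eq_iff tableaux_below_def p') simp
  qed (simp add: tab_monom_eq_iff)
  then show ?thesis
    unfolding schur1_def using card_tableaux_below[OF antimono_pfun[OF p] vanishes_pfun] by simp
qed

lemma supported_schur1: "supported {k} (schur1 k p)"
  unfolding supported_def schur1_def
  by (auto simp: tab_monom_eq_iff) (metis (mono_tags, lifting) Collect_empty_eq card.empty of_nat_0)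

lemma supported_hsym: "supported {k} (hsym k b)"
  by (simp add: supported_def hsym_def)

lemma hsym_in_Xi: "k < r \<Longrightarrow> hsym k b \<in> Xi r b"
  unfolding Xi_iff
proof (intro conjI allI impI)
  fix M assume k: "k < r" and "mcoeff (hsym k b) M \<noteq> 0"
  then have "in_fams {k} M \<and> mdeg M = b" by (auto simp: hsym_def split: if_splits)
  then show "in_fams {..<r} M" "mdeg M = b" using k by (auto simp: in_fams_def)
next
  fix \<pi> :: "nat \<Rightarrow> nat \<Rightarrow> nat" and M assume \<pi>: "\<forall>k. bij (\<pi> k)"
  then show "mcoeff (hsym k b) (act \<pi> M) = mcoeff (hsym k b) M"
    using in_fams_act[of \<pi> "{k}" M] mdeg_act[of \<pi> M] by (simp add: hsym_def)
qed

text \<open>Pieri's rule. A factorisation of a monomial \<open>M\<close> of family \<open>k\<close> into a factor of degree \<open>b\<close> and a second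
factor is given by exponents below those of \<open>M\<close>, so the coefficient at \<open>M\<close> is computed by
\<open>pieri_strip_chains\<close>.\<close>
lemma pieri_schur1:
  assumes p: "p \<in> partitions"
  shows "hsym k b * schur1 k p =
    (\<Sum>q\<in>{q \<in> partitions. pfun q \<in> add_strip (pfun p) b}. (schur1 k q :: 'a::comm_ring_1 series))"
proof (rule mfps_eqI)
  fix M
  let ?Q = "{q \<in> partitions. pfun q \<in> add_strip (pfun p) b}"
  show "mcoeff (hsym k b * schur1 k p) M = mcoeff (\<Sum>q\<in>?Q. (schur1 k q :: 'a series)) M"
  proof (cases "in_fams {k} M")
    case False
    then have "mcoeff (hsym k b * schur1 k p :: 'a series) M = 0"
      using supported_mult_mono[OF supported_hsym supported_schur1, of k b p] unfolding supported_def by blast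
    moreover have "mcoeff (schur1 k q :: 'a series) M = 0" for q
      using False supported_schur1[of k q] unfolding supported_def by blast
    ultimately show ?thesis by simp
  next
    case True
    obtain n where n: "vanishes n (fam k M)" using fam_fin_supp by (auto simp: fin_supp_def)
    let ?f = "fam k M"
    have ab: "antimono v \<and> fin_supp v" if "v \<in> add_strip (pfun p) b" for v
      using that add_strip_fin_supp[OF fin_supp_pfun that] hstrip_antimono_upper by (auto simp: add_strip_def)
    have "mcoeff (\<Sum>q\<in>?Q. (schur1 k q :: 'a series)) M = (\<Sum>q\<in>?Q. of_nat (strip_chains (pfun q) ?f n))"
      using True by (auto simp: mcoeff_schur1[OF _ n] intro!: sum.cong)
    also have "\<dots> = (\<Sum>v\<in>add_strip (pfun p) b. of_nat (strip_chains v ?f n))"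
      by (rule sum.reindex_bij_betw[OF bij_betw_pfun]) (rule ab)
    also have "\<dots> = of_nat (\<Sum>v\<in>add_strip (pfun p) b. strip_chains v ?f n)" by simp
    also have "\<dots> = (\<Sum>g\<in>exps_below ?f n b. of_nat (strip_chains (pfun p) (\<lambda>i. ?f i - g i) n))"
      by (subst pieri_strip_chains[OF fin_supp_pfun]) simp
    also have "\<dots> = (\<Sum>AB\<in>{AB \<in> antidiag M. mdeg (fst AB) = b}. of_nat (strip_chains (pfun p) (fam k (snd AB)) n))"
    proof (rule sum.reindex_bij_witness[of _ "\<lambda>AB. fam k (fst AB)" "\<lambda>g. (monom_of {k} (\<lambda>_. g), monom_of {k} (\<lambda>_ i. ?f i - g i))"])
      fix g assume g: "g \<in> exps_below ?f n b"
      have vg: "vanishes n g" "vanishes n (\<lambda>i. ?f i - g i)"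
        using g n by (auto simp: exps_below_def vanishes_def)
      then have fs: "fin_supp g" "fin_supp (\<lambda>i. ?f i - g i)" by (auto simp: fin_supp_def)
      have le: "g i \<le> ?f i" for i using g vg(1) by (cases "i < n") (auto simp: exps_below_def vanishes_def)
      show "fam k (fst (monom_of {k} (\<lambda>_. g), monom_of {k} (\<lambda>_ i. ?f i - g i))) = g" using fs by (simp add: fam_monom_of)
      have "monom_of {k} (\<lambda>_. g) + monom_of {k} (\<lambda>_ i. ?f i - g i) = M"
      proof (rule poly_mapping_eqI)
        fix v :: "nat \<times> nat" obtain k' i where v: "v = (k', i)" by (cases v)
        show "Poly_Mapping.lookup (monom_of {k} (\<lambda>_. g) + monom_of {k} (\<lambda>_ i. ?f i - g i)) v = Poly_Mapping.lookup M v"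
          using le[of i] in_famsD[OF True, of v] fs unfolding v by (auto simp: lookup_add lookup_monom_of fam_def)
      qed
      moreover have "mdeg (monom_of {k} (\<lambda>_. g)) = b"
        using g vg(1) fs by (simp add: mdeg_one_family[of k] in_fams_monom_of fam_monom_of fsize_eq exps_below_def)
      ultimately show "(monom_of {k} (\<lambda>_. g), monom_of {k} (\<lambda>_ i. ?f i - g i)) \<in> {AB \<in> antidiag M. mdeg (fst AB) = b}"
        by (simp add: antidiag_def)
      show "of_nat (strip_chains (pfun p) (fam k (snd (monom_of {k} (\<lambda>_. g), monom_of {k} (\<lambda>_ i. ?f i - g i)))) n) =
        (of_nat (strip_chains (pfun p) (\<lambda>i. ?f i - g i) n) :: 'a)"
        using fs by (simp add: fam_monom_of)
    next
      fix AB assume AB: "AB \<in> {AB \<in> antidiag M. mdeg (fst AB) = b}"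
      obtain A B where A: "AB = (A, B)" "A + B = M" "mdeg A = b" using AB by (cases AB) (auto simp: antidiag_def)
      have i: "in_fams {k} A" "in_fams {k} B" using True A(2) in_fams_add by metis+
      have sum: "fam k A i + fam k B i = ?f i" for i using A(2) by (simp add: fam_def lookup_add[symmetric])
      have le: "fam k A i \<le> ?f i" for i using sum[of i] by simp
      have vA: "vanishes n (fam k A)"
        using le n by (metis le_zero_eq vanishes_def)
      then show "fam k (fst AB) \<in> exps_below ?f n b"
        using le A i by (simp add: exps_below_def mdeg_one_family[of k] fsize_eq)
      have "(\<lambda>i. ?f i - fam k A i) = fam k B" using sum by (auto simp: fun_eq_iff) (metis add_diff_cancel_left')
      then show "(monom_of {k} (\<lambda>_. fam k (fst AB)), monom_of {k} (\<lambda>_ i. ?f i - fam k (fst AB) i)) = AB"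
        using i fam_fin_supp A(1) by (auto intro!: in_fam_eqI simp: in_fams_monom_of fam_monom_of)
    qed
    also have "\<dots> = (\<Sum>AB\<in>antidiag M. if mdeg (fst AB) = b then of_nat (strip_chains (pfun p) (fam k (snd AB)) n) else 0)"
      by (simp add: sum.inter_filter)
    also have "\<dots> = mcoeff (hsym k b * schur1 k p :: 'a series) M"
      unfolding mcoeff_mult
    proof (rule sum.cong[OF refl])
      fix AB assume AB: "AB \<in> antidiag M"
      obtain A B where A: "AB = (A, B)" "A + B = M" using AB by (cases AB) (auto simp: antidiag_def)
      have i: "in_fams {k} A" "in_fams {k} B" using True A(2) in_fams_add by metis+
      have sum: "fam k A i + fam k B i = ?f i" for i using A(2) by (simp add: fam_def lookup_add[symmetric])
      have "vanishes n (fam k B)"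
        using sum n by (metis add_is_0 vanishes_def)
      then show "(if mdeg (fst AB) = b then of_nat (strip_chains (pfun p) (fam k (snd AB)) n) else 0) =
        (case AB of (A, B) \<Rightarrow> mcoeff (hsym k b) A * mcoeff (schur1 k p :: 'a series) B)"
        using i unfolding A(1) by (simp add: mcoeff_schur1[OF p] hsym_def)
    qed
    finally show ?thesis by simp
  qed
qed

section \<open>Kostka numbers and complete functions\<close>

lemma mscale_simps:
  fixes f g :: "('v, 'a::comm_ring_1) mfps"
  shows "mscale c f * g = mscale c (f * g)" "f * mscale c g = mscale c (f * g)"
    "mscale c (mscale d f) = mscale (c * d) f" "mscale c (f + g) = mscale c f + mscale c g"
    "mscale 1 f = f" "mscale 0 f = 0" "mscale c 0 = 0"
proof -
  show m: "mscale c f * g = mscale c (f * g)" for f g :: "('v, 'a) mfps"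
    by (rule mfps_eqI) (auto simp: mcoeff_mult sum_distrib_left case_prod_unfold mult.assoc intro!: sum.cong)
  show "f * mscale c g = mscale c (f * g)"
    using m[of g f] by (simp add: mult.commute)
qed (rule mfps_eqI; simp add: algebra_simps)+

lemma mscale_sum_left: "mscale (sum c I) f = (\<Sum>i\<in>I. mscale (c i) f)" for f :: "('v, 'a::comm_ring_1) mfps"
  by (rule mfps_eqI) (simp add: sum_distrib_right)

lemma mscale_sum: "mscale c (sum f I) = (\<Sum>i\<in>I. mscale c (f i))" for f :: "_ \<Rightarrow> ('v, 'a::comm_ring_1) mfps"
  by (rule mfps_eqI) (simp add: sum_distrib_left)

lemma mscale_prod: "finite I \<Longrightarrow> (\<Prod>i\<in>I. mscale (c i) (f i)) = mscale (prod c I) (prod f I)"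
  for f :: "_ \<Rightarrow> ('v, 'a::comm_ring_1) mfps"
  by (induction I rule: finite_induct) (auto simp: mscale_simps mult.commute)

lemma schur1_Nil: "schur1 k [] = (1 :: 'a::comm_ring_1 series)"
proof (rule mfps_eqI)
  fix M
  have "{T \<in> ssyt []. tab_monom k T = M} = (if M = 0 then {[]} else {})"
    by (auto simp: ssyt_def tab_monom_def)
  then show "mcoeff (schur1 k []) M = mcoeff (1 :: 'a series) M"
    by (simp add: schur1_def)
qed

lemma Nil_parts: "parts 0 = {[]}"
  by (auto simp: parts_def partitions_def) (metis gr0I list.set_sel(1))

text \<open>Repeated application of Pieri's rule: the coefficient of a Schur function counts the ways of building
its shape strip by strip.\<close>
lemma prod_hsym:
  "(\<Prod>i<n. hsym k (f i)) =
     (\<Sum>p\<in>parts (\<Sum>i<n. f i). mscale (of_nat (strip_chains (pfun p) f n)) (schur1 k p :: 'a::comm_ring_1 series))"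
proof (induction n)
  case 0
  have "pfun [] = (\<lambda>_. 0)" by (simp add: pfun_def fun_eq_iff)
  then show ?case by (simp add: Nil_parts schur1_Nil mscale_simps)
next
  case (Suc n)
  let ?b = "\<Sum>i<n. f i" and ?b' = "\<Sum>i<Suc n. f i"
  let ?c = "\<lambda>p. of_nat (strip_chains (pfun p) f n) :: 'a"
  have "(\<Prod>i<Suc n. hsym k (f i)) = (\<Sum>p\<in>parts ?b. mscale (?c p) (hsym k (f n) * schur1 k p))"
    using Suc by (simp add: sum_distrib_left mscale_simps mult.commute[of _ "hsym k (f n)"])
  also have "\<dots> = (\<Sum>p\<in>parts ?b. \<Sum>q\<in>{q \<in> parts ?b'. pfun q \<in> add_strip (pfun p) (f n)}. mscale (?c p) (schur1 k q))"
  proof (rule sum.cong[OF refl])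
    fix p assume p: "p \<in> parts ?b"
    have "{q \<in> partitions. pfun q \<in> add_strip (pfun p) (f n)} = {q \<in> parts ?b'. pfun q \<in> add_strip (pfun p) (f n)}"
      using p by (auto simp: parts_def add_strip_def fsize_pfun)
    then have "hsym k (f n) * schur1 k p =
        (\<Sum>q\<in>{q \<in> parts ?b'. pfun q \<in> add_strip (pfun p) (f n)}. schur1 k q :: 'a series)"
      using p pieri_schur1[where 'a = 'a, of p k "f n"] by (simp add: parts_def)
    then show "mscale (?c p) (hsym k (f n) * schur1 k p) =
      (\<Sum>q\<in>{q \<in> parts ?b'. pfun q \<in> add_strip (pfun p) (f n)}. mscale (?c p) (schur1 k q))"
      by (simp add: mscale_sum)
  qed
  also have "\<dots> = (\<Sum>q\<in>parts ?b'. \<Sum>p\<in>{p \<in> parts ?b. pfun q \<in> add_strip (pfun p) (f n)}. mscale (?c p) (schur1 k q))"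
    by (rule sum.swap_restrict) (rule finite_parts)+
  also have "\<dots> = (\<Sum>q\<in>parts ?b'. mscale (of_nat (strip_chains (pfun q) f (Suc n))) (schur1 k q))"
  proof (rule sum.cong[OF refl])
    fix q assume q: "q \<in> parts ?b'"
    have eq: "{p \<in> parts ?b. pfun q \<in> add_strip (pfun p) (f n)} = {p \<in> partitions. pfun p \<in> remove_strip (pfun q) (f n)}"
      using q by (auto simp: parts_def add_strip_def remove_strip_def fsize_pfun)
    have ab: "antimono v \<and> fin_supp v" if "v \<in> remove_strip (pfun q) (f n)" for v
      using that remove_strip_fin_supp[OF fin_supp_pfun that] hstrip_antimono_lower by (auto simp: remove_strip_def)
    have "(\<Sum>p\<in>{p \<in> parts ?b. pfun q \<in> add_strip (pfun p) (f n)}. ?c p) =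
       (\<Sum>m\<in>remove_strip (pfun q) (f n). of_nat (strip_chains m f n))"
      unfolding eq by (rule sum.reindex_bij_betw[OF bij_betw_pfun]) (rule ab)
    then show "(\<Sum>p\<in>{p \<in> parts ?b. pfun q \<in> add_strip (pfun p) (f n)}. mscale (?c p) (schur1 k q)) =
      mscale (of_nat (strip_chains (pfun q) f (Suc n))) (schur1 k q)"
      by (simp add: mscale_sum_left[symmetric])
  qed
  finally show ?case .
qed

text \<open>The statistic commonly written \<open>n(p)\<close>.\<close>
definition nstat :: "nat list \<Rightarrow> nat" where
  "nstat p = (\<Sum>i<length p. i * p ! i)"

lemma nstat_eq: "length p \<le> n \<Longrightarrow> nstat p = (\<Sum>i<n. i * pfun p i)"
  unfolding nstat_def by (rule sum.mono_neutral_cong_left) (auto simp: pfun_def)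

definition kostka1 :: "nat list \<Rightarrow> nat list \<Rightarrow> nat" where
  "kostka1 p q = strip_chains (pfun p) (pfun q) (length q)"

lemma kostka1_nonzero:
  assumes "kostka1 p q \<noteq> 0" "p \<in> partitions" "q \<in> partitions"
  shows "sum_list p = sum_list q" "p = q \<or> nstat p < nstat q"
proof -
  let ?n = "length q"
  from strip_chains_nonzero[OF assms(1)[unfolded kostka1_def] fin_supp_pfun]
  have *: "vanishes ?n (pfun p)" "fsize (pfun p) = (\<Sum>i<?n. pfun q i)"
    "(\<Sum>i<?n. i * pfun p i) \<le> (\<Sum>i<?n. i * pfun q i)"
    "(\<Sum>i<?n. i * pfun p i) = (\<Sum>i<?n. i * pfun q i) \<Longrightarrow> \<forall>i<?n. pfun p i = pfun q i"
    by blast+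
  show "sum_list p = sum_list q"
    using *(2) fsize_eq[OF vanishes_pfun, of q] by (simp add: fsize_pfun)
  have "length p \<le> ?n"
    using pfun_pos[OF assms(2), of ?n] *(1) by (force simp: vanishes_def)
  then have n: "nstat p = (\<Sum>i<?n. i * pfun p i)" "nstat q = (\<Sum>i<?n. i * pfun q i)"
    by (auto intro: nstat_eq)
  show "p = q \<or> nstat p < nstat q"
  proof (cases "nstat p = nstat q")
    case True
    then have "pfun p i = pfun q i" for i
      using *(1,4) n vanishes_pfun[of q] by (cases "i < ?n") (auto simp: vanishes_def)
    then have "p = q" using pfun_inj assms(2,3) by blast
    then show ?thesis ..
  qed (use *(3) n in simp)
qed

lemma kostka1_self: "p \<in> partitions \<Longrightarrow> kostka1 p p = 1"
  unfolding kostka1_def by (rule strip_chains_self[OF vanishes_pfun antimono_pfun])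

lemma prod_list_hsym:
  "prod_list (map (hsym k) q) =
    (\<Sum>p\<in>parts (sum_list q). mscale (of_nat (kostka1 p q)) (schur1 k p :: 'a::comm_ring_1 series))"
proof -
  have "prod_list (map (hsym k) q) = (\<Prod>i<length q. hsym k (pfun q i) :: 'a series)"
    by (induction q rule: rev_induct) (auto simp: pfun_def nth_append mult.commute)
  moreover have "(\<Sum>i<length q. pfun q i) = sum_list q"
    using fsize_eq[OF vanishes_pfun, of q] by (simp add: fsize_pfun)
  ultimately show ?thesis by (simp add: prod_hsym kostka1_def)
qed

text \<open>Products of complete functions are visibly symmetric, and \<open>prod_list_hsym\<close> expresses them through
Schur functions with a unitriangular matrix. This can be solved for the Schur functions, by induction
along \<open>nstat\<close>, which shows that they are symmetric as well.\<close>
lemma schur1_in_Xi: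
  assumes "k < r" "p \<in> partitions"
  shows "(schur1 k p :: 'a::comm_ring_1 series) \<in> Xi r (sum_list p)"
  using assms(2)
proof (induction "nstat p" arbitrary: p rule: less_induct)
  case less
  let ?S = "parts (sum_list p)"
  have p: "p \<in> ?S" using less.prems by (simp add: parts_def)
  let ?t = "\<lambda>q. mscale (of_nat (kostka1 q p)) (schur1 k q :: 'a series)"
  have "prod_list (map (hsym k) p) = ?t p + sum ?t (?S - {p})"
    unfolding prod_list_hsym using p finite_parts by (simp add: sum.remove)
  then have eq: "schur1 k p = prod_list (map (hsym k) p) - sum ?t (?S - {p})"
    using kostka1_self[OF less.prems] by (simp add: mscale_simps)
  have "?t q \<in> Xi r (sum_list p)" if q: "q \<in> ?S - {p}" for q
  proof (cases "kostka1 q p = 0")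
    case False
    have "nstat q < nstat p" "q \<in> partitions"
      using kostka1_nonzero(2)[OF False] q less.prems by (auto simp: parts_def)
    then have "(schur1 k q :: 'a series) \<in> Xi r (sum_list q)" by (rule less.hyps)
    then show ?thesis using q by (auto simp: parts_def intro: Xi_scale)
  qed (simp add: mscale_simps Xi_zero)
  moreover have "prod_list (map (hsym k) p) \<in> Xi r (sum_list p)"
    using assms(1) by (intro Xi_prod_list hsym_in_Xi)
  ultimately show ?case unfolding eq by (intro Xi_diff Xi_sum)
qed

section \<open>Schur and monomial functions of r-partitions\<close>

definition kostka :: "nat \<Rightarrow> nat list list \<Rightarrow> nat list list \<Rightarrow> nat" where
  "kostka r l m = (\<Prod>k<r. kostka1 (l ! k) (m ! k))"

definition mrank :: "nat \<Rightarrow> nat list list \<Rightarrow> nat" where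
  "mrank r l = (\<Sum>k<r. nstat (l ! k))"

definition mpart_monom :: "nat \<Rightarrow> nat list list \<Rightarrow> (nat \<times> nat \<Rightarrow>\<^sub>0 nat)" where
  "mpart_monom r l = monom_of {..<r} (\<lambda>k. pfun (l ! k))"

lemma mparts_iff:
  "l \<in> mparts r N \<longleftrightarrow> length l = r \<and> (\<forall>k<r. l ! k \<in> partitions) \<and> (\<Sum>k<r. sum_list (l ! k)) = N"
  unfolding mparts_def
  by (auto simp: all_set_conv_all_nth subset_iff sum_list_sum_nth atLeast0LessThan in_set_conv_nth)

lemma finite_mparts: "finite (mparts r N)"
proof (rule finite_subset)
  show "mparts r N \<subseteq> {xs. set xs \<subseteq> (\<Union>b\<le>N. parts b) \<and> length xs = r}"
  proof
    fix l assume l: "l \<in> mparts r N"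
    have "p \<in> (\<Union>b\<le>N. parts b)" if "p \<in> set l" for p
      using l that member_le_sum_list[of "sum_list p" "map sum_list l"] by (auto simp: mparts_def parts_def)
    then show "l \<in> {xs. set xs \<subseteq> (\<Union>b\<le>N. parts b) \<and> length xs = r}" using l by (auto simp: mparts_def)
  qed
  show "finite {xs. set xs \<subseteq> (\<Union>b\<le>N. parts b) \<and> length xs = r}"
    by (rule finite_lists_length_eq) (auto simp: finite_parts)
qed

lemma fam_mpart_monom: "k < r \<Longrightarrow> fam k (mpart_monom r l) = pfun (l ! k)"
  unfolding mpart_monom_def by (rule fam_monom_of) (auto simp: fin_supp_pfun)

lemma in_fams_mpart_monom: "in_fams {..<r} (mpart_monom r l)"
  unfolding mpart_monom_def by (rule in_fams_monom_of) (auto simp: fin_supp_pfun)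

lemma mcoeff_schur_at:
  assumes "l \<in> mparts r N"
  shows "mcoeff (schur r l :: 'a::comm_ring_1 series) (mpart_monom r m) = of_nat (kostka r l m)"
proof -
  have "mcoeff (schur r l :: 'a series) (mpart_monom r m) = (\<Prod>k<r. mcoeff (schur1 k (l ! k)) (restr {k} (mpart_monom r m)))"
    unfolding schur_def using mcoeff_prod_families[of r "\<lambda>k. schur1 k (l ! k) :: 'a series" "mpart_monom r m"]
    by (simp add: supported_schur1 in_fams_mpart_monom)
  also have "\<dots> = (\<Prod>k<r. of_nat (kostka1 (l ! k) (m ! k)))"
  proof (rule prod.cong[OF refl])
    fix k assume k: "k \<in> {..<r}"
    have f: "fam k (restr {k} (mpart_monom r m)) = pfun (m ! k)" using k by (simp add: fam_restr fam_mpart_monom)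
    show "mcoeff (schur1 k (l ! k)) (restr {k} (mpart_monom r m)) = (of_nat (kostka1 (l ! k) (m ! k)) :: 'a)"
      using assms k vanishes_pfun[of "m ! k"]
      by (subst mcoeff_schur1[where n = "length (m ! k)"]) (auto simp: mparts_iff f in_fams_restr kostka1_def)
  qed
  finally show ?thesis by (simp add: kostka_def)
qed

lemma schur_in_Xi:
  assumes "l \<in> mparts r N" shows "(schur r l :: 'a::comm_ring_1 series) \<in> Xi r N"
proof -
  have "(\<Prod>k<r. schur1 k (l ! k) :: 'a series) \<in> Xi r (\<Sum>k<r. sum_list (l ! k))"
    using assms by (intro Xi_prod schur1_in_Xi) (auto simp: mparts_iff)
  then show ?thesis using assms by (simp add: schur_def mparts_iff)
qed

lemma kostka_nonzero:
  assumes "kostka r l m \<noteq> 0" "l \<in> mparts r N" "m \<in> mparts r N" "l \<noteq> m"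
  shows "mrank r l < mrank r m"
proof -
  have k: "l ! k = m ! k \<or> nstat (l ! k) < nstat (m ! k)" if "k < r" for k
    using assms that by (intro kostka1_nonzero(2)) (auto simp: kostka_def mparts_iff)
  have "\<exists>k<r. l ! k \<noteq> m ! k"
    using assms(2-4) by (metis mparts_iff nth_equalityI)
  then obtain k0 where "k0 < r" "l ! k0 \<noteq> m ! k0" by blast
  then show ?thesis
    unfolding mrank_def using k by (intro sum_strict_mono_ex1) (auto, metis less_imp_le order_refl)
qed

lemma kostka_self: "l \<in> mparts r N \<Longrightarrow> kostka r l l = 1"
  by (simp add: kostka_def kostka1_self mparts_iff)

text \<open>The matrix here is the transpose of the one in \<open>mcoeff_schur_at\<close>. This coincidence is the
orthonormality of the Schur functions under the form for which complete and monomial functions are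
dual.\<close>
lemma hsym_expand:
  assumes m: "m \<in> mparts r N"
  shows "(\<Prod>k<r. prod_list (map (hsym k) (m ! k))) =
    (\<Sum>l\<in>mparts r N. mscale (of_nat (kostka r l m)) (schur r l :: 'a::comm_ring_1 series))"
proof -
  let ?P = "\<lambda>k. parts (sum_list (m ! k))"
  let ?t = "\<lambda>l. mscale (of_nat (kostka r l m)) (schur r l :: 'a series)"
  let ?S = "{l. length l = r \<and> (\<forall>k<r. l ! k \<in> ?P k)}"
  have "(\<Prod>k<r. prod_list (map (hsym k) (m ! k)) :: 'a series) =
      (\<Sum>g\<in>PiE {..<r} ?P. \<Prod>k<r. mscale (of_nat (kostka1 (g k) (m ! k))) (schur1 k (g k)))"
    unfolding prod_list_hsym by (rule prod_sum_PiE) (auto simp: finite_parts)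
  also have "\<dots> = (\<Sum>l\<in>?S. ?t l)"
  proof (rule sum.reindex_bij_witness[of _ "\<lambda>l. restrict (nth l) {..<r}" "\<lambda>g. map g [0..<r]"])
    fix g assume g: "g \<in> PiE {..<r} ?P"
    show "restrict (nth (map g [0..<r])) {..<r} = g" using g by (auto simp: PiE_def extensional_def)
    show "map g [0..<r] \<in> ?S" using g by auto
    show "?t (map g [0..<r]) = (\<Prod>k<r. mscale (of_nat (kostka1 (g k) (m ! k))) (schur1 k (g k)))"
      by (simp add: mscale_prod kostka_def schur_def)
  qed (auto intro!: nth_equalityI)
  also have "\<dots> = (\<Sum>l\<in>mparts r N. ?t l)"
  proof (rule sum.mono_neutral_left[OF finite_mparts])
    show "?S \<subseteq> mparts r N" using m by (auto simp: mparts_iff parts_def)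
    show "\<forall>l\<in>mparts r N - ?S. ?t l = 0"
    proof
      fix l assume l: "l \<in> mparts r N - ?S"
      then obtain k where k: "k < r" "l ! k \<notin> ?P k" by (auto simp: mparts_iff)
      then have "kostka1 (l ! k) (m ! k) = 0"
        using kostka1_nonzero(1)[of "l ! k" "m ! k"] l m by (auto simp: mparts_iff parts_def)
      then have "kostka r l m = 0" using k by (auto simp: kostka_def)
      then show "?t l = 0" by (simp add: mscale_simps)
    qed
  qed
  finally show ?thesis .
qed

text \<open>By symmetry a series of \<open>Xi r N\<close> is determined by its coefficients at the monomials of the
\<open>r\<close>-partitions of \<open>N\<close>, since these meet every orbit of the permutations of the variables.\<close>
lemma Xi_eq_zero:
  assumes f: "f \<in> Xi r N" and zero: "\<And>l. l \<in> mparts r N \<Longrightarrow> mcoeff f (mpart_monom r l) = 0"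
  shows "mcoeff f M = 0"
proof (rule ccontr)
  assume nz: "mcoeff f M \<noteq> 0"
  then have M: "in_fams {..<r} M" "mdeg M = N" using f by (auto simp: Xi_iff)
  have "\<exists>p \<pi>. p \<in> partitions \<and> bij \<pi> \<and> (\<forall>i. pfun p i = fam k M (\<pi> i))" for k
    using fam_fin_supp[of k M] sort_to_partition unfolding fin_supp_def by metis
  then obtain P \<pi> where P: "\<And>k. P k \<in> partitions" "\<And>k. bij (\<pi> k)" "\<And>k i. pfun (P k) i = fam k M (\<pi> k i)"
    by metis
  let ?l = "map P [0..<r]"
  have eq: "mpart_monom r ?l = act \<pi> M"
    by (rule in_fams_eqI[where K = "{..<r}"])
      (auto simp: in_fams_mpart_monom in_fams_act[OF P(2)] M fam_mpart_monom fun_eq_iff fam_act[OF P(2)] P(3))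
  have "mdeg (mpart_monom r ?l) = (\<Sum>k<r. sum_list (P k))"
  proof -
    define n where "n = Max (insert 0 ((\<lambda>k. length (P k)) ` {..<r}))"
    have n: "vanishes n (pfun (P k))" if "k < r" for k
      by (rule vanishes_mono[OF vanishes_pfun]) (use that in \<open>auto simp: n_def intro!: Max_ge\<close>)
    have "mdeg (mpart_monom r ?l) = (\<Sum>k<r. \<Sum>i<n. fam k (mpart_monom r ?l) i)"
      by (rule mdeg_fam) (auto simp: in_fams_mpart_monom fam_mpart_monom n)
    also have "\<dots> = (\<Sum>k<r. sum_list (P k))"
      by (intro sum.cong) (auto simp: fam_mpart_monom fsize_pfun[symmetric] fsize_eq[OF n])
    finally show ?thesis .
  qed
  then have "?l \<in> mparts r N" using P(1) M(2) mdeg_act[of \<pi> M, OF P(2)] by (simp add: mparts_iff eq)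
  then have "mcoeff f (act \<pi> M) = 0" using zero[of ?l] eq by simp
  then show False using nz Xi_act[OF f, of \<pi> M] P(2) by simp
qed

lemma Xi_eqI:
  fixes f g :: "'a::comm_ring_1 series"
  assumes "f \<in> Xi r N" "g \<in> Xi r N" "\<And>l. l \<in> mparts r N \<Longrightarrow> mcoeff f (mpart_monom r l) = mcoeff g (mpart_monom r l)"
  shows "f = g"
proof (rule mfps_eqI)
  fix M show "mcoeff f M = mcoeff g M"
    using Xi_eq_zero[OF Xi_diff[OF assms(1,2)], of M] assms(3) by simp
qed

text \<open>Comparing coefficients at the monomials of the \<open>r\<close>-partitions gives a linear system with the Kostka
matrix. That matrix is unitriangular with non-negative integer entries, so the system can be solved
without leaving \<open>A\<close>.\<close>
lemma (in local_subring) schur_expand: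
  assumes f: "f \<in> Xi r N" and A: "\<And>M. mcoeff f M \<in> A"
  obtains a where "\<And>l. l \<in> mparts r N \<Longrightarrow> a l \<in> A" "f = (\<Sum>l\<in>mparts r N. mscale (a l) (schur r l))"
proof -
  have "\<exists>a. (\<forall>l\<in>mparts r N. a l \<in> A) \<and>
    (\<forall>m\<in>mparts r N. (\<Sum>l\<in>mparts r N. a l * of_nat (kostka r l m)) = mcoeff f (mpart_monom r m))"
  proof (rule triangular_solve[where \<phi> = "mrank r"])
    show "mrank r i < mrank r j" if "i \<in> mparts r N" "j \<in> mparts r N" "i \<noteq> j" "\<rho> (of_nat (kostka r i j)) \<noteq> 0" for i j
      using that by (intro kostka_nonzero) (auto simp: res_of_nat intro!: Nat.gr0I)
  qed (auto simp: finite_mparts of_nat_mem res_of_nat kostka_self A res_one)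
  then obtain a where a: "\<forall>l\<in>mparts r N. a l \<in> A"
    "\<forall>m\<in>mparts r N. (\<Sum>l\<in>mparts r N. a l * of_nat (kostka r l m)) = mcoeff f (mpart_monom r m)" by blast
  have "f = (\<Sum>l\<in>mparts r N. mscale (a l) (schur r l))"
    using a(2) by (intro Xi_eqI[OF f] Xi_sum Xi_scale schur_in_Xi) (auto simp: mcoeff_schur_at)
  then show thesis using that a(1) by blast
qed

text \<open>Independence of an indexed family, which includes its injectivity. It allows one to pass from the
coordinates \<open>mfps.representation\<close> with respect to a set of vectors to coefficients indexed by
\<open>r\<close>-partitions.\<close>
definition lin_indep_on :: "'i set \<Rightarrow> ('i \<Rightarrow> ('v, 'a::field) mfps) \<Rightarrow> bool" where
  "lin_indep_on I b \<longleftrightarrow> finite I \<and> (\<forall>c. (\<Sum>i\<in>I. mscale (c i) (b i)) = 0 \<longrightarrow> (\<forall>i\<in>I. c i = 0))"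

lemma lin_indep_onD:
  "lin_indep_on I b \<Longrightarrow> (\<Sum>i\<in>I. mscale (c i) (b i)) = 0 \<Longrightarrow> i \<in> I \<Longrightarrow> c i = 0"
  unfolding lin_indep_on_def by blast

lemma lin_indep_on_inj:
  fixes b :: "'i \<Rightarrow> ('v, 'a::field) mfps"
  assumes "lin_indep_on I b" shows "inj_on b I"
proof (rule inj_onI, rule ccontr)
  fix i j assume ij: "i \<in> I" "j \<in> I" "b i = b j" "i \<noteq> j"
  let ?c = "\<lambda>k. if k = i then 1 else if k = j then - 1 else (0 :: 'a)"
  have fin: "finite I" using assms by (simp add: lin_indep_on_def)
  have "(\<Sum>k\<in>I. mscale (?c k) (b k)) = (\<Sum>k\<in>I. (if k = i then b i else 0) + (if k = j then - b i else 0))"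
    by (rule sum.cong) (use ij in \<open>auto intro!: mfps_eqI\<close>)
  also have "\<dots> = 0" using fin ij by (simp add: sum.distrib)
  finally have "(\<Sum>k\<in>I. mscale (?c k) (b k)) = 0" .
  from lin_indep_onD[OF assms this ij(1)] show False by simp
qed

lemma lin_indep_on_coeffs_eq:
  assumes "lin_indep_on I b" "(\<Sum>i\<in>I. mscale (c i) (b i)) = (\<Sum>i\<in>I. mscale (d i) (b i))" "i \<in> I"
  shows "c i = d i"
proof -
  have "(\<Sum>i\<in>I. mscale (c i - d i) (b i)) = (\<Sum>i\<in>I. mscale (c i) (b i)) - (\<Sum>i\<in>I. mscale (d i) (b i))"
    unfolding sum_subtractf[symmetric] by (rule sum.cong) (auto intro!: mfps_eqI simp: algebra_simps)
  also have "\<dots> = 0" using assms(2) by simp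
  finally show ?thesis using lin_indep_onD[OF assms(1), of "\<lambda>i. c i - d i", OF _ assms(3)] by simp
qed

lemma representation_family:
  assumes ind: "lin_indep_on I b" and j: "j \<in> I"
  shows "mfps.representation (b ` I) (\<Sum>i\<in>I. mscale (c i) (b i)) (b j) = c j"
proof -
  have inj: "inj_on b I" using lin_indep_on_inj[OF ind] .
  have fin: "finite I" using ind by (simp add: lin_indep_on_def)
  have indep: "mfps.independent (b ` I)"
  proof (rule mfps.independent_if_scalars_zero)
    fix f x assume "(\<Sum>x\<in>b ` I. mscale (f x) x) = 0" "x \<in> b ` I"
    then show "f x = 0" using ind inj unfolding lin_indep_on_def by (auto simp: sum.reindex)
  qed (use fin in simp)
  have sp: "b i \<in> mfps.span (b ` I)" if "i \<in> I" for i using that by (simp add: mfps.span_base)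
  have "mfps.representation (b ` I) (\<Sum>i\<in>I. mscale (c i) (b i)) (b j) =
      (\<Sum>i\<in>I. c i * (if b j = b i then 1 else 0))"
    using indep sp
    by (simp add: mfps.representation_sum mfps.span_scale mfps.representation_scale mfps.representation_basis)
  also have "\<dots> = (\<Sum>i\<in>I. if i = j then c i else 0)"
    by (rule sum.cong) (use inj j in \<open>auto simp: inj_on_def\<close>)
  finally show ?thesis using fin j by simp
qed

lemma schur_lin_indep: "lin_indep_on (mparts r N) (schur r :: _ \<Rightarrow> 'a::field series)"
  unfolding lin_indep_on_def
proof (intro conjI allI impI ballI finite_mparts)
  fix c :: "nat list list \<Rightarrow> 'a" and l
  assume c: "(\<Sum>i\<in>mparts r N. mscale (c i) (schur r i)) = 0" and l: "l \<in> mparts r N"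
  interpret local_subring UNIV "\<lambda>x::'a. x" by (rule local_subring_UNIV)
  obtain b where b: "\<And>i j. i \<in> mparts r N \<Longrightarrow> j \<in> mparts r N \<Longrightarrow>
      (\<Sum>k\<in>mparts r N. of_nat (kostka r i k) * b k j) = (if i = j then 1 else 0 :: 'a)"
  proof (rule triangular_inverse[where I = "mparts r N" and g = "\<lambda>i j. of_nat (kostka r i j)" and \<phi> = "mrank r"])
    show "mrank r i < mrank r j" if "i \<in> mparts r N" "j \<in> mparts r N" "i \<noteq> j" "of_nat (kostka r i j) \<noteq> (0::'a)" for i j
      using that by (intro kostka_nonzero) (auto intro!: Nat.gr0I)
  qed (auto simp: finite_mparts kostka_self)
  have ev: "(\<Sum>i\<in>mparts r N. c i * of_nat (kostka r i m)) = 0" for m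
    using arg_cong[OF c, of "\<lambda>f. mcoeff f (mpart_monom r m)"] by (simp add: mcoeff_schur_at)
  have "(\<Sum>i\<in>mparts r N. c i * (\<Sum>m\<in>mparts r N. of_nat (kostka r i m) * b m l)) =
      (\<Sum>m\<in>mparts r N. (\<Sum>i\<in>mparts r N. c i * of_nat (kostka r i m)) * b m l)"
    by (simp add: sum_distrib_left sum_distrib_right mult.assoc) (rule sum.swap)
  then have "(\<Sum>i\<in>mparts r N. c i * (if i = l then 1 else 0)) = 0"
    using b l ev by simp
  then show "c l = 0" using l finite_mparts by (simp add: if_distrib cong: if_cong)
qed

text \<open>Two monomials of one family are related by a permutation of the variables iff they have the same
multiset of exponents; \<open>monom1 k p\<close> is the sum of the monomials with exponents \<open>p\<close>.\<close>
definition exponents :: "('v \<Rightarrow>\<^sub>0 nat) \<Rightarrow> nat multiset" where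
  "exponents M = image_mset (Poly_Mapping.lookup M) (mset_set (Poly_Mapping.keys M))"

lemma mcoeff_monom1: "mcoeff (monom1 k p :: 'a::comm_ring_1 series) M =
    (if in_fams {k} M \<and> exponents M = mset p then 1 else 0)"
  by (simp add: monom1_def in_fams_def exponents_def)

lemma exponents_act:
  assumes "\<And>k. bij (\<pi> k)" shows "exponents (act \<pi> M) = exponents M"
proof -
  let ?h = "\<lambda>(k, i). (k, \<pi> k i)"
  have inj: "inj ?h" using assms by (rule inj_act)
  have "surj ?h"
  proof (rule surjI)
    fix v show "?h ((\<lambda>(k, i). (k, inv (\<pi> k) i)) v) = v"
      using assms by (cases v) (simp add: bij_is_surj surj_f_inv_f)
  qed
  have keys: "Poly_Mapping.keys (act \<pi> M) = ?h -` Poly_Mapping.keys M"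
    unfolding act_def using inj by (rule keys_map_key)
  have img: "?h ` Poly_Mapping.keys (act \<pi> M) = Poly_Mapping.keys M"
    unfolding keys using \<open>surj ?h\<close> by (simp add: surj_image_vimage_eq)
  have "exponents (act \<pi> M) =
      image_mset (Poly_Mapping.lookup M) (image_mset ?h (mset_set (Poly_Mapping.keys (act \<pi> M))))"
    using assms unfolding exponents_def image_mset.compositionality
    by (intro image_mset_cong) (auto simp: lookup_act)
  also have "image_mset ?h (mset_set (Poly_Mapping.keys (act \<pi> M))) = mset_set (Poly_Mapping.keys M)"
    using image_mset_mset_set[OF inj_on_subset[OF inj subset_UNIV], of "Poly_Mapping.keys (act \<pi> M)"] img by simp
  finally show ?thesis by (simp add: exponents_def)
qed

lemma monom1_in_Xi: "k < r \<Longrightarrow> (monom1 k p :: 'a::comm_ring_1 series) \<in> Xi r (sum_list p)"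
  unfolding Xi_iff
proof (intro conjI allI impI)
  fix M assume k: "k < r" and "mcoeff (monom1 k p :: 'a series) M \<noteq> 0"
  then have *: "in_fams {k} M" "exponents M = mset p" by (auto simp: mcoeff_monom1 split: if_splits)
  show "in_fams {..<r} M" using *(1) k by (auto simp: in_fams_def)
  show "mdeg M = sum_list p"
    unfolding mdeg_def sum_unfold_sum_mset *(2)[unfolded exponents_def] by (rule sum_mset_sum_list)
next
  fix \<pi> :: "nat \<Rightarrow> nat \<Rightarrow> nat" and M assume "\<forall>k. bij (\<pi> k)"
  then show "mcoeff (monom1 k p :: 'a series) (act \<pi> M) = mcoeff (monom1 k p) M"
    using in_fams_act[of \<pi> "{k}" M] exponents_act[of \<pi> M] by (simp add: mcoeff_monom1)
qed

lemma msym_in_Xi: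
  assumes "l \<in> mparts r N" shows "(msym r l :: 'a::comm_ring_1 series) \<in> Xi r N"
proof -
  have "(\<Prod>k<r. monom1 k (l ! k) :: 'a series) \<in> Xi r (\<Sum>k<r. sum_list (l ! k))"
    by (intro Xi_prod monom1_in_Xi) auto
  then show ?thesis using assms by (simp add: msym_def mparts_iff)
qed

lemma partition_mset_eq:
  assumes "p \<in> partitions" "q \<in> partitions" "mset p = mset q" shows "p = q"
proof -
  have "sorted (rev p)" "sorted (rev q)" using assms by (auto simp: partitions_def sorted_wrt_rev)
  then have "rev p = rev q" using assms(3) by (metis mset_rev properties_for_sort)
  then show ?thesis by simp
qed

lemma monom1_at_partition:
  assumes q: "q \<in> partitions" and p: "p \<in> partitions" and M: "in_fams {k} M" "fam k M = pfun q"
  shows "mcoeff (monom1 k p :: 'a::comm_ring_1 series) M = (if p = q then 1 else 0)"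
proof -
  have "Poly_Mapping.keys M = Pair k ` {..<length q}"
  proof (intro set_eqI)
    fix v :: "nat \<times> nat" obtain k' i where v: "v = (k', i)" by (cases v)
    have "pfun q i \<noteq> 0 \<longleftrightarrow> i < length q" using pfun_pos[OF q, of i] by (auto simp: pfun_def)
    then show "v \<in> Poly_Mapping.keys M \<longleftrightarrow> v \<in> Pair k ` {..<length q}"
      using in_famsD[OF M(1), of v] fun_cong[OF M(2), of i] unfolding v
      by (cases "k' = k") (auto simp: in_keys_iff fam_def)
  qed
  then have "exponents M = image_mset (Poly_Mapping.lookup M \<circ> Pair k) (mset_set {..<length q})"
    by (simp add: exponents_def image_mset_mset_set[symmetric] inj_on_def image_mset.compositionality)
  also have "Poly_Mapping.lookup M \<circ> Pair k = pfun q"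
    using M(2) by (auto simp: fam_def fun_eq_iff)
  also have "image_mset (pfun q) (mset_set {..<length q}) = mset (map (pfun q) [0..<length q])"
    by (simp add: atLeast0LessThan)
  also have "map (pfun q) [0..<length q] = q" by (rule nth_equalityI) (auto simp: pfun_def)
  finally have "exponents M = mset q" .
  then show ?thesis using M(1) partition_mset_eq[OF p q] unfolding mcoeff_monom1 by auto
qed

lemma mcoeff_msym_at:
  assumes "l \<in> mparts r N" "m \<in> mparts r N"
  shows "mcoeff (msym r l :: 'a::comm_ring_1 series) (mpart_monom r m) = (if l = m then 1 else 0)"
proof -
  have s: "supported {k} (monom1 k p :: 'a series)" for k p
    by (simp add: supported_def mcoeff_monom1)
  have "mcoeff (msym r l :: 'a series) (mpart_monom r m) = (\<Prod>k<r. mcoeff (monom1 k (l ! k)) (restr {k} (mpart_monom r m)))"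
    unfolding msym_def using mcoeff_prod_families[of r "\<lambda>k. monom1 k (l ! k) :: 'a series" "mpart_monom r m"]
    by (simp add: s in_fams_mpart_monom)
  also have "\<dots> = (\<Prod>k<r. if l ! k = m ! k then 1 else 0)"
    by (rule prod.cong[OF refl], rule monom1_at_partition)
      (use assms in \<open>auto simp: mparts_iff in_fams_restr fam_restr fam_mpart_monom\<close>)
  also have "\<dots> = (if \<forall>k<r. l ! k = m ! k then 1 else 0)"
    by (auto intro!: prod.neutral prod_zero) 
  also have "(\<forall>k<r. l ! k = m ! k) \<longleftrightarrow> l = m"
    using assms nth_equalityI[of l m] by (auto simp: mparts_iff)
  finally show ?thesis .
qed

lemma msym_expand:
  assumes "f \<in> Xi r N"
  shows "f = (\<Sum>l\<in>mparts r N. mscale (mcoeff f (mpart_monom r l)) (msym r l :: 'a::comm_ring_1 series))"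
proof (rule Xi_eqI[OF assms])
  fix m assume m: "m \<in> mparts r N"
  have "(\<Sum>l\<in>mparts r N. mcoeff f (mpart_monom r l) * mcoeff (msym r l) (mpart_monom r m)) =
      (\<Sum>l\<in>mparts r N. if l = m then mcoeff f (mpart_monom r l) else 0)"
    by (rule sum.cong) (use m in \<open>auto simp: mcoeff_msym_at\<close>)
  then show "mcoeff f (mpart_monom r m) = mcoeff (\<Sum>l\<in>mparts r N. mscale (mcoeff f (mpart_monom r l)) (msym r l)) (mpart_monom r m)"
    using m finite_mparts by simp
qed (intro Xi_sum Xi_scale msym_in_Xi)

lemma msym_lin_indep: "lin_indep_on (mparts r N) (msym r :: _ \<Rightarrow> 'a::field series)"
  unfolding lin_indep_on_def
proof (intro conjI allI impI ballI finite_mparts)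
  fix c :: "nat list list \<Rightarrow> 'a" and m
  assume c: "(\<Sum>i\<in>mparts r N. mscale (c i) (msym r i)) = 0" and m: "m \<in> mparts r N"
  have "0 = (\<Sum>i\<in>mparts r N. c i * mcoeff (msym r i) (mpart_monom r m))"
    using arg_cong[OF c, of "\<lambda>f. mcoeff f (mpart_monom r m)"] by simp
  also have "\<dots> = (\<Sum>i\<in>mparts r N. if i = m then c i else 0)"
    by (rule sum.cong) (use m in \<open>auto simp: mcoeff_msym_at\<close>)
  finally show "c m = 0" using m finite_mparts by simp
qed

section \<open>The generating functions q\<close>

text \<open>The elementary symmetric function of degree \<open>b\<close> in the family \<open>k\<close>. With the truncations \<open>hsym_fin\<close> and
\<open>esym_fin\<close> to the first \<open>n\<close> variables it serves to compute the finite products that define \<open>qplus1\<close>.\<close>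
definition esym :: "nat \<Rightarrow> nat \<Rightarrow> 'a::comm_ring_1 series" where
  "esym k b = Abs_mfps (\<lambda>M. if in_fams {k} M \<and> mdeg M = b \<and> (\<forall>i. fam k M i \<le> 1) then 1 else 0)"

definition hsym_fin :: "nat \<Rightarrow> nat \<Rightarrow> nat \<Rightarrow> 'a::comm_ring_1 series" where
  "hsym_fin k n b = Abs_mfps (\<lambda>M. if vanishes n (fam k M) then mcoeff (hsym k b) M else 0)"

definition esym_fin :: "nat \<Rightarrow> nat \<Rightarrow> nat \<Rightarrow> 'a::comm_ring_1 series" where
  "esym_fin k n b = Abs_mfps (\<lambda>M. if vanishes n (fam k M) then mcoeff (esym k b) M else 0)"

definition xmon :: "('v \<Rightarrow>\<^sub>0 nat) \<Rightarrow> ('v, 'a::comm_ring_1) mfps" where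
  "xmon A = Abs_mfps (\<lambda>M. if M = A then 1 else 0)"

lemma mcoeff_mult_xmon: "mcoeff (f * xmon A) (B + A) = mcoeff f B"
proof -
  have "mcoeff (f * xmon A) (B + A) = (\<Sum>p\<in>antidiag (B + A). if p = (B, A) then mcoeff f B else 0)"
    unfolding mcoeff_mult xmon_def by (rule sum.cong) (auto simp: antidiag_def split: if_splits)
  then show ?thesis by (simp add: sum.delta) (simp add: antidiag_def)
qed

lemma mcoeff_mult_xmon_zero: "(\<And>B. M \<noteq> B + A) \<Longrightarrow> mcoeff (f * xmon A) M = 0"
proof (rule ccontr)
  assume *: "\<And>B. M \<noteq> B + A" "mcoeff (f * xmon A) M \<noteq> 0"
  from *(2) obtain B C where "M = B + C" "mcoeff f B \<noteq> 0" "mcoeff (xmon A) C \<noteq> (0 :: 'b)"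
    by (rule mcoeff_mult_nonzero)
  then show False using *(1)[of B] by (auto simp: xmon_def split: if_splits)
qed

lemma xmon_mult: "xmon A * xmon B = xmon (A + B)"
proof (rule mfps_eqI)
  fix M show "mcoeff (xmon A * xmon B :: ('a, 'b) mfps) M = mcoeff (xmon (A + B)) M"
  proof (cases "\<exists>C. M = C + B")
    case True
    then obtain C where "M = C + B" by blast
    then show ?thesis by (simp add: mcoeff_mult_xmon) (simp add: xmon_def)
  next
    case False
    then show ?thesis by (subst mcoeff_mult_xmon_zero) (auto simp: xmon_def)
  qed
qed

lemma mvar_power: "mvar v ^ i = (xmon (Poly_Mapping.single v i) :: ('v, 'a::comm_ring_1) mfps)"
proof (induction i)
  case 0
  show ?case by (rule mfps_eqI) (simp add: xmon_def)
next
  case (Suc i)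
  have "mvar v = (xmon (Poly_Mapping.single v 1) :: ('v, 'a) mfps)" by (simp add: mvar_def xmon_def)
  then show ?case unfolding power_Suc Suc.IH by (simp add: xmon_mult single_add[symmetric])
qed

definition drop_var :: "nat \<Rightarrow> nat \<Rightarrow> (nat \<times> nat \<Rightarrow>\<^sub>0 nat) \<Rightarrow> (nat \<times> nat \<Rightarrow>\<^sub>0 nat)" where
  "drop_var k n M = M - Poly_Mapping.single (k, n) (fam k M n)"

lemma drop_var_add: "drop_var k n M + Poly_Mapping.single (k, n) (fam k M n) = M"
  by (rule poly_mapping_eqI) (auto simp: drop_var_def lookup_add lookup_minus lookup_single when_def fam_def)

lemma fam_drop_var: "fam k (drop_var k n M) = (fam k M)(n := 0)"
  by (auto simp: drop_var_def fam_def lookup_minus lookup_single when_def fun_eq_iff)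

lemma in_fams_drop_var: "in_fams {k} (drop_var k n M) \<longleftrightarrow> in_fams {k} M"
  by (auto simp: in_fams_iff drop_var_def lookup_minus lookup_single when_def)

lemma mdeg_single: "mdeg (Poly_Mapping.single v c) = c"
  by (simp add: mdeg_def)

lemma mdeg_drop_var: "mdeg M = mdeg (drop_var k n M) + fam k M n"
  using arg_cong[OF drop_var_add[of k n M], of mdeg] by (simp add: mdeg_add mdeg_single)

text \<open>If \<open>F\<close> is free of the variable \<open>(k, n)\<close>, the power of that variable in \<open>M\<close> must come from the
second factor.\<close>
lemma mcoeff_mult_new_var:
  assumes F: "\<And>M. mcoeff F M \<noteq> 0 \<Longrightarrow> fam k M n = 0"
  shows "mcoeff (F * xmon (Poly_Mapping.single (k, n) c)) M = (if fam k M n = c then mcoeff F (drop_var k n M) else 0)"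
proof (cases "fam k M n = c")
  case True
  then show ?thesis using mcoeff_mult_xmon[of F "Poly_Mapping.single (k, n) c" "drop_var k n M"] drop_var_add[of k n M] by simp
next
  case False
  have "mcoeff (F * xmon (Poly_Mapping.single (k, n) c)) M = 0"
  proof (rule ccontr)
    assume "mcoeff (F * xmon (Poly_Mapping.single (k, n) c)) M \<noteq> 0"
    then obtain A B where AB: "M = A + B" "mcoeff F A \<noteq> 0" "mcoeff (xmon (Poly_Mapping.single (k, n) c) :: 'a series) B \<noteq> 0"
      by (rule mcoeff_mult_nonzero)
    then have "B = Poly_Mapping.single (k, n) c" by (auto simp: xmon_def split: if_splits)
    then have "fam k M n = c" using AB(1) F[OF AB(2)] by (simp add: fam_def lookup_add)
    then show False using False by simp
  qed
  then show ?thesis using False by simp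
qed

lemma vanishes_Suc_iff: "vanishes (Suc n) f \<longleftrightarrow> vanishes n (f(n := 0))"
proof -
  have "n \<le> i \<longleftrightarrow> i = n \<or> Suc n \<le> i" for i by auto
  then show ?thesis unfolding vanishes_def by auto
qed

lemma vanishes_iff_Suc: "vanishes n f \<longleftrightarrow> vanishes (Suc n) f \<and> f n = 0"
proof -
  have "n \<le> i \<longleftrightarrow> i = n \<or> Suc n \<le> i" for i by auto
  then show ?thesis unfolding vanishes_def by auto
qed

lemma vanishes_at: "vanishes n f \<Longrightarrow> f n = 0"
  by (simp add: vanishes_def)

lemma no_variables_iff: "in_fams {k} M \<and> vanishes 0 (fam k M) \<longleftrightarrow> M = 0"
proof
  assume "in_fams {k} M \<and> vanishes 0 (fam k M)"
  then show "M = 0"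
    by (intro in_fam_eqI[of k]) (auto simp: vanishes_def in_fams_def fam_def fun_eq_iff)
qed (auto simp: vanishes_def in_fams_def fam_def)

lemma prod_geometric:
  "fps_nth (\<Prod>i<n. Abs_fps (\<lambda>j. mvar (k, i) ^ j)) b = (hsym_fin k n b :: 'a::comm_ring_1 series)"
proof (induction n arbitrary: b)
  case 0
  show ?case
  proof (rule mfps_eqI)
    fix M
    show "mcoeff (fps_nth (\<Prod>i<0. Abs_fps (\<lambda>j. mvar (k, i) ^ j)) b) M = mcoeff (hsym_fin k 0 b :: 'a series) M"
      using no_variables_iff[of k M] by (cases "M = 0") (auto simp: hsym_fin_def hsym_def)
  qed
next
  case (Suc n)
  have F: "fam k M n = 0" if "mcoeff (hsym_fin k n i :: 'a series) M \<noteq> 0" for i M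
    using that vanishes_at[of n "fam k M"] by (auto simp: hsym_fin_def split: if_splits)
  show ?case
  proof (rule mfps_eqI)
    fix M
    let ?a = "fam k M n" and ?B = "drop_var k n M"
    have "mcoeff (fps_nth (\<Prod>i<Suc n. Abs_fps (\<lambda>j. mvar (k, i) ^ j)) b :: 'a series) M =
        (\<Sum>i=0..b. if ?a = b - i then mcoeff (hsym_fin k n i :: 'a series) ?B else 0)"
      using Suc.IH by (simp add: fps_mult_nth mvar_power mcoeff_mult_new_var[OF F])
    also have "\<dots> = (\<Sum>i=0..b. if i = b - ?a then (if ?a \<le> b then mcoeff (hsym_fin k n i :: 'a series) ?B else 0) else 0)"
      by (rule sum.cong) auto
    also have "\<dots> = (if ?a \<le> b then mcoeff (hsym_fin k n (b - ?a) :: 'a series) ?B else 0)"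
      by simp
    also have "\<dots> = mcoeff (hsym_fin k (Suc n) b) M"
      using mdeg_drop_var[of M k n]
      by (auto simp: hsym_fin_def hsym_def vanishes_Suc_iff fam_drop_var in_fams_drop_var)
    finally show "mcoeff (fps_nth (\<Prod>i<Suc n. Abs_fps (\<lambda>j. mvar (k, i) ^ j)) b) M = mcoeff (hsym_fin k (Suc n) b :: 'a series) M" .
  qed
qed

lemma esym_fin_0: "esym_fin k n 0 = 1"
proof (rule mfps_eqI)
  fix M :: "nat \<times> nat \<Rightarrow>\<^sub>0 nat"
  have "mdeg M = 0 \<longleftrightarrow> M = 0"
  proof
    assume "mdeg M = 0"
    then have "\<forall>v\<in>Poly_Mapping.keys M. Poly_Mapping.lookup M v = 0" by (simp add: mdeg_def)
    then have "Poly_Mapping.keys M = {}" by (metis all_not_in_conv in_keys_iff)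
    then show "M = 0" by simp
  qed simp
  then show "mcoeff (esym_fin k n 0) M = mcoeff 1 M"
    by (cases "M = 0") (auto simp: esym_fin_def esym_def vanishes_def in_fams_def fam_def)
qed

lemma esym_0: "esym k 0 = 1"
proof (rule mfps_eqI)
  fix M
  obtain n where "vanishes n (fam k M)" using fam_fin_supp by (auto simp: fin_supp_def)
  then show "mcoeff (esym k 0) M = mcoeff 1 M"
    using arg_cong[OF esym_fin_0[of k n], of "\<lambda>f. mcoeff f M"] by (simp add: esym_fin_def)
qed

lemma prod_linear:
  "fps_nth (\<Prod>i<n. 1 - fps_const (mconst t * mvar (k, i)) * fps_X) b =
    mscale ((- t) ^ b) (esym_fin k n b :: 'a::comm_ring_1 series)"
proof (induction n arbitrary: b)
  case 0
  show ?case
  proof (cases b)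
    case 0
    then show ?thesis by (simp add: esym_fin_0 mscale_simps)
  next
    case (Suc c)
    have "mcoeff (esym_fin k 0 b :: 'a series) M = 0" for M
    proof -
      show ?thesis using Suc no_variables_iff[of k M] by (auto simp: esym_fin_def esym_def)
    qed
    then have "esym_fin k 0 b = (0 :: 'a series)" by (intro mfps_eqI) simp
    then show ?thesis using Suc by (simp add: mscale_simps)
  qed
next
  case (Suc n)
  let ?P = "\<Prod>i<n. 1 - fps_const (mconst t * mvar (k, i)) * fps_X :: 'a series fps"
  have P: "(\<Prod>i<Suc n. 1 - fps_const (mconst t * mvar (k, i)) * fps_X) = ?P - (?P * fps_const (mconst t * mvar (k, n))) * fps_X"
    by (simp add: algebra_simps)
  show ?case
  proof (cases b)
    case 0
    then show ?thesis unfolding P using Suc.IH[of 0] by (simp add: esym_fin_0)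
  next
    case (Suc c)
    have F: "fam k M n = 0" if "mcoeff (esym_fin k n c :: 'a series) M \<noteq> 0" for M
      using that vanishes_at[of n "fam k M"] by (auto simp: esym_fin_def split: if_splits)
    have rec: "esym_fin k (Suc n) (Suc c) = esym_fin k n (Suc c) + esym_fin k n c * (mvar (k, n) :: 'a series)"
    proof (rule mfps_eqI)
      fix M
      have v: "mvar (k, n) = (xmon (Poly_Mapping.single (k, n) 1) :: 'a series)"
        using mvar_power[of "(k, n)" 1] by simp
      have r: "mcoeff (esym_fin k n c * (mvar (k, n) :: 'a series)) M =
          (if fam k M n = 1 then mcoeff (esym_fin k n c) (drop_var k n M) else 0)"
        unfolding v by (rule mcoeff_mult_new_var[OF F])
      have van: "vanishes n (fam k M) \<longleftrightarrow> vanishes (Suc n) (fam k M) \<and> fam k M n = 0"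
        by (rule vanishes_iff_Suc)
      have le: "(\<forall>i. ((fam k M)(n := 0)) i \<le> 1) \<longleftrightarrow> (\<forall>i. fam k M i \<le> 1)" if "fam k M n \<le> 1"
        using that by (auto simp: fun_upd_def)
      consider "fam k M n = 0" | "fam k M n = 1" | "fam k M n \<ge> 2" by linarith
      then show "mcoeff (esym_fin k (Suc n) (Suc c)) M = mcoeff (esym_fin k n (Suc c) + esym_fin k n c * (mvar (k, n) :: 'a series)) M"
      proof cases
        case 1
        then show ?thesis using van by (simp add: r) (simp add: esym_fin_def)
      next
        case 2
        then show ?thesis using van le mdeg_drop_var[of M k n]
          by (simp add: r) (simp add: esym_fin_def esym_def vanishes_Suc_iff fam_drop_var in_fams_drop_var)
      next
        case 3
        then have "\<not> (\<forall>i. fam k M i \<le> 1)" by (metis one_less_numeral_iff not_less order_less_le_trans semiring_norm(76))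
        then show ?thesis using 3 van by (simp add: r) (auto simp: esym_fin_def esym_def)
      qed
    qed
    show ?thesis unfolding P Suc using Suc.IH
      by (simp add: rec mscale_simps mconst_mult)
         (rule mfps_eqI, simp add: algebra_simps)
  qed
qed

text \<open>The product of the series \<open>\<Prod>(1 - t u x)\<close> over the family before \<open>k\<close>, whose coefficients are the
\<open>(- t)\<^sup>i e\<^sub>i\<close>, and \<open>\<Prod>1 / (1 - u x)\<close> over the family \<open>k\<close>, whose coefficients are the \<open>h\<^sub>j\<close>. At a given
monomial the truncated products are constant once \<open>n\<close> exceeds the indices of all its variables, and
this is the limit by which \<open>qplus1\<close> is defined.\<close>
lemma qplus1_eq:
  "qplus1 r k t b = (\<Sum>i=0..b. mscale ((- t) ^ i) (esym (cpred r k) i * (hsym k (b - i) :: 'a::comm_ring_1 series)))"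
proof (rule mfps_eqI)
  fix M
  let ?k = "cpred r k"
  let ?rhs = "mcoeff (\<Sum>i=0..b. mscale ((- t) ^ i) (esym ?k i * (hsym k (b - i) :: 'a series))) M"
  obtain n1 n2 where n12: "vanishes n1 (fam ?k M)" "vanishes n2 (fam k M)"
    using fam_fin_supp[of ?k M] fam_fin_supp[of k M] by (auto simp: fin_supp_def)
  have fin: "mcoeff (fps_nth (qplus_fin r k t n) b) M = ?rhs" if n: "n \<ge> max n1 n2" for n
  proof -
    have v: "vanishes n (fam ?k M)" "vanishes n (fam k M)"
      using n n12 vanishes_mono by (metis max.boundedE)+
    have trunc: "mcoeff (esym_fin ?k n i * hsym_fin k n j) M = mcoeff (esym ?k i * hsym k j :: 'a series) M" for i j
      unfolding mcoeff_mult
    proof (rule sum.cong[OF refl])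
      fix p assume p: "p \<in> antidiag M"
      obtain A B where AB: "p = (A, B)" "A + B = M" using p by (cases p) (auto simp: antidiag_def)
      have sum: "fam k' A i + fam k' B i = fam k' M i" for k' i using AB(2) by (simp add: fam_def lookup_add[symmetric])
      have "vanishes n (fam ?k A)" "vanishes n (fam k B)"
        using v sum by (metis add_is_0 vanishes_def)+
      then show "(case p of (A, B) \<Rightarrow> mcoeff (esym_fin ?k n i) A * mcoeff (hsym_fin k n j) B) =
          (case p of (A, B) \<Rightarrow> mcoeff (esym ?k i) A * mcoeff (hsym k j :: 'a series) B)"
        unfolding AB(1) by (simp add: esym_fin_def hsym_fin_def)
    qed
    have "fps_nth (qplus_fin r k t n) b = (\<Sum>i=0..b. mscale ((- t) ^ i) (esym_fin ?k n i * (hsym_fin k n (b - i) :: 'a series)))"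
      unfolding qplus_fin_def prod.distrib fps_mult_nth prod_geometric prod_linear
      by (simp add: mscale_simps)
    then show ?thesis by (simp add: trunc)
  qed
  have "(THE c. \<forall>\<^sub>F n in sequentially. mcoeff (fps_nth (qplus_fin r k t n) b) M = c) = ?rhs"
  proof (rule the_equality)
    show ev: "\<forall>\<^sub>F n in sequentially. mcoeff (fps_nth (qplus_fin r k t n) b) M = ?rhs"
      using fin unfolding eventually_sequentially by blast
    fix c assume "\<forall>\<^sub>F n in sequentially. mcoeff (fps_nth (qplus_fin r k t n) b) M = c"
    with ev have "\<forall>\<^sub>F n in sequentially. c = ?rhs" by eventually_elim simp
    then show "c = ?rhs" by simp
  qed
  then show "mcoeff (qplus1 r k t b) M = ?rhs" by (simp add: qplus1_def)
qed

lemma esym_in_Xi: "k < r \<Longrightarrow> (esym k b :: 'a::comm_ring_1 series) \<in> Xi r b"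
  unfolding Xi_iff
proof (intro conjI allI impI)
  fix M assume k: "k < r" and "mcoeff (esym k b :: 'a series) M \<noteq> 0"
  then have "in_fams {k} M \<and> mdeg M = b" by (auto simp: esym_def split: if_splits)
  then show "in_fams {..<r} M" "mdeg M = b" using k by (auto simp: in_fams_def)
next
  fix \<pi> :: "nat \<Rightarrow> nat \<Rightarrow> nat" and M assume \<pi>: "\<forall>k. bij (\<pi> k)"
  have "(\<forall>i. fam k (act \<pi> M) i \<le> 1) \<longleftrightarrow> (\<forall>i. fam k M (\<pi> k i) \<le> 1)"
    using \<pi> by (simp add: fam_act)
  also have "\<dots> \<longleftrightarrow> (\<forall>i. fam k M i \<le> 1)"
    using \<pi> by (metis bij_pointE)
  finally show "mcoeff (esym k b :: 'a series) (act \<pi> M) = mcoeff (esym k b) M"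
    using \<pi> in_fams_act[of \<pi> "{k}" M] mdeg_act[of \<pi> M] by (simp add: esym_def)
qed

lemma cpred_less: "0 < r \<Longrightarrow> cpred r k < r"
  by (simp add: cpred_def nat_less_iff)

lemma qplus1_in_Xi:
  assumes "k < r" shows "(qplus1 r k t b :: 'a::comm_ring_1 series) \<in> Xi r b"
  unfolding qplus1_eq
proof (intro Xi_sum Xi_scale)
  fix i assume "i \<in> {0..b}"
  then have "i + (b - i) = b" by simp
  moreover have "esym (cpred r k) i * (hsym k (b - i) :: 'a series) \<in> Xi r (i + (b - i))"
    using assms cpred_less[of r k] by (intro Xi_mult esym_in_Xi hsym_in_Xi) auto
  ultimately show "esym (cpred r k) i * (hsym k (b - i) :: 'a series) \<in> Xi r b" by simp
qed

lemma qplus_in_Xi: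
  assumes "l \<in> mparts r N" shows "qplus r l \<in> Xi r N"
proof -
  have "qplus r l \<in> Xi r (\<Sum>k<r. sum_list (l ! k))"
    unfolding qplus_def by (intro Xi_prod Xi_prod_list qplus1_in_Xi) auto
  then show ?thesis using assms by (simp add: mparts_iff)
qed

text \<open>Series with coefficients in \<open>A\<close> form a ring on which taking residues of the coefficients is a ring
homomorphism. Series with integer coefficients, such as \<open>hsym\<close> and \<open>schur\<close>, are mapped to
themselves.\<close>
context local_subring
begin

definition coeffs_in :: "('v, 'a) mfps \<Rightarrow> bool" where
  "coeffs_in f \<longleftrightarrow> (\<forall>M. mcoeff f M \<in> A)"

lemma mcoeff_mmap [simp]: "mcoeff (mmap h f) M = h (mcoeff f M)"
  by (simp add: mmap_def)

lemma coeffs_in_sum: "(\<And>i. i \<in> I \<Longrightarrow> coeffs_in (f i)) \<Longrightarrow> coeffs_in (sum f I) \<and> mmap \<rho> (sum f I) = (\<Sum>i\<in>I. mmap \<rho> (f i))"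
  by (auto simp: coeffs_in_def intro!: sum_mem mfps_eqI res_sum)

lemma coeffs_in_scale: "c \<in> A \<Longrightarrow> coeffs_in f \<Longrightarrow> coeffs_in (mscale c f) \<and> mmap \<rho> (mscale c f) = mscale (\<rho> c) (mmap \<rho> f)"
  by (auto simp: coeffs_in_def intro!: mult_mem mfps_eqI res_mult)

lemma coeffs_in_mult:
  "coeffs_in f \<Longrightarrow> coeffs_in g \<Longrightarrow> coeffs_in (f * g) \<and> mmap \<rho> (f * g) = mmap \<rho> f * mmap \<rho> g"
  unfolding coeffs_in_def
  by (auto simp: mcoeff_mult case_prod_unfold res_sum res_mult mult_mem intro!: sum_mem mfps_eqI)

lemma coeffs_in_one: "coeffs_in 1 \<and> mmap \<rho> 1 = 1"
  by (auto simp: coeffs_in_def one_mem zero_mem res_one res_zero intro!: mfps_eqI)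

lemma coeffs_in_prod: "finite I \<Longrightarrow> (\<And>i. i \<in> I \<Longrightarrow> coeffs_in (f i)) \<Longrightarrow> coeffs_in (prod f I) \<and> mmap \<rho> (prod f I) = (\<Prod>i\<in>I. mmap \<rho> (f i))"
  by (induction I rule: finite_induct) (auto simp: coeffs_in_one coeffs_in_mult)

lemma coeffs_in_prod_list: "(\<And>i. i \<in> set xs \<Longrightarrow> coeffs_in (f i)) \<Longrightarrow> coeffs_in (prod_list (map f xs)) \<and>
   mmap \<rho> (prod_list (map f xs)) = prod_list (map (\<lambda>i. mmap \<rho> (f i)) xs)"
  by (induction xs) (auto simp: coeffs_in_one coeffs_in_mult)

lemma coeffs_in_of_nat: "(\<And>M. mcoeff f M = of_nat (c M)) \<Longrightarrow> (\<And>M. mcoeff g M = of_nat (c M)) \<Longrightarrow> coeffs_in f \<and> mmap \<rho> f = g"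
  by (auto simp: coeffs_in_def of_nat_mem res_of_nat intro!: mfps_eqI)

lemma coeffs_in_hsym: "coeffs_in (hsym k b) \<and> mmap \<rho> (hsym k b) = hsym k b"
  by (rule coeffs_in_of_nat[where c = "\<lambda>M. if in_fams {k} M \<and> mdeg M = b then 1 else 0"]) (auto simp: hsym_def)

lemma coeffs_in_esym: "coeffs_in (esym k b) \<and> mmap \<rho> (esym k b) = esym k b"
  by (rule coeffs_in_of_nat[where c = "\<lambda>M. if in_fams {k} M \<and> mdeg M = b \<and> (\<forall>i. fam k M i \<le> 1) then 1 else 0"])
    (auto simp: esym_def)

lemma coeffs_in_schur: "coeffs_in (schur r l) \<and> mmap \<rho> (schur r l) = schur r l"
proof -
  have "coeffs_in (schur1 k p) \<and> mmap \<rho> (schur1 k p) = schur1 k p" for k p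
    by (rule coeffs_in_of_nat[where c = "\<lambda>M. card {T \<in> ssyt p. tab_monom k T = M}"]) (auto simp: schur1_def)
  then show ?thesis unfolding schur_def using coeffs_in_prod[of "{..<r}" "\<lambda>k. schur1 k (l ! k)"] by simp
qed

text \<open>In \<open>qplus1_eq\<close> only the term without a factor \<open>t\<close> survives.\<close>
lemma coeffs_in_qplus1:
  assumes t: "t \<in> A" "\<rho> t = 0"
  shows "coeffs_in (qplus1 r k t b) \<and> mmap \<rho> (qplus1 r k t b) = hsym k b"
proof -
  have p: "(- t) ^ i \<in> A \<and> \<rho> ((- t) ^ i) = (if i = 0 then 1 else 0)" for i
    by (induction i) (auto simp: one_mem res_one mult_mem uminus_mem t res_mult res_uminus)
  let ?f = "\<lambda>i. mscale ((- t) ^ i) (esym (cpred r k) i * hsym k (b - i))"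
  have f: "coeffs_in (?f i) \<and> mmap \<rho> (?f i) = (if i = 0 then hsym k b else 0)" for i
    using p[of i] coeffs_in_mult[of "esym (cpred r k) i" "hsym k (b - i)"]
      coeffs_in_scale[of "(- t) ^ i" "esym (cpred r k) i * hsym k (b - i)"] coeffs_in_hsym coeffs_in_esym
    by (simp add: esym_0 mscale_simps)
  then show ?thesis unfolding qplus1_eq using coeffs_in_sum[of "{0..b}" ?f] by simp
qed

end

section \<open>The Gram matrix of the Schur basis\<close>

text \<open>At \<open>t = 0\<close> the \<open>q\<^sup>+\<close> become products of complete functions, so \<open>hsym_expand\<close> determines the residues of
the transition matrix to the Schur basis.\<close>
lemma qplus_schur_matrix:
  assumes r: "r \<ge> 1"
  obtains a where "\<And>m l. m \<in> mparts r N \<Longrightarrow> l \<in> mparts r N \<Longrightarrow> a m l \<in> ratA r"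
    "\<And>m l. m \<in> mparts r N \<Longrightarrow> l \<in> mparts r N \<Longrightarrow> rat_at0 (a m l) = of_nat (kostka r l m)"
    "\<And>m. m \<in> mparts r N \<Longrightarrow> qplus r m = (\<Sum>l\<in>mparts r N. mscale (a m l) (schur r l))"
proof -
  have q: "ratA.coeffs_in r (qplus r m) \<and> mmap rat_at0 (qplus r m) = (\<Prod>k<r. prod_list (map (hsym k) (m ! k)))" for m
  proof -
    have "tvar (cpred r k) \<in> ratA r" for k using r by (intro tvar_mem cpred_less) auto
    then have "ratA.coeffs_in r (qplus1 r k (tvar (cpred r k)) b) \<and>
        mmap rat_at0 (qplus1 r k (tvar (cpred r k)) b) = hsym k b" for k b
      by (intro ratA.coeffs_in_qplus1) (auto simp: rat_at0_tvar)
    then have "ratA.coeffs_in r (prod_list (map (qplus1 r k (tvar (cpred r k))) (m ! k))) \<and>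
        mmap rat_at0 (prod_list (map (qplus1 r k (tvar (cpred r k))) (m ! k))) = prod_list (map (hsym k) (m ! k))" for k
      using ratA.coeffs_in_prod_list[where r = r and f = "qplus1 r k (tvar (cpred r k))" and xs = "m ! k"] by simp
    then show ?thesis unfolding qplus_def
      using ratA.coeffs_in_prod[where r = r and I = "{..<r}" and f = "\<lambda>k. prod_list (map (qplus1 r k (tvar (cpred r k))) (m ! k))"]
      by simp
  qed
  have "\<exists>a. (\<forall>l\<in>mparts r N. a l \<in> ratA r) \<and> qplus r m = (\<Sum>l\<in>mparts r N. mscale (a l) (schur r l))"
    if m: "m \<in> mparts r N" for m
  proof (rule ratA.schur_expand[OF qplus_in_Xi[OF m]])
    show "mcoeff (qplus r m) M \<in> ratA r" for M
      using q[of m] by (simp add: ratA.coeffs_in_def)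
  qed blast
  then have "\<forall>m\<in>mparts r N. \<exists>a. (\<forall>l\<in>mparts r N. a l \<in> ratA r) \<and>
      qplus r m = (\<Sum>l\<in>mparts r N. mscale (a l) (schur r l))" ..
  from bchoice[OF this] obtain a where a: "\<And>m l. m \<in> mparts r N \<Longrightarrow> l \<in> mparts r N \<Longrightarrow> a m l \<in> ratA r"
    and e: "\<And>m. m \<in> mparts r N \<Longrightarrow> qplus r m = (\<Sum>l\<in>mparts r N. mscale (a m l) (schur r l))"
    by blast
  show thesis
  proof (rule that[OF a _ e])
    fix m l assume m: "m \<in> mparts r N" and l: "l \<in> mparts r N"
    have t: "ratA.coeffs_in r (mscale (a m l) (schur r l)) \<and>
        mmap rat_at0 (mscale (a m l) (schur r l)) = mscale (rat_at0 (a m l)) (schur r l)" if "l \<in> mparts r N" for l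
      using ratA.coeffs_in_scale[OF a[OF m that], of "schur r l"] ratA.coeffs_in_schur[of r r l] by simp
    have "mmap rat_at0 (qplus r m) = (\<Sum>l\<in>mparts r N. mscale (rat_at0 (a m l)) (schur r l))"
      unfolding e[OF m] using ratA.coeffs_in_sum[where r = r and I = "mparts r N" and f = "\<lambda>l. mscale (a m l) (schur r l)"] t by simp
    moreover have "mmap rat_at0 (qplus r m) = (\<Sum>l\<in>mparts r N. mscale (of_nat (kostka r l m)) (schur r l))"
      using q[of m] hsym_expand[OF m] by simp
    ultimately show "rat_at0 (a m l) = of_nat (kostka r l m)"
      by (intro lin_indep_on_coeffs_eq[OF schur_lin_indep _ l]) simp
  qed
qed

lemma pairing_bases:
  assumes q: "lin_indep_on (mparts r N) (qplus r)"
  shows "pairing r N (\<Sum>m\<in>mparts r N. mscale (x m) (qplus r m)) (\<Sum>m\<in>mparts r N. mscale (y m) (msym r m)) =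
    (\<Sum>m\<in>mparts r N. x m * y m)"
  unfolding pairing_def
  by (intro sum.cong refl arg_cong2[where f = "(*)"] representation_family q msym_lin_indep)

text \<open>Write \<open>q = a s\<close> for the transition matrix \<open>a\<close> and \<open>s = K m\<close> for the Kostka matrix. As \<open>a\<close> reduces to the
unitriangular matrix \<open>K\<^sup>T\<close>, it is invertible over \<open>A\<close>; in particular the \<open>q\<close> form a basis. Since \<open>q\<close>
and \<open>m\<close> are dual, the Gram matrix of \<open>s = a\<^sup>-\<^sup>1 q = K m\<close> is \<open>a\<^sup>-\<^sup>1 K\<^sup>T\<close>, which reduces to the identity.\<close>
lemma gram_matrix:
  assumes r: "r \<ge> 1"
  obtains G where "\<And>l l'. l \<in> mparts r N \<Longrightarrow> l' \<in> mparts r N \<Longrightarrow> G l l' \<in> ratA r"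
    "\<And>l l'. l \<in> mparts r N \<Longrightarrow> l' \<in> mparts r N \<Longrightarrow> rat_at0 (G l l') = (if l = l' then 1 else 0)"
    "\<And>c d. pairing r N (\<Sum>l\<in>mparts r N. mscale (c l) (schur r l)) (\<Sum>l\<in>mparts r N. mscale (d l) (schur r l)) =
       (\<Sum>l\<in>mparts r N. \<Sum>l'\<in>mparts r N. c l * d l' * G l l')"
proof -
  let ?P = "mparts r N"
  obtain a where a: "\<And>m l. m \<in> ?P \<Longrightarrow> l \<in> ?P \<Longrightarrow> a m l \<in> ratA r"
    and res_a: "\<And>m l. m \<in> ?P \<Longrightarrow> l \<in> ?P \<Longrightarrow> rat_at0 (a m l) = of_nat (kostka r l m)"
    and e: "\<And>m. m \<in> ?P \<Longrightarrow> qplus r m = (\<Sum>l\<in>?P. mscale (a m l) (schur r l))"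
    by (rule qplus_schur_matrix[OF r, where N = N]) blast
  \<comment> \<open>\<open>b\<close> is the transposed inverse of \<open>a\<close>: the transpose of \<open>a\<close>, rather than \<open>a\<close>, is triangular for \<open>mrank\<close>\<close>
  obtain b where b: "\<And>l m. l \<in> ?P \<Longrightarrow> m \<in> ?P \<Longrightarrow> b m l \<in> ratA r"
    and ba: "\<And>i j. i \<in> ?P \<Longrightarrow> j \<in> ?P \<Longrightarrow> (\<Sum>l\<in>?P. b i l * a j l) = (if i = j then 1 else 0)"
    and ab: "\<And>i j. i \<in> ?P \<Longrightarrow> j \<in> ?P \<Longrightarrow> (\<Sum>m\<in>?P. a m i * b m j) = (if i = j then 1 else 0)"
  proof (rule ratA.triangular_inverse[of ?P "\<lambda>l m. a m l" r "mrank r"])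
    show "mrank r i < mrank r j" if "i \<in> ?P" "j \<in> ?P" "i \<noteq> j" "rat_at0 (a j i) \<noteq> 0" for i j
      using that by (intro kostka_nonzero) (auto simp: res_a intro!: Nat.gr0I)
  qed (auto simp: finite_mparts a res_a kostka_self)
  have schur_q: "(\<Sum>l\<in>?P. mscale (c l) (schur r l)) = (\<Sum>m\<in>?P. mscale (\<Sum>l\<in>?P. c l * b m l) (qplus r m))" for c
  proof -
    have "(\<Sum>m\<in>?P. mscale (\<Sum>l\<in>?P. c l * b m l) (qplus r m)) =
        (\<Sum>m\<in>?P. \<Sum>i\<in>?P. mscale ((\<Sum>l\<in>?P. c l * b m l) * a m i) (schur r i))"
      by (rule sum.cong) (auto simp: e mscale_sum mscale_simps)
    also have "\<dots> = (\<Sum>i\<in>?P. mscale (\<Sum>m\<in>?P. (\<Sum>l\<in>?P. c l * b m l) * a m i) (schur r i))"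
      by (subst sum.swap) (simp add: mscale_sum_left)
    also have "\<dots> = (\<Sum>i\<in>?P. mscale (c i) (schur r i))"
    proof (rule sum.cong[OF refl])
      fix i assume i: "i \<in> ?P"
      have "(\<Sum>m\<in>?P. (\<Sum>l\<in>?P. c l * b m l) * a m i) = (\<Sum>l\<in>?P. c l * (\<Sum>m\<in>?P. a m i * b m l))"
        by (simp add: sum_distrib_left sum_distrib_right mult.assoc mult.commute[of "a _ _"]) (rule sum.swap)
      also have "\<dots> = (\<Sum>l\<in>?P. if l = i then c l else 0)"
        by (rule sum.cong) (auto simp: ab i)
      finally show "mscale (\<Sum>m\<in>?P. (\<Sum>l\<in>?P. c l * b m l) * a m i) (schur r i) = mscale (c i) (schur r i)"
        using i finite_mparts by simp
    qed
    finally show ?thesis by simp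
  qed
  have q_ind: "lin_indep_on ?P (qplus r)"
    unfolding lin_indep_on_def
  proof (intro conjI allI impI ballI finite_mparts)
    fix c j assume c: "(\<Sum>m\<in>?P. mscale (c m) (qplus r m)) = 0" and j: "j \<in> ?P"
    have "(\<Sum>m\<in>?P. mscale (c m) (qplus r m)) = (\<Sum>m\<in>?P. \<Sum>i\<in>?P. mscale (c m * a m i) (schur r i))"
      by (rule sum.cong) (auto simp: e mscale_sum mscale_simps)
    also have "\<dots> = (\<Sum>i\<in>?P. mscale (\<Sum>m\<in>?P. c m * a m i) (schur r i))"
      by (subst sum.swap) (simp add: mscale_sum_left)
    finally have zero: "(\<Sum>m\<in>?P. c m * a m i) = 0" if "i \<in> ?P" for i
      using c lin_indep_onD[OF schur_lin_indep, of "\<lambda>i. \<Sum>m\<in>?P. c m * a m i"] that by simp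
    have "0 = (\<Sum>i\<in>?P. b j i * (\<Sum>m\<in>?P. c m * a m i))" using zero by simp
    also have "\<dots> = (\<Sum>m\<in>?P. c m * (\<Sum>i\<in>?P. b j i * a m i))"
      by (simp add: sum_distrib_left mult.left_commute) (rule sum.swap)
    also have "\<dots> = (\<Sum>m\<in>?P. if m = j then c m else 0)"
      by (rule sum.cong) (auto simp: ba j)
    finally show "c j = 0" using j finite_mparts by simp
  qed
  define G where "G l l' = (\<Sum>m\<in>?P. b m l * of_nat (kostka r l' m))" for l l'
  have G: "G l l' \<in> ratA r" if "l \<in> ?P" "l' \<in> ?P" for l l'
    unfolding G_def using b that by (auto intro!: ratA.sum_mem ratA.mult_mem ratA.of_nat_mem)
  show thesis
  proof (rule that[OF G])
    fix l l' assume l: "l \<in> ?P" and l': "l' \<in> ?P"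
    have "rat_at0 (G l l') = (\<Sum>m\<in>?P. rat_at0 (b m l) * of_nat (kostka r l' m))"
      unfolding G_def using b l
      by (subst ratA.res_sum[where r = r]) (auto simp: ratA.res_mult[where r = r] ratA.res_of_nat ratA.mult_mem ratA.of_nat_mem)
    also have "\<dots> = (\<Sum>m\<in>?P. rat_at0 (a m l' * b m l))"
      using a b l l' by (intro sum.cong) (auto simp: ratA.res_mult[where r = r] res_a)
    also have "\<dots> = rat_at0 (\<Sum>m\<in>?P. a m l' * b m l)"
      using a b l l' by (subst ratA.res_sum[where r = r]) (auto intro: ratA.mult_mem)
    finally show "rat_at0 (G l l') = (if l = l' then 1 else 0)"
      using ab[OF l' l] by (auto simp: ratA.res_one ratA.res_zero)
  next
    fix c d :: "nat list list \<Rightarrow> ratT"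
    have "(\<Sum>l\<in>?P. mscale (d l) (schur r l)) = (\<Sum>m\<in>?P. mscale (\<Sum>l\<in>?P. d l * of_nat (kostka r l m)) (msym r m))"
      using msym_expand[of "\<Sum>l\<in>?P. mscale (d l) (schur r l)" r N]
      by (simp add: Xi_sum Xi_scale schur_in_Xi mcoeff_schur_at)
    then have "pairing r N (\<Sum>l\<in>?P. mscale (c l) (schur r l)) (\<Sum>l\<in>?P. mscale (d l) (schur r l)) =
        (\<Sum>m\<in>?P. (\<Sum>l\<in>?P. c l * b m l) * (\<Sum>l'\<in>?P. d l' * of_nat (kostka r l' m)))"
      using pairing_bases[OF q_ind] schur_q[of c] by simp
    also have "\<dots> = (\<Sum>m\<in>?P. \<Sum>l\<in>?P. \<Sum>l'\<in>?P. c l * d l' * (b m l * of_nat (kostka r l' m)))"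
      by (simp add: sum_product mult.assoc mult.left_commute)
    also have "\<dots> = (\<Sum>l\<in>?P. \<Sum>m\<in>?P. \<Sum>l'\<in>?P. c l * d l' * (b m l * of_nat (kostka r l' m)))"
      by (rule sum.swap)
    also have "\<dots> = (\<Sum>l\<in>?P. \<Sum>l'\<in>?P. c l * d l' * G l l')"
      unfolding G_def sum_distrib_left by (intro sum.cong refl sum.swap)
    finally show "pairing r N (\<Sum>l\<in>?P. mscale (c l) (schur r l)) (\<Sum>l\<in>?P. mscale (d l) (schur r l)) =
       (\<Sum>l\<in>?P. \<Sum>l'\<in>?P. c l * d l' * G l l')" .
  qed
qed

section \<open>The embeddings Theta\<close>

lemma lin_indep_on_reindex:
  fixes b :: "'j \<Rightarrow> ('v, 'a::field) mfps" and h :: "'i \<Rightarrow> 'j"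
  assumes "lin_indep_on J b" "inj_on h I" "h ` I \<subseteq> J"
  shows "lin_indep_on I (\<lambda>i. b (h i))"
  unfolding lin_indep_on_def
proof (intro conjI allI impI ballI)
  have fJ: "finite J" using assms(1) by (simp add: lin_indep_on_def)
  then show "finite I" using assms(2,3) finite_subset finite_imageD by blast
  fix c :: "'i \<Rightarrow> 'a" and i assume c: "(\<Sum>i\<in>I. mscale (c i) (b (h i))) = 0" and i: "i \<in> I"
  let ?d = "\<lambda>j. if j \<in> h ` I then c (the_inv_into I h j) else 0"
  have "(\<Sum>j\<in>J. mscale (?d j) (b j)) = (\<Sum>j\<in>h ` I. mscale (?d j) (b j))"
    by (rule sum.mono_neutral_right) (use fJ assms(3) in \<open>auto simp: mscale_simps\<close>)
  also have "\<dots> = (\<Sum>i\<in>I. mscale (c i) (b (h i)))"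
    using assms(2) by (simp add: sum.reindex the_inv_into_f_f)
  finally have "(\<Sum>j\<in>J. mscale (?d j) (b j)) = 0" using c by simp
  then have "?d (h i) = 0" using i assms(3) by (intro lin_indep_onD[OF assms(1)]) auto
  then show "c i = 0" using i assms(2) by (simp add: the_inv_into_f_f)
qed

lemma Theta_schur_sum:
  "Theta r N th (\<Sum>l\<in>mparts r N. mscale (c l) (schur r l)) = (\<Sum>l\<in>mparts r N. mscale (c l) (schur r (th l) :: 'a::field series))"
  unfolding Theta_def by (intro sum.cong refl arg_cong2[where f = mscale] representation_family schur_lin_indep)

lemma Theta_schur:
  assumes "l \<in> mparts r N"
  shows "Theta r N th (schur r l) = (schur r (th l) :: 'a::field series)"
proof -
  have *: "(\<Sum>m\<in>mparts r N. mscale (if m = l then 1 else 0) (f m)) = f l" for f :: "_ \<Rightarrow> 'a series"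
  proof -
    have "(\<Sum>m\<in>mparts r N. mscale (if m = l then 1 else 0) (f m)) = (\<Sum>m\<in>mparts r N. if m = l then f m else 0)"
      by (rule sum.cong) (auto simp: mscale_simps)
    then show ?thesis using assms finite_mparts by simp
  qed
  show ?thesis
    using Theta_schur_sum[of r N th "\<lambda>m. if m = l then 1 else 0 :: 'a"] unfolding * .
qed

lemma Theta_inj_on:
  assumes "inj_on th (mparts r N)" "th ` mparts r N \<subseteq> mparts r n"
  shows "inj_on (Theta r N th) (Xi r N :: 'a::field series set)"
proof (rule inj_onI)
  interpret U: local_subring UNIV "\<lambda>x::'a. x" by (rule local_subring_UNIV)
  fix f g :: "'a series" assume f: "f \<in> Xi r N" and g: "g \<in> Xi r N" and eq: "Theta r N th f = Theta r N th g"
  obtain c where c: "f = (\<Sum>l\<in>mparts r N. mscale (c l) (schur r l))"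
    using U.schur_expand[OF f] by blast
  obtain d where d: "g = (\<Sum>l\<in>mparts r N. mscale (d l) (schur r l))"
    using U.schur_expand[OF g] by blast
  have "c l = d l" if "l \<in> mparts r N" for l
    using eq unfolding c d Theta_schur_sum
    by (rule lin_indep_on_coeffs_eq[OF lin_indep_on_reindex[OF schur_lin_indep assms] _ that])
  then show "f = g" unfolding c d by simp
qed

lemma inv_Theta:
  assumes "inj_on th (mparts r N)" "th ` mparts r N \<subseteq> mparts r n"
  shows "inv_into (Xi r N) (Theta r N th) (\<Sum>l\<in>mparts r N. mscale (c l) (schur r (th l) :: 'a::field series)) =
    (\<Sum>l\<in>mparts r N. mscale (c l) (schur r l))"
proof -
  have "(\<Sum>l\<in>mparts r N. mscale (c l) (schur r l)) \<in> Xi r N"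
    by (intro Xi_sum Xi_scale schur_in_Xi)
  from inv_into_f_f[OF Theta_inj_on[OF assms] this] show ?thesis unfolding Theta_schur_sum .
qed

section \<open>Symbols and similarity\<close>

text \<open>Subtracting the entries of the row of \<open>Lambda0\<close> of the same length leaves a partition followed by
zeros, from which the partition is recovered. The shift only appends a further zero, so the result
depends on the class alone (\<open>reduced_rows_shift\<close>).\<close>
definition reduced_row :: "nat \<Rightarrow> nat \<Rightarrow> nat list \<Rightarrow> nat list" where
  "reduced_row b e xs =
     filter (\<lambda>x. x \<noteq> 0) (map (\<lambda>i. xs ! i - (b + (length xs - 1 - i) * e)) [0..<length xs])"

definition reduced_rows :: "(nat \<Rightarrow> nat) \<Rightarrow> nat \<Rightarrow> nat list list \<Rightarrow> nat list list" where
  "reduced_rows s e X = map (\<lambda>k. reduced_row (s k) e (X ! k)) [0..<length X]"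

definition shift_step :: "nat \<Rightarrow> (nat \<Rightarrow> nat) \<Rightarrow> nat \<Rightarrow> nat list list \<Rightarrow> nat list list \<Rightarrow> bool" where
  "shift_step r s e U V \<longleftrightarrow> (\<exists>m. length m = r \<and> U \<in> Ztilde s e m) \<and> V = shift s e U"

lemma symbol_class_eq: "symbol_class r s e X = {Y. equivclp (shift_step r s e) X Y}"
  by (simp add: symbol_class_def shift_step_def[abs_def])

lemma length_shift [simp]: "length (shift s e X) = length X"
  by (simp add: shift_def)

lemma shift_nth: "k < length X \<Longrightarrow> shift s e X ! k = map (\<lambda>a. a + e) (X ! k) @ [s k]"
  by (simp add: shift_def)

lemma reduced_row_shift: "reduced_row b e (map (\<lambda>a. a + e) xs @ [b]) = reduced_row b e xs"
proof -
  let ?ys = "map (\<lambda>a. a + e) xs @ [b]" and ?n = "length xs"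
  have entries: "map (\<lambda>i. ?ys ! i - (b + (length ?ys - 1 - i) * e)) [0..<length ?ys] =
      map (\<lambda>i. xs ! i - (b + (?n - 1 - i) * e)) [0..<?n] @ [0]"
  proof (rule nth_equalityI)
    fix i assume "i < length (map (\<lambda>i. ?ys ! i - (b + (length ?ys - 1 - i) * e)) [0..<length ?ys])"
    then have "i < Suc ?n" by simp
    moreover have "?n - i = Suc (?n - 1 - i)" if "i < ?n" using that by simp
    ultimately show "map (\<lambda>i. ?ys ! i - (b + (length ?ys - 1 - i) * e)) [0..<length ?ys] ! i =
        (map (\<lambda>i. xs ! i - (b + (?n - 1 - i) * e)) [0..<?n] @ [0]) ! i"
      by (cases "i < ?n") (auto simp: nth_append less_Suc_eq simp del: upt_Suc)
  qed simp
  show ?thesis unfolding reduced_row_def entries by simp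
qed

lemma reduced_rows_shift: "reduced_rows s e (shift s e X) = reduced_rows s e X"
  by (simp add: reduced_rows_def shift_nth reduced_row_shift cong: map_cong)

lemma Min_image_add:
  fixes A :: "nat set" assumes "finite A" "A \<noteq> {}" shows "Min ((\<lambda>x. x + c) ` A) = Min A + c"
  using assms mono_Min_commute[of "\<lambda>x. x + c" A] by (simp add: mono_def)

lemma defect_add: "m \<noteq> [] \<Longrightarrow> defect (map (\<lambda>x. x + c) m) = defect m"
  by (simp add: defect_def Min_image_add)

lemma defect_defect: "m \<noteq> [] \<Longrightarrow> defect (defect m) = defect m"
proof -
  assume m: "m \<noteq> []"
  have "map (\<lambda>x. x + Min (set m)) (defect m) = m"
    by (simp add: defect_def o_def map_idI)
  moreover have "defect m \<noteq> []" using m by (simp add: defect_def)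
  ultimately show ?thesis using defect_add[of "defect m" "Min (set m)"] by simp
qed

lemma defect_shift: "defect (map length (shift s e X)) = defect (map length X)"
proof (cases "X = []")
  case False
  have "map length (shift s e X) = map (\<lambda>x. x + 1) (map length X)"
    by (rule nth_equalityI) (auto simp: shift_nth)
  then show ?thesis using defect_add[of "map length X" 1] False by simp
qed (simp add: shift_def)

lemma symbol_class_invariants:
  assumes "Y \<in> symbol_class r s e X"
  shows "reduced_rows s e Y = reduced_rows s e X \<and> defect (map length Y) = defect (map length X)"
  using assms unfolding symbol_class_eq mem_Collect_eq
  by (induction rule: equivclp_induct) (auto simp: shift_step_def reduced_rows_shift defect_shift)

lemma symbol_rep_mem: "symbol_rep (symbol_class r s e X) \<in> symbol_class r s e X"
  unfolding symbol_rep_def by (rule someI[of _ X]) (simp add: symbol_class_eq)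

lemma length_Lambda0 [simp]: "length (Lambda0 s e m) = length m"
  by (simp add: Lambda0_def)

lemma add_mpart_Lambda0_nth:
  assumes "k < length m"
  shows "add_mpart (Lambda0 s e m) l ! k = map (\<lambda>i. s k + (m ! k - Suc i) * e + pfun (l ! k) i) [0..<m ! k]"
proof -
  have "Lambda0 s e m ! k = map (\<lambda>i. s k + (m ! k - Suc i) * e) [0..<m ! k]"
    using assms by (simp add: Lambda0_def map_Suc_upt[symmetric] o_def del: upt_Suc)
  then show ?thesis using assms by (auto simp: add_mpart_def pfun_def intro!: nth_equalityI)
qed

lemma length_add_mpart [simp]: "length (add_mpart X l) = length X"
  by (simp add: add_mpart_def)

lemma map_length_add_mpart: "map length (add_mpart (Lambda0 s e m) l) = m"
  by (rule nth_equalityI) (auto simp: add_mpart_Lambda0_nth)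

lemma filter_pfun:
  assumes "p \<in> partitions" "length p \<le> n" shows "filter (\<lambda>x. x \<noteq> 0) (map (pfun p) [0..<n]) = p"
proof -
  have "map (pfun p) [0..<n] = p @ replicate (n - length p) 0"
    using assms(2) by (intro nth_equalityI) (auto simp: pfun_def nth_append)
  moreover have "filter (\<lambda>x. x \<noteq> 0) p = p"
    using assms(1) by (auto simp: filter_id_conv partitions_def) (metis gr0I)
  ultimately show ?thesis by (simp add: filter_replicate)
qed

lemma reduced_rows_add_mpart:
  assumes "length l = length m" "\<And>k. k < length m \<Longrightarrow> l ! k \<in> partitions \<and> length (l ! k) \<le> m ! k"
  shows "reduced_rows s e (add_mpart (Lambda0 s e m) l) = l"
proof (rule nth_equalityI)
  fix k assume "k < length (reduced_rows s e (add_mpart (Lambda0 s e m) l))"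
  then have k: "k < length m" by (simp add: reduced_rows_def)
  let ?row = "map (\<lambda>i. s k + (m ! k - Suc i) * e + pfun (l ! k) i) [0..<m ! k]"
  have "map (\<lambda>i. ?row ! i - (s k + (length ?row - 1 - i) * e)) [0..<length ?row] = map (pfun (l ! k)) [0..<m ! k]"
    by (intro map_cong) auto
  then have "reduced_row (s k) e ?row = l ! k"
    unfolding reduced_row_def using filter_pfun[of "l ! k" "m ! k"] assms(2)[OF k] by argo
  then show "reduced_rows s e (add_mpart (Lambda0 s e m) l) ! k = l ! k"
    using k by (simp add: reduced_rows_def add_mpart_Lambda0_nth)
qed (simp add: reduced_rows_def assms(1))

lemma add_mpart_in_Ztilde:
  assumes "length l = length m" "\<And>k. k < length m \<Longrightarrow> l ! k \<in> partitions"
  shows "add_mpart (Lambda0 s e m) l \<in> Ztilde s e m"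
  unfolding Ztilde_def
proof (intro CollectI conjI allI impI map_length_add_mpart)
  fix k assume "k < length (add_mpart (Lambda0 s e m) l)"
  then have k: "k < length m" by simp
  note row = add_mpart_Lambda0_nth[OF k, of s e l]
  {
    fix i assume "Suc i < length (add_mpart (Lambda0 s e m) l ! k)"
    then have i: "Suc i < m ! k" by (simp add: row)
    have "pfun (l ! k) (Suc i) \<le> pfun (l ! k) i"
      using antimono_pfun[OF assms(2)[OF k]] by (simp add: antimono_iff_le_Suc)
    moreover have "m ! k - Suc i = Suc (m ! k - Suc (Suc i))" using i by simp
    ultimately show "add_mpart (Lambda0 s e m) l ! k ! Suc i + e \<le> add_mpart (Lambda0 s e m) l ! k ! i"
      using i by (simp add: row)
  }
  assume "add_mpart (Lambda0 s e m) l ! k \<noteq> []"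
  then show "s k \<le> last (add_mpart (Lambda0 s e m) l ! k)" by (simp add: row last_map)
qed

lemma shift_in_Ztilde:
  assumes "X \<in> Ztilde s e m" shows "shift s e X \<in> Ztilde s e (map Suc m)"
  unfolding Ztilde_def
proof (intro CollectI conjI allI impI)
  have len: "map length X = m" using assms by (simp add: Ztilde_def)
  show "map length (shift s e X) = map Suc m"
    unfolding len[symmetric] by (rule nth_equalityI) (auto simp: shift_nth)
next
  fix k assume "k < length (shift s e X)"
  then have k: "k < length X" by simp
  note row = shift_nth[OF k, of s e]
  have X: "\<And>i. Suc i < length (X ! k) \<Longrightarrow> X ! k ! Suc i + e \<le> X ! k ! i" "X ! k \<noteq> [] \<Longrightarrow> s k \<le> last (X ! k)"
    using assms k by (auto simp: Ztilde_def)
  {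
    fix i assume "Suc i < length (shift s e X ! k)"
    then have i: "Suc i \<le> length (X ! k)" by (simp add: row)
    show "shift s e X ! k ! Suc i + e \<le> shift s e X ! k ! i"
    proof (cases "Suc i < length (X ! k)")
      case True
      then show ?thesis using X(1)[OF True] by (simp add: row nth_append)
    next
      case False
      then have l: "Suc i = length (X ! k)" using i by simp
      then have "last (X ! k) = X ! k ! i" "X ! k \<noteq> []" by (auto simp: last_conv_nth) (metis diff_Suc_1 last_conv_nth length_0_conv nat.distinct(1))
      then show ?thesis using X(2) l by (simp add: row nth_append)
    qed
  }
  show "s k \<le> last (shift s e X ! k)" by (simp add: row)
qed

lemma shift_pow_comm: "(shift s e ^^ i) ((shift s e ^^ j) X) = (shift s e ^^ j) ((shift s e ^^ i) X)"
  by (metis add.commute comp_apply funpow_add)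

text \<open>The shift is a function, so two elements of a class have a common iterated shift. The class consists
of elements of sets \<open>Ztilde s e m\<close> because the shift preserves these.\<close>
lemma symbol_class_chain:
  assumes X: "X \<in> Ztilde s e m" "length m = r" and Y: "Y \<in> symbol_class r s e X"
  shows "(\<exists>m. length m = r \<and> Y \<in> Ztilde s e m) \<and> (\<exists>i j. (shift s e ^^ i) X = (shift s e ^^ j) Y)"
  using Y unfolding symbol_class_eq mem_Collect_eq
proof (induction rule: equivclp_induct)
  case base
  then show ?case using X by blast
next
  case (step Y Z)
  from step.IH obtain i j where ij: "(shift s e ^^ i) X = (shift s e ^^ j) Y" by blast
  from step.hyps(2) show ?case
  proof
    assume YZ: "shift_step r s e Y Z"
    have "(shift s e ^^ Suc i) X = (shift s e ^^ j) Z"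
      using YZ ij shift_pow_comm[where s = s and e = e and i = 1 and j = j and X = Y] by (simp add: shift_step_def)
    moreover have "\<exists>m. length m = r \<and> Z \<in> Ztilde s e m"
      using YZ shift_in_Ztilde unfolding shift_step_def by (metis length_map)
    ultimately show ?case by blast
  next
    assume ZY: "shift_step r s e Z Y"
    have "(shift s e ^^ i) X = (shift s e ^^ Suc j) Z"
      using ZY ij by (simp add: shift_step_def funpow_swap1)
    then show ?case using ZY unfolding shift_step_def by blast
  qed
qed

lemma symbol_class_shift_pow:
  assumes X: "X \<in> Ztilde s e m" "length m = r" and Y: "Y \<in> symbol_class r s e X"
  shows "(shift s e ^^ i) Y \<in> symbol_class r s e X"
proof (induction i)
  case (Suc i)
  have "shift_step r s e ((shift s e ^^ i) Y) ((shift s e ^^ Suc i) Y)"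
    using symbol_class_chain[OF X Suc] by (simp add: shift_step_def)
  then show ?case using Suc unfolding symbol_class_eq mem_Collect_eq by (rule equivclp_into_equivclp[rotated, OF disjI1])
qed (use Y in simp)

lemma mset_concat_nth: "mset (concat X) = (\<Sum>k<length X. mset (X ! k))"
  by (simp add: mset_concat sum_list_sum_nth atLeast0LessThan)

text \<open>The shift acts on the multiset of all entries in a way that depends only on this multiset and the
number of rows.\<close>
lemma mset_concat_shift:
  "mset (concat (shift s e X)) = image_mset (\<lambda>a. a + e) (mset (concat X)) + (\<Sum>k<length X. {#s k#})"
proof -
  have "mset (concat (shift s e X)) = (\<Sum>k<length X. image_mset (\<lambda>a. a + e) (mset (X ! k)) + {#s k#})"
    unfolding mset_concat_nth by (simp add: shift_nth)
  also have "\<dots> = image_mset (\<lambda>a. a + e) (\<Sum>k<length X. mset (X ! k)) + (\<Sum>k<length X. {#s k#})"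
  proof -
    have "image_mset f (sum g A) = (\<Sum>x\<in>A. image_mset f (g x))" for f :: "nat \<Rightarrow> nat" and g :: "nat \<Rightarrow> nat multiset" and A
      by (induction A rule: infinite_finite_induct) auto
    then show ?thesis by (simp only: sum.distrib)
  qed
  finally show ?thesis unfolding mset_concat_nth .
qed

lemma mset_concat_shift_pow:
  assumes "mset (concat X) = mset (concat Y)" "length X = length Y"
  shows "mset (concat ((shift s e ^^ i) X)) = mset (concat ((shift s e ^^ i) Y))"
proof -
  have "length ((shift s e ^^ i) X) = length X" for X by (induction i) auto
  then show ?thesis using assms by (induction i) (auto simp: mset_concat_shift)
qed

definition is_symbol :: "nat \<Rightarrow> (nat \<Rightarrow> nat) \<Rightarrow> nat \<Rightarrow> symbol \<Rightarrow> bool" where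
  "is_symbol r s e L \<longleftrightarrow> (\<exists>X m. X \<in> Ztilde s e m \<and> length m = r \<and> L = symbol_class r s e X)"

lemma Ztilde_length: "X \<in> Ztilde s e m \<Longrightarrow> length X = length m"
  by (auto simp: Ztilde_def)

lemma similar_refl: "is_symbol r s e L \<Longrightarrow> similar L L"
proof -
  assume "is_symbol r s e L"
  then obtain X where "L = symbol_class r s e X" unfolding is_symbol_def by blast
  then have "X \<in> L" by (simp add: symbol_class_eq)
  then show ?thesis unfolding similar_def by blast
qed

lemma similar_sym: "similar L L' \<Longrightarrow> similar L' L"
  unfolding similar_def by metis

text \<open>The two representatives \<open>V\<close> and \<open>V'\<close> of the middle symbol become equal after suitable iterated
shifts; applying the same shifts to the outer representatives preserves the equality of multisets.\<close>
lemma similar_trans: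
  assumes "is_symbol r s e L1" "is_symbol r s e L2" "is_symbol r s e L3" "similar L1 L2" "similar L2 L3"
  shows "similar L1 L3"
proof -
  obtain X1 m1 X2 m2 X3 m3 where
    L1: "X1 \<in> Ztilde s e m1" "length m1 = r" "L1 = symbol_class r s e X1" and
    L2: "X2 \<in> Ztilde s e m2" "length m2 = r" "L2 = symbol_class r s e X2" and
    L3: "X3 \<in> Ztilde s e m3" "length m3 = r" "L3 = symbol_class r s e X3"
    using assms(1-3) unfolding is_symbol_def by metis
  obtain U V where UV: "U \<in> L1" "V \<in> L2" "mset (concat U) = mset (concat V)" using assms(4) unfolding similar_def by blast
  obtain V' W where VW: "V' \<in> L2" "W \<in> L3" "mset (concat V') = mset (concat W)" using assms(5) unfolding similar_def by blast
  have chain: "(\<exists>m. length m = r \<and> V \<in> Ztilde s e m) \<and> (\<exists>i j. (shift s e ^^ i) X2 = (shift s e ^^ j) V)"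
     "(\<exists>m. length m = r \<and> V' \<in> Ztilde s e m) \<and> (\<exists>i j. (shift s e ^^ i) X2 = (shift s e ^^ j) V')"
    using symbol_class_chain[OF L2(1,2)] UV(2) VW(1) L2(3) by blast+
  then obtain i j i' j' where ij: "(shift s e ^^ i) X2 = (shift s e ^^ j) V" "(shift s e ^^ i') X2 = (shift s e ^^ j') V'"
    by blast
  have len: "length U = r" "length V = r" "length V' = r" "length W = r"
    using chain symbol_class_chain[OF L1(1,2)] symbol_class_chain[OF L3(1,2)] UV(1) VW(2) L1(3) L3(3) Ztilde_length by metis+
  have "(shift s e ^^ (i' + j)) V = (shift s e ^^ i') ((shift s e ^^ i) X2)" using ij by (simp add: funpow_add)
  also have "\<dots> = (shift s e ^^ (i + j')) V'" using ij shift_pow_comm[where s = s and e = e and i = i' and j = i and X = X2] by (simp add: funpow_add)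
  finally have VV: "(shift s e ^^ (i' + j)) V = (shift s e ^^ (i + j')) V'" .
  have "mset (concat ((shift s e ^^ (i' + j)) U)) = mset (concat ((shift s e ^^ (i + j')) W))"
    using mset_concat_shift_pow[OF UV(3), where s = s and e = e and i = "i' + j"]
      mset_concat_shift_pow[OF VW(3), where s = s and e = e and i = "i + j'"] VV len by simp
  moreover have "(shift s e ^^ (i' + j)) U \<in> L1" "(shift s e ^^ (i + j')) W \<in> L3"
    using symbol_class_shift_pow[OF L1(1,2)] symbol_class_shift_pow[OF L3(1,2)] UV(1) VW(2) L1(3) L3(3) by auto
  ultimately show ?thesis unfolding similar_def by blast
qed

text \<open>Defect and \<open>r\<close>-partition can be read off an arbitrary representative, as both are invariants of the
class; for \<open>symbol_of\<close> itself they are \<open>d\<close> and \<open>l\<close>, since the rows have at least \<open>N\<close> entries and no part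
of \<open>l\<close> is cut off.\<close>
lemma symbol_of_facts:
  assumes r: "r \<ge> 1" and d: "d \<in> defects r \<alpha>" and l: "l \<in> mparts r N"
  shows "is_symbol r s e (symbol_of r s e N d l)"
    and "symbol_defect (symbol_of r s e N d l) = d"
    and "reduced_rows s e (symbol_rep (symbol_of r s e N d l)) = l"
proof -
  obtain m where m: "length m = r" "d = defect m" using d by (auto simp: defects_def)
  have len: "length d = r" using m by (simp add: defect_def)
  have dd: "defect (map (\<lambda>x. x + N) d) = d"
    using m r defect_defect[of m] defect_add[of d N] len by force
  let ?m = "map (\<lambda>x. x + N) d" and ?X = "add_mpart (Lambda0 s e (map (\<lambda>x. x + N) d)) l"
  have l': "length l = r" "\<And>k. k < r \<Longrightarrow> l ! k \<in> partitions" using l by (auto simp: mparts_iff)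
  have "length (l ! k) \<le> N" if "k < r" for k
  proof -
    have "length (l ! k) \<le> sum_list (l ! k)" using length_le_sum_list l'(2)[OF that] .
    also have "\<dots> \<le> (\<Sum>k<r. sum_list (l ! k))" using that by (intro member_le_sum) auto
    finally show ?thesis using l by (simp add: mparts_iff)
  qed
  then have red: "reduced_rows s e ?X = l"
    using l' len by (intro reduced_rows_add_mpart) (auto simp: trans_le_add2)
  show "is_symbol r s e (symbol_of r s e N d l)"
    unfolding is_symbol_def symbol_of_def using add_mpart_in_Ztilde[of l ?m s e] l' len by fastforce
  note inv = symbol_class_invariants[OF symbol_rep_mem[of r s e ?X]]
  show "symbol_defect (symbol_of r s e N d l) = d"
    using inv dd by (simp add: symbol_defect_def symbol_of_def map_length_add_mpart)
  show "reduced_rows s e (symbol_rep (symbol_of r s e N d l)) = l"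
    using inv red by (simp add: symbol_of_def)
qed

lemma symbol_mpart_symbol_of:
  assumes r: "r \<ge> 1" and d: "d \<in> defects r \<alpha>" and l: "l \<in> mparts r (red_rank r \<alpha> n d)"
  shows "symbol_mpart r s e \<alpha> n (symbol_of r s e (red_rank r \<alpha> n d) d l) = l"
proof -
  have "inj_on (symbol_of r s e (red_rank r \<alpha> n d) d) (mparts r (red_rank r \<alpha> n d))"
    by (rule inj_on_inverseI[where g = "\<lambda>L. reduced_rows s e (symbol_rep L)"]) (rule symbol_of_facts(3)[OF r d])
  then show ?thesis
    unfolding symbol_mpart_def Let_def symbol_of_facts(2)[OF r d l] using l by (rule the_inv_into_f_f)
qed

section \<open>Triangular families and orthogonality\<close>

text \<open>The coordinates of a vector \<open>s\<^sub>L + (\<Sum>i\<in>J L. u i * s\<^sub>i)\<close>.\<close>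
definition unitri :: "('i \<Rightarrow> 'i set) \<Rightarrow> 'i \<Rightarrow> ('i \<Rightarrow> 'a) \<Rightarrow> 'i \<Rightarrow> 'a::zero_neq_one" where
  "unitri J L u = (\<lambda>i. if i = L then 1 else if i \<in> J L then u i else 0)"

definition bilin :: "'i set \<Rightarrow> ('i \<Rightarrow> 'i \<Rightarrow> 'a) \<Rightarrow> ('i \<Rightarrow> 'a) \<Rightarrow> ('i \<Rightarrow> 'a) \<Rightarrow> 'a::comm_ring_1" where
  "bilin Z G c d = (\<Sum>i\<in>Z. \<Sum>j\<in>Z. c i * d j * G i j)"

lemma bilin_flip: "bilin Z G c d = bilin Z (\<lambda>i j. G j i) d c"
  unfolding bilin_def by (subst sum.swap) (simp add: mult.commute[of "c _"])

lemma sum_unitri: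
  fixes u :: "'i \<Rightarrow> 'a::zero_neq_one" and h :: "'i \<Rightarrow> 'a \<Rightarrow> 'b::comm_monoid_add"
  assumes "finite Z" "L \<in> Z" "J L \<subseteq> Z" "L \<notin> J L" and h0: "\<And>i. h i 0 = 0"
  shows "(\<Sum>i\<in>Z. h i (unitri J L u i)) = h L 1 + (\<Sum>i\<in>J L. h i (u i))"
proof -
  have fin: "finite (J L)" using assms finite_subset by blast
  have "(\<Sum>i\<in>Z. h i (unitri J L u i)) = (\<Sum>i\<in>insert L (J L). h i (unitri J L u i))"
    by (rule sum.mono_neutral_right) (use assms in \<open>auto simp: unitri_def\<close>)
  also have "\<dots> = h L 1 + (\<Sum>i\<in>J L. h i (unitri J L u i))"
    using fin assms(4) by (simp add: unitri_def)
  also have "(\<Sum>i\<in>J L. h i (unitri J L u i)) = (\<Sum>i\<in>J L. h i (u i))"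
    by (rule sum.cong) (use assms(4) in \<open>auto simp: unitri_def\<close>)
  finally show ?thesis .
qed

lemma bilin_unitri:
  fixes G :: "'i \<Rightarrow> 'i \<Rightarrow> 'a::comm_ring_1"
  assumes Z: "finite Z" and J: "\<And>L. L \<in> Z \<Longrightarrow> J L \<subseteq> Z \<and> L \<notin> J L" and L: "L \<in> Z" and j: "j \<in> Z"
  shows "bilin Z G (unitri J L u) (unitri J j v) =
    (G L j + (\<Sum>i\<in>J L. u i * G i j)) + (\<Sum>k\<in>J j. v k * (G L k + (\<Sum>i\<in>J L. u i * G i k)))"
proof -
  have inner: "(\<Sum>i\<in>Z. unitri J L u i * G i k) = G L k + (\<Sum>i\<in>J L. u i * G i k)" for k
    using sum_unitri[of Z L J "\<lambda>i x. x * G i k" u] Z J L by simp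
  have "bilin Z G (unitri J L u) (unitri J j v) = (\<Sum>k\<in>Z. unitri J j v k * (\<Sum>i\<in>Z. unitri J L u i * G i k))"
    unfolding bilin_def by (subst sum.swap) (simp add: sum_distrib_left mult.assoc mult.left_commute)
  also have "\<dots> = (G L j + (\<Sum>i\<in>J L. u i * G i j)) + (\<Sum>k\<in>J j. v k * (G L k + (\<Sum>i\<in>J L. u i * G i k)))"
    unfolding inner using sum_unitri[of Z j J "\<lambda>k x. x * (G L k + (\<Sum>i\<in>J L. u i * G i k))" v] Z J j by simp
  finally show ?thesis .
qed

text \<open>If a vector is orthogonal to the triangular combinations at all \<open>j \<in> J L\<close>, then it is orthogonal to
the basis vectors at these \<open>j\<close>: the combination at \<open>j\<close> is the basis vector plus terms at \<open>J j\<close>, which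
lie in \<open>J L\<close> and have been dealt with, because \<open>J k\<close> is a proper subset of \<open>J j\<close> for \<open>k \<in> J j\<close>.\<close>
lemma orthogonal_imp_equations:
  fixes G :: "'i \<Rightarrow> 'i \<Rightarrow> 'a::comm_ring_1"
  assumes Z: "finite Z" and J: "\<And>L. L \<in> Z \<Longrightarrow> J L \<subseteq> Z \<and> L \<notin> J L"
    and trans: "\<And>L j. L \<in> Z \<Longrightarrow> j \<in> J L \<Longrightarrow> J j \<subseteq> J L"
    and orth: "\<And>j. j \<in> J L \<Longrightarrow> bilin Z G (unitri J L u) (unitri J j (v j)) = 0"
    and L: "L \<in> Z" and j: "j \<in> J L"
  shows "G L j + (\<Sum>i\<in>J L. u i * G i j) = 0"
  using j
proof (induction "card (J j)" arbitrary: j rule: less_induct)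
  case less
  have jZ: "j \<in> Z" using less.prems J L by blast
  have "(\<Sum>k\<in>J j. v j k * (G L k + (\<Sum>i\<in>J L. u i * G i k))) = 0"
  proof (intro sum.neutral ballI)
    fix k assume k: "k \<in> J j"
    have "k \<in> Z" using k J[OF jZ] by blast
    then have "k \<notin> J k" using J by simp
    then have "J k \<subset> J j" using trans[OF jZ k] k by auto
    moreover have "finite (J j)" using J jZ Z finite_subset by blast
    ultimately have "card (J k) < card (J j)" by (rule psubset_card_mono[rotated])
    moreover have "k \<in> J L" using trans[OF L less.prems] k by blast
    ultimately have "G L k + (\<Sum>i\<in>J L. u i * G i k) = 0" by (rule less.hyps)
    then show "v j k * (G L k + (\<Sum>i\<in>J L. u i * G i k)) = 0" by simp
  qed
  then show ?case using bilin_unitri[OF Z J L jZ, where u = u and v = "v j" and G = G] orth[OF less.prems] by simp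
qed

lemma equations_imp_orthogonal:
  fixes G :: "'i \<Rightarrow> 'i \<Rightarrow> 'a::comm_ring_1"
  assumes Z: "finite Z" and J: "\<And>L. L \<in> Z \<Longrightarrow> J L \<subseteq> Z \<and> L \<notin> J L"
    and trans: "\<And>L j. L \<in> Z \<Longrightarrow> j \<in> J L \<Longrightarrow> J j \<subseteq> J L"
    and eq: "\<And>j. j \<in> J L \<Longrightarrow> G L j + (\<Sum>i\<in>J L. u i * G i j) = 0"
    and L: "L \<in> Z" and j: "j \<in> J L"
  shows "bilin Z G (unitri J L u) (unitri J j v) = 0"
proof -
  have jZ: "j \<in> Z" using j J L by blast
  have "v k * (G L k + (\<Sum>i\<in>J L. u i * G i k)) = 0" if "k \<in> J j" for k
    using eq[of k] trans[OF L j] that by auto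
  then show ?thesis
    using eq[OF j] bilin_unitri[OF Z J L jZ, where u = u and v = v and G = G] by (simp add: sum.neutral)
qed

section \<open>The space spanned by the symbols\<close>

locale symbol_setting =
  fixes r n \<alpha> e :: nat and s :: "nat \<Rightarrow> nat" and D :: "nat list set"
    and \<theta> :: "nat list \<Rightarrow> nat list list \<Rightarrow> nat list list"
  assumes r: "r \<ge> 1" and finite_D: "finite D" and D: "D \<subseteq> defects r \<alpha>"
    and nonempty: "\<forall>d\<in>D. symbols r s e \<alpha> n d \<noteq> {}"
    and theta: "\<forall>d\<in>D. inj_on (\<theta> d) (mparts r (red_rank r \<alpha> n d)) \<and>
                \<theta> d ` mparts r (red_rank r \<alpha> n d) \<subseteq> mparts r n"
begin

abbreviation "shapes d \<equiv> mparts r (red_rank r \<alpha> n d)"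
abbreviation "Z \<equiv> symbolsD r s e \<alpha> n D"
abbreviation "symb d l \<equiv> symbol_of r s e (red_rank r \<alpha> n d) d l"
abbreviation S :: "symbol \<Rightarrow> 'a::field Dseries" where "S \<equiv> schurD r s e \<alpha> n \<theta>"
abbreviation "shape_of L \<equiv> symbol_mpart r s e \<alpha> n L"

lemma Z_eq: "Z = (\<lambda>(d, l). symb d l) ` (SIGMA d:D. shapes d)"
proof -
  have "symbols r s e \<alpha> n d = symb d ` shapes d" if "d \<in> D" for d
    using nonempty that by (auto simp: symbols_def split: if_splits)
  then show ?thesis unfolding symbolsD_def by (simp add: image_UN[symmetric] Sigma_def) auto
qed

lemma sym_facts:
  assumes "d \<in> D" "l \<in> shapes d"
  shows "symb d l \<in> Z" "symbol_defect (symb d l) = d" "shape_of (symb d l) = l" "is_symbol r s e (symb d l)"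
  using assms D symbol_of_facts[OF r _ assms(2)] symbol_mpart_symbol_of[OF r _ assms(2)] unfolding Z_eq by auto

lemma Z_cases:
  assumes "L \<in> Z" obtains d l where "d \<in> D" "l \<in> shapes d" "L = symb d l"
  using assms unfolding Z_eq by auto

lemma finite_Z: "finite Z"
  unfolding Z_eq using finite_D finite_mparts by blast

lemma sum_Z: "sum h Z = (\<Sum>d\<in>D. \<Sum>l\<in>shapes d. h (symb d l))"
proof -
  have "inj_on (\<lambda>(d, l). symb d l) (SIGMA d:D. shapes d)"
  proof (rule inj_onI)
    fix x y assume x: "x \<in> (SIGMA d:D. shapes d)" and y: "y \<in> (SIGMA d:D. shapes d)"
      and eq: "(\<lambda>(d, l). symb d l) x = (\<lambda>(d, l). symb d l) y"
    obtain d l d' l' where xy: "x = (d, l)" "y = (d', l')" by (cases x, cases y)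
    then have m: "d \<in> D" "l \<in> shapes d" "d' \<in> D" "l' \<in> shapes d'" "symb d l = symb d' l'" using x y eq by auto
    then show "x = y" using sym_facts(2,3)[OF m(1,2)] sym_facts(2,3)[OF m(3,4)] xy by simp
  qed
  then have "sum h Z = (\<Sum>(d, l)\<in>(SIGMA d:D. shapes d). h (symb d l))"
    unfolding Z_eq by (subst sum.reindex) (auto simp: case_prod_unfold)
  also have "\<dots> = (\<Sum>d\<in>D. \<Sum>l\<in>shapes d. h (symb d l))"
    using finite_D finite_mparts by (intro sum.Sigma[symmetric]) auto
  finally show ?thesis .
qed

lemma schurD_sym:
  assumes "d \<in> D" "l \<in> shapes d"
  shows "S (symb d l) = (Poly_Mapping.single d (schur r (\<theta> d l)) :: 'a::field Dseries)"
  using assms unfolding schurD_def Let_def sym_facts(2,3)[OF assms] by (simp add: Theta_schur)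

lemma lookup_Dscale: "Poly_Mapping.lookup (Dscale c F) d = mscale c (Poly_Mapping.lookup F d)"
  unfolding Dscale_def by (simp add: map.rep_eq when_def mscale_simps)

lemma Dscale_one: "Dscale 1 F = F"
  by (rule poly_mapping_eqI) (simp add: lookup_Dscale mscale_simps)

lemma Dscale_zero: "Dscale 0 F = 0"
  by (rule poly_mapping_eqI) (simp add: lookup_Dscale mscale_simps)

definition schur_comb :: "(symbol \<Rightarrow> 'a::field) \<Rightarrow> 'a Dseries" where
  "schur_comb c = (\<Sum>L\<in>Z. Dscale (c L) (S L))"

lemma lookup_schur_comb:
  "Poly_Mapping.lookup (schur_comb c :: 'a::field Dseries) d =
     (if d \<in> D then \<Sum>l\<in>shapes d. mscale (c (symb d l)) (schur r (\<theta> d l)) else 0)"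
proof -
  have "Poly_Mapping.lookup (schur_comb c) d = (\<Sum>d'\<in>D. \<Sum>l\<in>shapes d'. mscale (c (symb d' l)) (schur r (\<theta> d' l) when d' = d))"
    unfolding schur_comb_def sum_Z lookup_sum
    by (intro sum.cong refl) (simp add: lookup_Dscale schurD_sym lookup_single)
  also have "\<dots> = (\<Sum>d'\<in>D. if d' = d then \<Sum>l\<in>shapes d. mscale (c (symb d l)) (schur r (\<theta> d l)) else 0)"
    by (rule sum.cong) (auto simp: mscale_simps)
  finally show ?thesis using finite_D by simp
qed

text \<open>Summands of different defects are orthogonal and each one carries the form of \<open>gram_matrix\<close>,
transported by \<open>Theta\<close>; so the Gram matrix is block diagonal with these blocks.\<close>
lemma pairing_schur_comb:
  obtains G where "\<And>L L'. L \<in> Z \<Longrightarrow> L' \<in> Z \<Longrightarrow> G L L' \<in> ratA r"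
    "\<And>L L'. L \<in> Z \<Longrightarrow> L' \<in> Z \<Longrightarrow> rat_at0 (G L L') = (if L = L' then 1 else 0)"
    "\<And>c c'. pairingD r \<alpha> n D \<theta> (schur_comb c) (schur_comb c') = bilin Z G c c'"
proof -
  have "\<forall>d. \<exists>G. (\<forall>l\<in>shapes d. \<forall>l'\<in>shapes d. G l l' \<in> ratA r \<and> rat_at0 (G l l') = (if l = l' then 1 else 0)) \<and>
    (\<forall>c c'. pairing r (red_rank r \<alpha> n d) (\<Sum>l\<in>shapes d. mscale (c l) (schur r l)) (\<Sum>l\<in>shapes d. mscale (c' l) (schur r l)) =
       (\<Sum>l\<in>shapes d. \<Sum>l'\<in>shapes d. c l * c' l' * G l l'))"
    by (rule allI, rule gram_matrix[OF r]) blast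
  from choice[OF this] obtain g where g: "\<And>d l l'. l \<in> shapes d \<Longrightarrow> l' \<in> shapes d \<Longrightarrow> g d l l' \<in> ratA r \<and> rat_at0 (g d l l') = (if l = l' then 1 else 0)"
    and pair: "\<And>d c c'. pairing r (red_rank r \<alpha> n d) (\<Sum>l\<in>shapes d. mscale (c l) (schur r l)) (\<Sum>l\<in>shapes d. mscale (c' l) (schur r l)) =
       (\<Sum>l\<in>shapes d. \<Sum>l'\<in>shapes d. c l * c' l' * g d l l')"
    by blast
  define G where "G L L' = (if symbol_defect L = symbol_defect L' then g (symbol_defect L) (shape_of L) (shape_of L') else 0)" for L L'
  have G: "G (symb d l) (symb d' l') = (if d = d' then g d l l' else 0)" if "d \<in> D" "l \<in> shapes d" "d' \<in> D" "l' \<in> shapes d'" for d l d' l'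
    unfolding G_def sym_facts(2,3)[OF that(1,2)] sym_facts(2,3)[OF that(3,4)] by simp
  show thesis
  proof (rule that[of G])
    fix L L' assume L: "L \<in> Z" and L': "L' \<in> Z"
    obtain d l where dl: "d \<in> D" "l \<in> shapes d" "L = symb d l" using L by (rule Z_cases)
    obtain d' l' where dl': "d' \<in> D" "l' \<in> shapes d'" "L' = symb d' l'" using L' by (rule Z_cases)
    have eq: "L = L' \<longleftrightarrow> d = d' \<and> l = l'"
      using sym_facts(2,3)[OF dl(1,2)] sym_facts(2,3)[OF dl'(1,2)] dl(3) dl'(3) by metis
    show "G L L' \<in> ratA r"
      unfolding dl(3) dl'(3) G[OF dl(1,2) dl'(1,2)] using g dl dl' ratA.zero_mem by auto
    show "rat_at0 (G L L') = (if L = L' then 1 else 0)"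
      unfolding eq unfolding dl(3) dl'(3) G[OF dl(1,2) dl'(1,2)] using g dl dl' ratA.res_zero by auto
  next
    fix c c' :: "symbol \<Rightarrow> ratT"
    have inv: "inv_into (Xi r (red_rank r \<alpha> n d)) (Theta r (red_rank r \<alpha> n d) (\<theta> d)) (Poly_Mapping.lookup (schur_comb c) d) =
        (\<Sum>l\<in>shapes d. mscale (c (symb d l)) (schur r l))" if "d \<in> D" for d and c :: "symbol \<Rightarrow> ratT"
      using theta that by (simp add: lookup_schur_comb inv_Theta[where n = n])
    have "pairingD r \<alpha> n D \<theta> (schur_comb c) (schur_comb c') = (\<Sum>d\<in>D. \<Sum>l\<in>shapes d. \<Sum>l'\<in>shapes d. c (symb d l) * c' (symb d l') * g d l l')"
      unfolding pairingD_def Let_def by (intro sum.cong refl) (simp add: inv pair)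
    also have "\<dots> = (\<Sum>d\<in>D. \<Sum>l\<in>shapes d. \<Sum>d'\<in>D. \<Sum>l'\<in>shapes d'. c (symb d l) * c' (symb d' l') * G (symb d l) (symb d' l'))"
    proof (intro sum.cong refl)
      fix d l assume d: "d \<in> D" and l: "l \<in> shapes d"
      have "(\<Sum>d'\<in>D. \<Sum>l'\<in>shapes d'. c (symb d l) * c' (symb d' l') * G (symb d l) (symb d' l')) =
          (\<Sum>d'\<in>D. if d' = d then \<Sum>l'\<in>shapes d. c (symb d l) * c' (symb d l') * g d l l' else 0)"
        by (rule sum.cong) (use d l in \<open>auto simp: G\<close>)
      then show "(\<Sum>l'\<in>shapes d. c (symb d l) * c' (symb d l') * g d l l') =
          (\<Sum>d'\<in>D. \<Sum>l'\<in>shapes d'. c (symb d l) * c' (symb d' l') * G (symb d l) (symb d' l'))"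
        using d finite_D by simp
    qed
    also have "\<dots> = bilin Z G c c'" unfolding bilin_def sum_Z ..
    finally show "pairingD r \<alpha> n D \<theta> (schur_comb c) (schur_comb c') = bilin Z G c c'" .
  qed
qed

lemma spec0_schur_comb:
  assumes c: "\<And>L. L \<in> Z \<Longrightarrow> c L \<in> ratA r"
  shows "spec0 (schur_comb c) = schur_comb (\<lambda>L. rat_at0 (c L))"
proof (rule poly_mapping_eqI)
  fix d
  have m0: "mmap rat_at0 (0 :: ratT series) = 0"
    by (rule mfps_eqI) (simp add: mmap_def ratA.res_zero)
  have "Poly_Mapping.lookup (spec0 (schur_comb c)) d = mmap rat_at0 (Poly_Mapping.lookup (schur_comb c) d)"
    unfolding spec0_def by (simp add: map.rep_eq when_def m0)
  also have "\<dots> = Poly_Mapping.lookup (schur_comb (\<lambda>L. rat_at0 (c L))) d"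
  proof (cases "d \<in> D")
    case True
    have t: "ratA.coeffs_in r (mscale (c (symb d l)) (schur r (\<theta> d l))) \<and>
        mmap rat_at0 (mscale (c (symb d l)) (schur r (\<theta> d l))) = mscale (rat_at0 (c (symb d l))) (schur r (\<theta> d l))"
      if "l \<in> shapes d" for l
      using ratA.coeffs_in_scale[OF c[OF sym_facts(1)[OF True that]], of "schur r (\<theta> d l)"] ratA.coeffs_in_schur[of r r] by simp
    show ?thesis
      using True ratA.coeffs_in_sum[where r = r and I = "shapes d" and f = "\<lambda>l. mscale (c (symb d l)) (schur r (\<theta> d l))"] t
      by (simp add: lookup_schur_comb)
  qed (simp add: lookup_schur_comb m0)
  finally show "Poly_Mapping.lookup (spec0 (schur_comb c)) d = Poly_Mapping.lookup (schur_comb (\<lambda>L. rat_at0 (c L))) d" .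
qed

lemma XiA_eq: "XiA r s e \<alpha> n D \<theta> = {schur_comb c | c. \<forall>L\<in>Z. c L \<in> ratA r}"
  unfolding XiA_def schur_comb_def ..

end

section \<open>Existence and uniqueness\<close>

context symbol_setting
begin

lemma Z_is_symbol: "L \<in> Z \<Longrightarrow> is_symbol r s e L"
  by (erule Z_cases) (simp add: sym_facts(4))

lemma Z_similar:
  shows "L \<in> Z \<Longrightarrow> similar L L"
    and "L1 \<in> Z \<Longrightarrow> L2 \<in> Z \<Longrightarrow> L3 \<in> Z \<Longrightarrow> similar L1 L2 \<Longrightarrow> similar L2 L3 \<Longrightarrow> similar L1 L3"
  using similar_refl similar_trans Z_is_symbol by blast+

definition below :: "symbol rel \<Rightarrow> symbol \<Rightarrow> symbol set" where
  "below R L = {L' \<in> Z. (L', L) \<in> R \<and> \<not> similar L' L}"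

text \<open>The combinatorial content of the order: the second claim holds because similarity classes are
intervals, for a \<open>k\<close> below \<open>j\<close> that is similar to \<open>L\<close> would force \<open>j\<close> to be similar to \<open>k\<close>; the third one
because the order is total.\<close>
lemma below_facts:
  assumes "symbol_order r s e \<alpha> Z R"
  shows below_subset: "L \<in> Z \<Longrightarrow> below R L \<subseteq> Z \<and> L \<notin> below R L"
    and below_trans: "L \<in> Z \<Longrightarrow> j \<in> below R L \<Longrightarrow> below R j \<subseteq> below R L"
    and below_total: "L \<in> Z \<Longrightarrow> L' \<in> Z \<Longrightarrow> \<not> similar L L' \<Longrightarrow> L' \<in> below R L \<or> L \<in> below R L'"
proof -
  have lin: "linear_order_on Z R" and conv: "\<And>L1 L2 L3. L1 \<in> Z \<Longrightarrow> L2 \<in> Z \<Longrightarrow> L3 \<in> Z \<Longrightarrow> (L1, L2) \<in> R \<Longrightarrow> (L2, L3) \<in> R \<Longrightarrow> similar L1 L3 \<Longrightarrow> similar L1 L2"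
    using assms unfolding symbol_order_def by blast+
  have tr: "trans R" and tot: "total_on Z R"
    using lin by (auto simp: order_on_defs)
  show "below R L \<subseteq> Z \<and> L \<notin> below R L" if "L \<in> Z"
    using Z_similar(1)[OF that] by (auto simp: below_def)
  show "below R j \<subseteq> below R L" if L: "L \<in> Z" and j: "j \<in> below R L"
  proof
    fix k assume k: "k \<in> below R j"
    have "(k, L) \<in> R" using k j transD[OF tr] unfolding below_def by blast
    moreover have "\<not> similar k L" using conv[of k j L] k j L unfolding below_def by blast
    ultimately show "k \<in> below R L" using k by (simp add: below_def)
  qed
  show "L' \<in> below R L \<or> L \<in> below R L'" if "L \<in> Z" "L' \<in> Z" "\<not> similar L L'"
  proof -
    have "L \<noteq> L'" using that Z_similar(1) by blast
    then have "(L, L') \<in> R \<or> (L', L) \<in> R" using tot that(1,2) unfolding total_on_def by blast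
    then show ?thesis using that similar_sym unfolding below_def by blast
  qed
qed

lemma schur_comb_unitri:
  assumes "symbol_order r s e \<alpha> Z R" "L \<in> Z"
  shows "schur_comb (unitri (below R) L u) = S L + (\<Sum>i\<in>below R L. Dscale (u i) (S i))"
proof -
  have "schur_comb (unitri (below R) L u) = Dscale 1 (S L) + (\<Sum>i\<in>below R L. Dscale (u i) (S i))"
    unfolding schur_comb_def
    by (rule sum_unitri[where h = "\<lambda>i x. Dscale x (S i)"])
      (use assms below_subset[OF assms] finite_Z in \<open>auto simp: Dscale_zero\<close>)
  then show ?thesis by (simp add: Dscale_one)
qed

lemma below_expansion:
  assumes R: "symbol_order r s e \<alpha> Z R" and L: "L \<in> Z" and u: "\<And>L'. L' \<in> Z \<Longrightarrow> similar L' L \<Longrightarrow> u L' = 0"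
  shows "(\<Sum>L' | L' \<in> Z \<and> (L', L) \<in> R \<and> L' \<noteq> L. Dscale (u L') (S L')) =
    (\<Sum>i\<in>below R L. Dscale (u i) (S i))"
  by (rule sum.mono_neutral_right)
    (use finite_Z Z_similar(1)[OF L] u in \<open>auto simp: below_def Dscale_zero\<close>)

text \<open>The form need not be symmetric. The coefficients of \<open>P\<^sup>+\<close> solve these equations for the Gram matrix, those
of \<open>P\<^sup>-\<close> for its transpose.\<close>
lemma triangular_solution:
  assumes R: "symbol_order r s e \<alpha> Z R"
    and G: "\<And>L L'. L \<in> Z \<Longrightarrow> L' \<in> Z \<Longrightarrow> G L L' \<in> ratA r"
      "\<And>L L'. L \<in> Z \<Longrightarrow> L' \<in> Z \<Longrightarrow> rat_at0 (G L L') = (if L = L' then 1 else 0)"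
  obtains u where "\<And>L i. L \<in> Z \<Longrightarrow> i \<in> below R L \<Longrightarrow> u L i \<in> ratA r"
    "\<And>L i. L \<in> Z \<Longrightarrow> i \<in> below R L \<Longrightarrow> rat_at0 (u L i) = 0"
    "\<And>L j. L \<in> Z \<Longrightarrow> j \<in> below R L \<Longrightarrow> G L j + (\<Sum>i\<in>below R L. u L i * G i j) = 0"
    "\<And>L w i. L \<in> Z \<Longrightarrow> (\<And>j. j \<in> below R L \<Longrightarrow> G L j + (\<Sum>i\<in>below R L. w i * G i j) = 0) \<Longrightarrow>
       i \<in> below R L \<Longrightarrow> w i = u L i"
proof -
  define Q where "Q L u \<longleftrightarrow> (\<forall>i\<in>below R L. u i \<in> ratA r \<and> rat_at0 (u i) = 0 \<and>
        G L i + (\<Sum>k\<in>below R L. u k * G k i) = 0) \<and>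
      (\<forall>w. (\<forall>j\<in>below R L. G L j + (\<Sum>i\<in>below R L. w i * G i j) = 0) \<longrightarrow> (\<forall>i\<in>below R L. w i = u i))" for L u
  have "\<forall>L\<in>Z. \<exists>u. Q L u"
  proof
    fix L assume L: "L \<in> Z"
    have B: "i \<in> Z" "i \<noteq> L" if "i \<in> below R L" for i using below_subset[OF R L] that by auto
    have fin: "finite (below R L)" using below_subset[OF R L] finite_Z finite_subset by blast
    show "\<exists>u. Q L u"
    proof (rule ratA.block_orthogonalisation[OF fin, of G r "G L"])
      fix u
      assume "\<And>i. i \<in> below R L \<Longrightarrow> u i \<in> ratA r" "\<And>i. i \<in> below R L \<Longrightarrow> rat_at0 (u i) = 0"
        "\<And>j. j \<in> below R L \<Longrightarrow> G L j + (\<Sum>i\<in>below R L. u i * G i j) = 0"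
        "\<And>v i. (\<And>j. j \<in> below R L \<Longrightarrow> G L j + (\<Sum>i\<in>below R L. v i * G i j) = 0) \<Longrightarrow> i \<in> below R L \<Longrightarrow> v i = u i"
      then show ?thesis unfolding Q_def by (intro exI[of _ u]) auto
    qed (use B L G in auto)
  qed
  from bchoice[OF this] obtain u where "\<And>L. L \<in> Z \<Longrightarrow> Q L (u L)" by blast
  note u = this[unfolded Q_def]
  show thesis by (rule that[of u]) (use u in blast)+
qed

lemma exists_unique_families:
  assumes R: "symbol_order r s e \<alpha> Z R"
  shows "\<exists>!P :: sign \<Rightarrow> symbol \<Rightarrow> ratT Dseries.
     (\<forall>\<sigma>. P \<sigma> \<in> Z \<rightarrow>\<^sub>E XiA r s e \<alpha> n D \<theta>) \<and>
     (\<forall>\<sigma>. \<forall>\<Lambda>\<in>Z. \<exists>u. (\<forall>\<Lambda>'\<in>Z. u \<Lambda>' \<in> ratA r \<and> (similar \<Lambda>' \<Lambda> \<longrightarrow> u \<Lambda>' = 0)) \<and>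
        P \<sigma> \<Lambda> = S \<Lambda> + (\<Sum>\<Lambda>' | \<Lambda>' \<in> Z \<and> (\<Lambda>', \<Lambda>) \<in> R \<and> \<Lambda>' \<noteq> \<Lambda>. Dscale (u \<Lambda>') (S \<Lambda>'))) \<and>
     (\<forall>\<Lambda>\<in>Z. \<forall>\<Lambda>'\<in>Z. \<not> similar \<Lambda> \<Lambda>' \<longrightarrow> pairingD r \<alpha> n D \<theta> (P Plus \<Lambda>) (P Minus \<Lambda>') = 0) \<and>
     (\<forall>\<sigma>. \<forall>\<Lambda>\<in>Z. spec0 (P \<sigma> \<Lambda>) = S \<Lambda>)" (is "\<exists>!P. ?fam P \<and> ?tri P \<and> ?orth P \<and> ?spec P")
proof -
  obtain G where G: "\<And>L L'. L \<in> Z \<Longrightarrow> L' \<in> Z \<Longrightarrow> G L L' \<in> ratA r"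
    "\<And>L L'. L \<in> Z \<Longrightarrow> L' \<in> Z \<Longrightarrow> rat_at0 (G L L') = (if L = L' then 1 else 0)"
    and pair: "\<And>c c'. pairingD r \<alpha> n D \<theta> (schur_comb c) (schur_comb c') = bilin Z G c c'"
    by (rule pairing_schur_comb) blast
  let ?Gt = "\<lambda>L L'. G L' L" and ?J = "below R"
  note J = below_subset[OF R] and J_trans = below_trans[OF R]
  obtain up where up: "\<And>L i. L \<in> Z \<Longrightarrow> i \<in> ?J L \<Longrightarrow> up L i \<in> ratA r"
    "\<And>L i. L \<in> Z \<Longrightarrow> i \<in> ?J L \<Longrightarrow> rat_at0 (up L i) = 0"
    and up_eq: "\<And>L j. L \<in> Z \<Longrightarrow> j \<in> ?J L \<Longrightarrow> G L j + (\<Sum>i\<in>?J L. up L i * G i j) = 0"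
    and up_unique: "\<And>L w i. L \<in> Z \<Longrightarrow> (\<And>j. j \<in> ?J L \<Longrightarrow> G L j + (\<Sum>i\<in>?J L. w i * G i j) = 0) \<Longrightarrow>
       i \<in> ?J L \<Longrightarrow> w i = up L i"
    by (rule triangular_solution[OF R, of G]) (use G in auto)
  obtain um where um: "\<And>L i. L \<in> Z \<Longrightarrow> i \<in> ?J L \<Longrightarrow> um L i \<in> ratA r"
    "\<And>L i. L \<in> Z \<Longrightarrow> i \<in> ?J L \<Longrightarrow> rat_at0 (um L i) = 0"
    and um_eq: "\<And>L j. L \<in> Z \<Longrightarrow> j \<in> ?J L \<Longrightarrow> ?Gt L j + (\<Sum>i\<in>?J L. um L i * ?Gt i j) = 0"
    and um_unique: "\<And>L w i. L \<in> Z \<Longrightarrow> (\<And>j. j \<in> ?J L \<Longrightarrow> ?Gt L j + (\<Sum>i\<in>?J L. w i * ?Gt i j) = 0) \<Longrightarrow>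
       i \<in> ?J L \<Longrightarrow> w i = um L i"
    by (rule triangular_solution[OF R, of ?Gt]) (use G in auto)
  define w where "w \<sigma> = (case \<sigma> of Plus \<Rightarrow> up | Minus \<Rightarrow> um)" for \<sigma>
  have w: "w \<sigma> L i \<in> ratA r" "rat_at0 (w \<sigma> L i) = 0" if "L \<in> Z" "i \<in> ?J L" for \<sigma> L i
    using up um that by (cases \<sigma>; simp add: w_def)+
  define P where "P \<sigma> = restrict (\<lambda>L. schur_comb (unitri ?J L (w \<sigma> L))) Z" for \<sigma>
  have P: "P \<sigma> L = schur_comb (unitri ?J L (w \<sigma> L))" if "L \<in> Z" for \<sigma> L
    using that by (simp add: P_def)
  have coeff: "unitri ?J L (w \<sigma> L) i \<in> ratA r" if "L \<in> Z" for \<sigma> L i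
    using w[OF that] ratA.zero_mem ratA.one_mem by (simp add: unitri_def)
  have "?fam P"
  proof
    fix \<sigma>
    have "schur_comb (unitri ?J L (w \<sigma> L)) \<in> XiA r s e \<alpha> n D \<theta>" if "L \<in> Z" for L
      using coeff[OF that] unfolding XiA_eq by blast
    then show "P \<sigma> \<in> Z \<rightarrow>\<^sub>E XiA r s e \<alpha> n D \<theta>" unfolding P_def by (simp add: restrict_PiE_iff)
  qed
  moreover have "?tri P"
  proof (intro allI ballI)
    fix \<sigma> L assume L: "L \<in> Z"
    let ?u = "\<lambda>i. if i \<in> ?J L then w \<sigma> L i else 0"
    have "(\<Sum>i\<in>?J L. Dscale (w \<sigma> L i) (S i)) = (\<Sum>i\<in>?J L. Dscale (?u i) (S i))"
      by (rule sum.cong) auto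
    also have "\<dots> = (\<Sum>L' | L' \<in> Z \<and> (L', L) \<in> R \<and> L' \<noteq> L. Dscale (?u L') (S L'))"
      by (rule below_expansion[OF R L, symmetric]) (simp add: below_def)
    finally have "P \<sigma> L = S L + (\<Sum>L' | L' \<in> Z \<and> (L', L) \<in> R \<and> L' \<noteq> L. Dscale (?u L') (S L'))"
      by (simp add: P[OF L] schur_comb_unitri[OF R L])
    moreover have "\<forall>L'\<in>Z. ?u L' \<in> ratA r \<and> (similar L' L \<longrightarrow> ?u L' = 0)"
      using w(1)[OF L] ratA.zero_mem by (simp add: below_def)
    ultimately show "\<exists>u. (\<forall>L'\<in>Z. u L' \<in> ratA r \<and> (similar L' L \<longrightarrow> u L' = 0)) \<and>
        P \<sigma> L = S L + (\<Sum>L' | L' \<in> Z \<and> (L', L) \<in> R \<and> L' \<noteq> L. Dscale (u L') (S L'))"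
      by (intro exI[of _ ?u] conjI)
  qed
  moreover have "?orth P"
  proof (intro ballI impI)
    fix L L' assume L: "L \<in> Z" "L' \<in> Z" "\<not> similar L L'"
    have "bilin Z G (unitri ?J L (up L)) (unitri ?J L' (um L')) = 0"
      using below_total[OF R L]
    proof
      assume "L' \<in> ?J L"
      then show ?thesis
        using equations_imp_orthogonal[OF finite_Z J J_trans, where G = G and L = L and u = "up L" and j = L'] up_eq[OF L(1)] L(1) by blast
    next
      assume "L \<in> ?J L'"
      then have "bilin Z ?Gt (unitri ?J L' (um L')) (unitri ?J L (up L)) = 0"
        using equations_imp_orthogonal[OF finite_Z J J_trans, where G = ?Gt and L = L' and u = "um L'" and j = L] um_eq[OF L(2)] L(2) by blast
      then show ?thesis using bilin_flip[of Z G] by simp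
    qed
    then show "pairingD r \<alpha> n D \<theta> (P Plus L) (P Minus L') = 0"
      by (simp add: P[OF L(1)] P[OF L(2)] pair w_def)
  qed
  moreover have "?spec P"
  proof (intro allI ballI)
    fix \<sigma> L assume L: "L \<in> Z"
    have "spec0 (P \<sigma> L) = schur_comb (\<lambda>i. rat_at0 (unitri ?J L (w \<sigma> L) i))"
      unfolding P[OF L] by (rule spec0_schur_comb) (rule coeff[OF L])
    also have "(\<lambda>i. rat_at0 (unitri ?J L (w \<sigma> L) i)) = unitri ?J L (\<lambda>_. 0)"
      using w(2)[OF L] ratA.res_zero ratA.res_one by (auto simp: unitri_def)
    finally show "spec0 (P \<sigma> L) = S L"
      by (simp add: schur_comb_unitri[OF R L] Dscale_zero)
  qed
  ultimately have ex: "?fam P \<and> ?tri P \<and> ?orth P \<and> ?spec P" by blast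
  have unique: "Q = P" if Q: "?fam Q" "?tri Q" "?orth Q" for Q
  proof -
    have "\<forall>\<sigma>. \<forall>L\<in>Z. \<exists>u. Q \<sigma> L = schur_comb (unitri ?J L u)"
    proof (intro allI ballI)
      fix \<sigma> L assume L: "L \<in> Z"
      obtain u where "\<forall>L'\<in>Z. u L' \<in> ratA r \<and> (similar L' L \<longrightarrow> u L' = 0)"
        "Q \<sigma> L = S L + (\<Sum>L' | L' \<in> Z \<and> (L', L) \<in> R \<and> L' \<noteq> L. Dscale (u L') (S L'))"
        using Q(2) L by blast
      then have "Q \<sigma> L = schur_comb (unitri ?J L u)"
        by (simp add: schur_comb_unitri[OF R L] below_expansion[OF R L])
      then show "\<exists>u. Q \<sigma> L = schur_comb (unitri ?J L u)" by (rule exI[of _ u])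
    qed
    then obtain x where x: "\<And>\<sigma> L. L \<in> Z \<Longrightarrow> Q \<sigma> L = schur_comb (unitri ?J L (x \<sigma> L))"
      by metis
    have orth: "bilin Z G (unitri ?J L (x Plus L)) (unitri ?J L' (x Minus L')) = 0"
      if "L \<in> Z" "L' \<in> Z" "\<not> similar L L'" for L L'
      using Q(3) that by (simp add: x[symmetric] pair[symmetric])
    have eqs: "x Plus L i = up L i \<and> x Minus L i = um L i" if L: "L \<in> Z" and i: "i \<in> ?J L" for L i
    proof
      have JZ: "j \<in> Z" "\<not> similar j L" "\<not> similar L j" if "j \<in> ?J L" for j
        using that similar_sym by (auto simp: below_def)
      have "G L j + (\<Sum>i\<in>?J L. x Plus L i * G i j) = 0" if "j \<in> ?J L" for j
        by (rule orthogonal_imp_equations[OF finite_Z J J_trans, where v = "x Minus"]) (use orth L JZ that in auto)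
      then show "x Plus L i = up L i" using up_unique[OF L _ i] by blast
      have flip: "bilin Z ?Gt (unitri ?J L (x Minus L)) (unitri ?J j (x Plus j)) = 0" if "j \<in> ?J L" for j
        using orth[of j L] JZ[OF that] L bilin_flip[of Z G] by simp
      have "?Gt L j + (\<Sum>i\<in>?J L. x Minus L i * ?Gt i j) = 0" if "j \<in> ?J L" for j
        by (rule orthogonal_imp_equations[OF finite_Z J J_trans, where v = "x Plus" and G = ?Gt]) (use flip L that in auto)
      then show "x Minus L i = um L i" using um_unique[OF L _ i] by blast
    qed
    have "unitri ?J L (x \<sigma> L) = unitri ?J L (w \<sigma> L)" if "L \<in> Z" for \<sigma> L
      using eqs[OF that] by (cases \<sigma>) (auto simp: unitri_def w_def)
    then have on: "Q \<sigma> L = P \<sigma> L" if "L \<in> Z" for \<sigma> L using that by (simp add: x P)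
    have "Q \<sigma> = P \<sigma>" for \<sigma>
    proof (rule extensionalityI[of _ Z])
      show "Q \<sigma> \<in> extensional Z" using Q(1) by (simp add: PiE_def)
      show "P \<sigma> \<in> extensional Z" unfolding P_def by simp
    qed (rule on)
    then show ?thesis by blast
  qed
  show ?thesis
    by (rule ex1I[of _ P]) (use ex unique in blast)+
qed

end

theorem proposition3p6:
  fixes r n \<alpha> e :: nat
    and s :: "nat \<Rightarrow> nat"
    and D :: "nat list set"
    and \<theta> :: "nat list \<Rightarrow> nat list list \<Rightarrow> nat list list"
    and R :: "symbol rel"
  defines "Z \<equiv> symbolsD r s e \<alpha> n D"
    and "S \<equiv> (schurD r s e \<alpha> n \<theta> :: symbol \<Rightarrow> ratT Dseries)"
  assumes "r \<ge> 1" and "\<alpha> < r" and "\<forall>k<r. s k \<le> e"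
    and "finite D" and "D \<subseteq> defects r \<alpha>"
    and "\<forall>d\<in>D. symbols r s e \<alpha> n d \<noteq> {}"
    and "\<forall>d\<in>D. inj_on (\<theta> d) (mparts r (red_rank r \<alpha> n d)) \<and>
                \<theta> d ` mparts r (red_rank r \<alpha> n d) \<subseteq> mparts r n"
    and "symbol_order r s e \<alpha> Z R"
  shows "\<exists>!P :: sign \<Rightarrow> symbol \<Rightarrow> ratT Dseries.
     (\<forall>\<sigma>. P \<sigma> \<in> Z \<rightarrow>\<^sub>E XiA r s e \<alpha> n D \<theta>) \<and>
     (\<forall>\<sigma>. \<forall>\<Lambda>\<in>Z. \<exists>u. (\<forall>\<Lambda>'\<in>Z. u \<Lambda>' \<in> ratA r \<and> (similar \<Lambda>' \<Lambda> \<longrightarrow> u \<Lambda>' = 0)) \<and>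
        P \<sigma> \<Lambda> = S \<Lambda> + (\<Sum>\<Lambda>' | \<Lambda>' \<in> Z \<and> (\<Lambda>', \<Lambda>) \<in> R \<and> \<Lambda>' \<noteq> \<Lambda>. Dscale (u \<Lambda>') (S \<Lambda>'))) \<and>
     (\<forall>\<Lambda>\<in>Z. \<forall>\<Lambda>'\<in>Z. \<not> similar \<Lambda> \<Lambda>' \<longrightarrow> pairingD r \<alpha> n D \<theta> (P Plus \<Lambda>) (P Minus \<Lambda>') = 0) \<and>
     (\<forall>\<sigma>. \<forall>\<Lambda>\<in>Z. spec0 (P \<sigma> \<Lambda>) = schurD r s e \<alpha> n \<theta> \<Lambda>)"
proof -
  interpret symbol_setting r n \<alpha> e s D \<theta>
    using assms(3,6-9) by unfold_locales auto
  show ?thesis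
    unfolding Z_def S_def by (rule exists_unique_families) (use assms(10) in \<open>simp add: Z_def\<close>)
qed

end
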